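(* Let $F\in\{\mathbb R,\mathbb C\}$, let $(G,H)$ be a unitary GGP pair over $F$, let $\tau\in\mathfrak g^\wedge$ and let $0\ne z\in\mathfrak z_H$. The following are equivalent: (i) $\tau$ is stable; (ii) $\tau\in\mathfrak g^\wedge$ and its restriction $\tau_H\in\mathfrak h^\wedge$ are both regular, and the bilinear form \[\mathfrak g_\tau/\mathfrak z\otimes\mathfrak h_{\tau_H}\to F,\qquad (x,y)\mapsto\langle[z,[x,y]],\tau\rangle\] is nondegenerate.
   Context: $(G,H)=(\mathrm U(V),\mathrm U(V_H))$ with $V$ an $(n+1)$-dimensional nondegenerate hermitian module over a quadratic étale $F$-algebra $E$, $V_H=(Ee)^\perp$. $\mathfrak g,\mathfrak h$ Lie algebras, $\mathfrak z,\mathfrak z_H$ their centers, $\mathfrak g^\wedge=\mathrm{Hom}(\mathfrak g,i\mathbb R)$ with coadjoint action $[x,\xi]$ and pairing $\langle x,\xi\rangle$. $\mathfrak g_\tau=\{x\in\mathfrak g:[x,\tau]=0\}$, similarly $\mathfrak h_{\tau_H}$. Regular: centralizer of minimal dimension. Stable: finite $H$-stabilizer and closed $H$-orbit. *)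

theory Defs
  imports "HOL-Analysis.Analysis" "HOL-Library.Function_Algebras"
begin

text \<open>
  The ground field: up to isomorphism the members of this class are exactly the real and the
  complex numbers.  Multiplicativity of the norm forces \<open>c \<bullet> 1\<close> to be the real part of \<open>c\<close>.
\<close>

class real_or_complex = real_normed_field + real_inner +
  assumes real_or_complex:
    "(\<forall>c. \<exists>r. c = r *\<^sub>R 1) \<or>
     (\<exists>j. j * j = - 1 \<and> (\<forall>c. \<exists>r s. c = r *\<^sub>R 1 + s *\<^sub>R j))"

instance real :: real_or_complex
proof
  have "\<forall>c::real. \<exists>r. c = r *\<^sub>R 1"
    by auto
  then show "(\<forall>c::real. \<exists>r. c = r *\<^sub>R 1) \<or>
     (\<exists>j::real. j * j = - 1 \<and> (\<forall>c. \<exists>r s. c = r *\<^sub>R 1 + s *\<^sub>R j))" ..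
qed

instance complex :: real_or_complex
proof
  have "\<exists>r s. c = r *\<^sub>R 1 + s *\<^sub>R \<i>" for c
    by (rule exI[of _ "Re c"], rule exI[of _ "Im c"]) (simp add: complex_eq_iff)
  then show "(\<forall>c::complex. \<exists>r. c = r *\<^sub>R 1) \<or>
     (\<exists>j::complex. j * j = - 1 \<and> (\<forall>c. \<exists>r s. c = r *\<^sub>R 1 + s *\<^sub>R j))"
    by (intro disjI2 exI[of _ \<i>]) simp
qed

text \<open>
  A quadratic etale \<open>F\<close>-algebra is \<open>F[X]/(X\<^sup>2 - b X - c)\<close> with nonzero discriminant.
  Its canonical involution is its unique nontrivial \<open>F\<close>-algebra automorphism.
\<close>

locale quadratic_etale =
  fixes emb :: "'f::real_or_complex \<Rightarrow> 'e::comm_ring_1"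
    and cj :: "'e \<Rightarrow> 'e"
  assumes emb_add: "emb (a + b) = emb a + emb b"
    and emb_mult: "emb (a * b) = emb a * emb b"
    and emb_one: "emb 1 = 1"
    and etale: "\<exists>\<omega> b c. \<omega> * \<omega> = emb b * \<omega> + emb c \<and> b\<^sup>2 + 4 * c \<noteq> 0 \<and>
                  (\<forall>x. \<exists>!pq. x = emb (fst pq) + emb (snd pq) * \<omega>)"
    and cj_add: "cj (x + y) = cj x + cj y"
    and cj_mult: "cj (x * y) = cj x * cj y"
    and cj_emb: "cj (emb a) = emb a"
    and cj_cj: "cj (cj x) = x"
    and cj_nontrivial: "cj \<noteq> id"

locale hermitian_module = quadratic_etale emb cj + module scl
  for emb :: "'f::real_or_complex \<Rightarrow> 'e::comm_ring_1"
    and cj :: "'e \<Rightarrow> 'e"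
    and scl :: "'e \<Rightarrow> 'v::ab_group_add \<Rightarrow> 'v"
    and form :: "'v \<Rightarrow> 'v \<Rightarrow> 'e" +
  assumes form_add: "form (u + v) w = form u w + form v w"
    and form_scale: "form (scl a u) v = a * form u v"
    and form_cj: "form v u = cj (form u v)"
    and form_nondegenerate: "(\<And>v. form u v = 0) \<Longrightarrow> u = 0"

text \<open>
  \<open>V\<close> is free of rank \<open>n + 1\<close>; the invertibility of \<open>\<langle>e, e\<rangle>\<close> is what makes
  \<open>V = E e \<oplus> V\<^sub>H\<close> with \<open>V\<^sub>H\<close> again nondegenerate.
\<close>

locale unitary_ggp = hermitian_module emb cj scl form
  for emb :: "'f::real_or_complex \<Rightarrow> 'e::comm_ring_1"
    and cj :: "'e \<Rightarrow> 'e"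
    and scl :: "'e \<Rightarrow> 'v::ab_group_add \<Rightarrow> 'v"
    and form :: "'v \<Rightarrow> 'v \<Rightarrow> 'e"
    and n :: nat
    and e :: 'v +
  assumes rank: "\<exists>B. finite B \<and> card B = n + 1 \<and> module.independent scl B \<and>
                   module.span scl B = UNIV"
    and form_e_unit: "form e e dvd 1"

definition orth :: "('v \<Rightarrow> 'v \<Rightarrow> 'e::zero) \<Rightarrow> 'v set \<Rightarrow> 'v set" where
  "orth form W = {v. \<forall>w\<in>W. form v w = 0}"

definition ggp_VH :: "('e \<Rightarrow> 'v \<Rightarrow> 'v) \<Rightarrow> ('v \<Rightarrow> 'v \<Rightarrow> 'e::zero) \<Rightarrow> 'v \<Rightarrow> 'v set" where
  "ggp_VH scl form e = orth form (range (\<lambda>a. scl a e))"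

text \<open>
  For a nondegenerate submodule \<open>W\<close>, the group \<open>U(W)\<close> and its Lie algebra are realized inside
  \<open>End(V)\<close>, acting on \<open>W\<^sup>\<bottom>\<close> as the identity and as zero respectively.
\<close>

definition unitary_group ::
    "('e::comm_ring_1 \<Rightarrow> 'v::ab_group_add \<Rightarrow> 'v) \<Rightarrow> ('v \<Rightarrow> 'v \<Rightarrow> 'e) \<Rightarrow> 'v set \<Rightarrow> ('v \<Rightarrow> 'v) set"
  where
  "unitary_group scl form W =
     {g. module_hom scl scl g \<and> bij g \<and> (\<forall>u v. form (g u) (g v) = form u v) \<and>
         (\<forall>v\<in>orth form W. g v = v)}"

definition unitary_lie ::
    "('e::comm_ring_1 \<Rightarrow> 'v::ab_group_add \<Rightarrow> 'v) \<Rightarrow> ('v \<Rightarrow> 'v \<Rightarrow> 'e) \<Rightarrow> 'v set \<Rightarrow> ('v \<Rightarrow> 'v) set"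
  where
  "unitary_lie scl form W =
     {x. module_hom scl scl x \<and> (\<forall>u v. form (x u) v + form u (x v) = 0) \<and>
         (\<forall>v\<in>orth form W. x v = 0)}"

definition lie_bracket :: "('v \<Rightarrow> 'v) \<Rightarrow> ('v \<Rightarrow> 'v) \<Rightarrow> 'v \<Rightarrow> 'v::ab_group_add" where
  "lie_bracket x y = (\<lambda>v. x (y v) - y (x v))"

definition lie_center :: "('v \<Rightarrow> 'v::ab_group_add) set \<Rightarrow> ('v \<Rightarrow> 'v) set" where
  "lie_center L = {x\<in>L. \<forall>y\<in>L. lie_bracket x y = 0}"

definition end_scale ::
    "('f \<Rightarrow> 'e) \<Rightarrow> ('e \<Rightarrow> 'v \<Rightarrow> 'v) \<Rightarrow> 'f \<Rightarrow> ('v \<Rightarrow> 'v) \<Rightarrow> 'v \<Rightarrow> 'v" where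
  "end_scale emb scl c x = (\<lambda>v. scl (emb c) (x v))"

text \<open>
  The real-linear maps from \<open>L\<close> to \<open>i\<real>\<close>, extended by zero outside \<open>L\<close>.  The product topology on
  the ambient function type restricts to the usual one on this finite-dimensional real space.
\<close>

definition lie_dual ::
    "('f::real_or_complex \<Rightarrow> 'e) \<Rightarrow> ('e \<Rightarrow> 'v \<Rightarrow> 'v) \<Rightarrow> ('v \<Rightarrow> 'v::ab_group_add) set \<Rightarrow>
     (('v \<Rightarrow> 'v) \<Rightarrow> complex) set" where
  "lie_dual emb scl L =
     {\<xi>. (\<forall>x\<in>L. \<forall>y\<in>L. \<xi> (x + y) = \<xi> x + \<xi> y) \<and>
         (\<forall>r. \<forall>x\<in>L. \<xi> (end_scale emb scl (of_real r) x) = of_real r * \<xi> x) \<and>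
         (\<forall>x\<in>L. Re (\<xi> x) = 0) \<and> (\<forall>x. x \<notin> L \<longrightarrow> \<xi> x = 0)}"

definition dual_restrict ::
    "('v \<Rightarrow> 'v) set \<Rightarrow> (('v \<Rightarrow> 'v) \<Rightarrow> complex) \<Rightarrow> ('v \<Rightarrow> 'v) \<Rightarrow> complex" where
  "dual_restrict M \<xi> = (\<lambda>x. if x \<in> M then \<xi> x else 0)"

definition coad ::
    "('v \<Rightarrow> 'v::ab_group_add) set \<Rightarrow> ('v \<Rightarrow> 'v) \<Rightarrow> (('v \<Rightarrow> 'v) \<Rightarrow> complex) \<Rightarrow> ('v \<Rightarrow> 'v) \<Rightarrow> complex"
  where
  "coad L x \<xi> = (\<lambda>y. if y \<in> L then - \<xi> (lie_bracket x y) else 0)"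

definition Coad ::
    "('v \<Rightarrow> 'v) set \<Rightarrow> ('v \<Rightarrow> 'v) \<Rightarrow> (('v \<Rightarrow> 'v) \<Rightarrow> complex) \<Rightarrow> ('v \<Rightarrow> 'v) \<Rightarrow> complex"
  where
  "Coad L g \<xi> = (\<lambda>x. if x \<in> L then \<xi> (inv g \<circ> x \<circ> g) else 0)"

definition lie_centralizer ::
    "('v \<Rightarrow> 'v::ab_group_add) set \<Rightarrow> (('v \<Rightarrow> 'v) \<Rightarrow> complex) \<Rightarrow> ('v \<Rightarrow> 'v) set" where
  "lie_centralizer L \<xi> = {x\<in>L. coad L x \<xi> = 0}"

definition lie_regular ::
    "('f::real_or_complex \<Rightarrow> 'e) \<Rightarrow> ('e \<Rightarrow> 'v \<Rightarrow> 'v) \<Rightarrow> ('v \<Rightarrow> 'v::ab_group_add) set \<Rightarrow>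
     (('v \<Rightarrow> 'v) \<Rightarrow> complex) \<Rightarrow> bool" where
  "lie_regular emb scl L \<xi> \<longleftrightarrow> \<xi> \<in> lie_dual emb scl L \<and>
     (\<forall>\<eta>\<in>lie_dual emb scl L.
        vector_space.dim (end_scale emb scl) (lie_centralizer L \<xi>)
        \<le> vector_space.dim (end_scale emb scl) (lie_centralizer L \<eta>))"

definition lie_stable ::
    "('v \<Rightarrow> 'v) set \<Rightarrow> ('v \<Rightarrow> 'v) set \<Rightarrow> (('v \<Rightarrow> 'v) \<Rightarrow> complex) \<Rightarrow> bool" where
  "lie_stable L H \<xi> \<longleftrightarrow> finite {g\<in>H. Coad L g \<xi> = \<xi>} \<and> closed ((\<lambda>g. Coad L g \<xi>) ` H)"

text \<open>
  The \<open>F\<close>-valued pairing attached to \<open>\<xi> : L \<rightarrow> i\<real>\<close>: the \<open>F\<close>-linear form with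
  \<open>\<xi> x = i Re \<langle>x, \<xi>\<rangle>\<close>.  For \<open>F = \<real>\<close> this is \<open>\<xi> x / i\<close>.
\<close>

definition pairing ::
    "('f::real_or_complex \<Rightarrow> 'e) \<Rightarrow> ('e \<Rightarrow> 'v \<Rightarrow> 'v) \<Rightarrow> ('v \<Rightarrow> 'v) \<Rightarrow> (('v \<Rightarrow> 'v) \<Rightarrow> complex) \<Rightarrow> 'f"
  where
  "pairing emb scl x \<xi> =
     (THE c. \<forall>a. \<xi> (end_scale emb scl a x) = \<i> * of_real ((a * c) \<bullet> 1))"

text \<open>
  Nondegeneracy, on both sides, of the form induced by \<open>b\<close> on \<open>A/Z \<otimes> B\<close>.  The inclusion of
  \<open>Z\<close> in the left radical says that \<open>b\<close> descends to the quotient.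
\<close>

definition nondegenerate_mod ::
    "'a set \<Rightarrow> 'a set \<Rightarrow> 'b::zero set \<Rightarrow> ('a \<Rightarrow> 'b \<Rightarrow> 'c::zero) \<Rightarrow> bool" where
  "nondegenerate_mod A Z B b \<longleftrightarrow>
     {x\<in>A. \<forall>y\<in>B. b x y = 0} = Z \<and> {y\<in>B. \<forall>x\<in>A. b x y = 0} = {0}"

lemma (in hermitian_module) vector_space_end: "vector_space (end_scale emb scl)"
  by unfold_locales
     (auto simp: end_scale_def fun_eq_iff emb_add emb_mult emb_one algebra_simps)

lemma real_or_complex_functional:
  fixes f :: "'f::real_or_complex \<Rightarrow> real"
  assumes "linear f"
  shows "\<exists>!c. \<forall>a. f a = (a * c) \<bullet> 1"
proof -
  interpret linear f by fact
  have one: "(1::'f) \<bullet> 1 = 1"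
    by (simp add: dot_square_norm)
  have unique: "c = d" if "\<forall>a. f a = (a * c) \<bullet> 1" "\<forall>a. f a = (a * d) \<bullet> 1" for c d
  proof (rule ccontr)
    assume "c \<noteq> d"
    have "(inverse (c - d) * (c - d)) \<bullet> 1 = 0"
      using that by (simp only: right_diff_distrib inner_diff_left)
    with \<open>c \<noteq> d\<close> one show False by simp
  qed
  have "\<exists>c. \<forall>a. f a = (a * c) \<bullet> 1"
    using real_or_complex[where 'a = 'f, folded of_real_def, unfolded scaleR_conv_of_real]
  proof
    assume real: "\<forall>c::'f. \<exists>r. c = of_real r"
    have "f a = (a * of_real (f 1)) \<bullet> 1" for a
    proof -
      obtain r where "a = of_real r" using real by blast
      then show ?thesis
        using scale[of r 1] one by (simp add: of_real_def)
    qed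
    then show ?thesis by blast
  next
    assume "\<exists>j::'f. j * j = - 1 \<and> (\<forall>c. \<exists>r s. c = of_real r + of_real s * j)"
    then obtain j :: 'f where j: "j * j = - 1"
      and gen: "\<And>c. \<exists>r s. c = of_real r + of_real s * j" by blast
    have "norm j * norm j = 1"
      using j by (metis norm_minus_cancel norm_mult norm_one)
    then have nj: "norm j = 1"
      by (metis abs_norm_cancel real_sqrt_abs2 real_sqrt_one)
    have "(1 + j) * (1 + j) = 2 * j"
      using j by (simp add: algebra_simps)
    then have "norm (1 + j) * norm (1 + j) = 2"
      by (metis norm_mult nj mult.right_neutral norm_numeral)
    then have "(1 + j) \<bullet> (1 + j) = 2"
      by (simp add: dot_square_norm power2_eq_square)
    moreover have "j \<bullet> j = 1"
      by (simp add: dot_square_norm nj)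
    ultimately have j1: "j \<bullet> 1 = 0"
      using one by (simp add: inner_add_left inner_add_right inner_commute)
    let ?c = "of_real (f 1) - of_real (f j) * j"
    have "f a = (a * ?c) \<bullet> 1" for a
    proof -
      obtain r s where a: "a = of_real r + of_real s * j" using gen by blast
      have "a * ?c = of_real (r * f 1 + s * f j) + of_real (s * f 1 - r * f j) * j
                     - of_real (s * f j) * (j * j + 1)"
        by (simp add: a algebra_simps)
      then have "(a * ?c) \<bullet> 1 = r * f 1 + s * f j"
        unfolding j using one j1
        by (simp add: inner_add_left of_real_def flip: scaleR_conv_of_real)
      moreover have "f a = r * f 1 + s * f j"
        unfolding a using scale[of r 1] scale[of s j]
        by (simp add: add of_real_def)
      ultimately show ?thesis by simp
    qed
    then show ?thesis by blast
  qed
  with unique show ?thesis by blast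
qed

lemma (in hermitian_module) pairing_eq:
  assumes \<xi>: "\<xi> \<in> lie_dual emb scl L" and x: "x \<in> L"
    and L: "\<And>a x. x \<in> L \<Longrightarrow> end_scale emb scl a x \<in> L"
  shows "\<xi> (end_scale emb scl a x) = \<i> * of_real ((a * pairing emb scl x \<xi>) \<bullet> 1)"
proof -
  let ?f = "\<lambda>a. Im (\<xi> (end_scale emb scl a x))"
  have add: "end_scale emb scl (a + b) x = end_scale emb scl a x + end_scale emb scl b x" for a b
    by (simp add: end_scale_def fun_eq_iff emb_add scale_left_distrib)
  have mult: "end_scale emb scl (r *\<^sub>R a) x = end_scale emb scl (of_real r) (end_scale emb scl a x)"
    for r a
    by (simp add: end_scale_def fun_eq_iff emb_mult scaleR_conv_of_real)
  have "linear ?f"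
    by (rule linearI) (use \<xi> x L in \<open>auto simp: add mult lie_dual_def\<close>)
  moreover have "\<xi> (end_scale emb scl a x) = \<i> * of_real t \<longleftrightarrow> ?f a = t" for a t
    using \<xi> L[OF x, of a] by (auto simp: lie_dual_def complex_eq_iff)
  ultimately have "\<exists>!c. \<forall>a. \<xi> (end_scale emb scl a x) = \<i> * of_real ((a * c) \<bullet> 1)"
    using real_or_complex_functional[of ?f] by simp
  from theI'[OF this] show ?thesis
    unfolding pairing_def by blast
qed

end

theory Submission
  imports Defs
begin

text \<open>
  Through the trace form, \<open>\<tau>\<close> is represented by a skew endomorphism \<open>T\<close> of \<open>V\<close>, and \<open>\<tau>\<^sub>H\<close> by its
  compression \<open>T\<^sub>H\<close> to \<open>V\<^sub>H\<close>.  Both conditions are equivalent to \<open>E[T] e = V\<close>.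

  If \<open>E[T] e = V\<close>, the stabilizer of \<open>\<tau>\<close> is trivial and its orbit is cut out by the moments
  \<open>\<langle>T\<^sup>i e, e\<rangle>\<close>.  Otherwise \<open>N = (E[T] e)\<^sup>\<bottom>\<close> is a nonzero \<open>T\<close>-stable submodule of \<open>V\<^sub>H\<close>.  If \<open>N\<close> is
  nondegenerate, the norm one elements of \<open>E\<close> acting on \<open>N\<close> stabilize \<open>\<tau>\<close>; if not, a one-parameter
  group contracting the radical of \<open>N\<close> moves \<open>\<tau>\<close> to a limit with infinite stabilizer.

  With \<open>z\<close> acting on \<open>V\<^sub>H\<close> as the scalar \<open>a\<close>, the bilinear form is the trace to \<open>F\<close> of
  \<open>a \<langle>e, e\<rangle>\<^sup>-\<^sup>1 \<langle>y T e, x e\<rangle>\<close>.  If \<open>E[T] e = V\<close>, the vectors \<open>x e\<close> and \<open>y T e\<close> fill \<open>V\<close> and \<open>V\<^sub>H\<close>, which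
  gives nondegeneracy, and regularity holds because cyclicity is an open condition on lines through
  \<open>T\<close> and determines the dimension of the centralizer.  Conversely, regularity of \<open>\<tau>\<^sub>H\<close> makes the
  centralizer of \<open>T\<^sub>H\<close> commutative; if \<open>N \<noteq> 0\<close>, it therefore preserves the image \<open>N\<^sub>1 \<noteq> 0\<close> of some
  endomorphism commuting with \<open>T\<^sub>H\<close> and having values in \<open>N\<close>, and an endomorphism commuting with \<open>T\<close>
  with values in \<open>N\<^sub>1\<close> yields an element of the left radical that is not central.
\<close>

subsection \<open>Finite-dimensional subspaces and linear pencils\<close>

text \<open>\<open>E\<close> is only etale: it may be the split algebra F x F, and always is when F
  is complex. Submodules of V then need not have bases over \<open>E\<close>, so every dimension
  count takes place over F. The way back to \<open>E\<close> is a unit \<open>\<delta>\<close> with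
  \<open>cj \<delta> = - \<delta>\<close> and square in F: multiplication by it exchanges skew and
  hermitian maps, so the commutant of a skew T in End(V) is C + \<open>\<delta>\<close> C, with C
  its part in the Lie algebra.

  Genericity is obtained without determinants: on a finite-dimensional space, a pencil A + t B with
  A injective is injective for all but finitely many t.

  Two obstacles shape the last part. The form in (ii) only sees a trace with values in F, so an
  \<open>E\<close>-valued product has to be shown to be skew before its vanishing can be concluded.
  Conversely, N itself need not be stable under the centralizer of \<open>T\<^sub>H\<close>, which
  is why it is replaced by the image of a map commuting with \<open>T\<^sub>H\<close>.\<close>

context vector_space
begin

lemma subspace_finite_basis:
  assumes "finite D" "X \<subseteq> span D" "subspace X"
  obtains A where "finite A" "A \<subseteq> X" "independent A" "span A = X" "card A = dim X"
proof -
  obtain A where A: "A \<subseteq> X" "independent A" "X \<subseteq> span A"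
    using maximal_independent_subset[of X] by blast
  have "finite A"
    using independent_span_bound[OF assms(1) A(2)] A(1) assms(2) by blast
  moreover have "span A = X"
    using A assms(3) by (intro span_subspace) auto
  ultimately show ?thesis
    using that A basis_card_eq_dim by metis
qed

lemma dim_mono_finite:
  assumes "finite D" "Y \<subseteq> span D" "subspace X" "subspace Y" "X \<subseteq> Y"
  shows "dim X \<le> dim Y"
proof -
  obtain A where A: "finite A" "A \<subseteq> Y" "span A = Y" "card A = dim Y"
    using subspace_finite_basis[OF assms(1,2,4)] by metis
  then show ?thesis
    using dim_le_card[of X A] assms(5) by simp
qed

lemma independent_Un_direct:
  assumes "finite A" "finite B" "independent A" "independent B" "span A \<inter> span B = {0}"
  shows "independent (A \<union> B)" "A \<inter> B = {}"
proof -
  show disj: "A \<inter> B = {}"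
  proof (rule ccontr)
    assume "A \<inter> B \<noteq> {}"
    then obtain a where a: "a \<in> A" "a \<in> B" by blast
    then have "a = 0" using assms(5) span_base by blast
    then show False using a assms(3) dependent_zero by blast
  qed
  have "u v = 0" if s: "(\<Sum>v\<in>A \<union> B. scale (u v) v) = 0" and v: "v \<in> A \<union> B" for u v
  proof -
    let ?a = "\<Sum>v\<in>A. scale (u v) v" and ?b = "\<Sum>v\<in>B. scale (u v) v"
    have ab: "?a + ?b = 0"
      using s by (simp add: sum.union_disjoint assms disj)
    have "?a \<in> span A" "?b \<in> span B"
      by (auto intro!: span_sum intro: span_scale span_base)
    moreover have "?a = - ?b" using ab by (simp add: eq_neg_iff_add_eq_0)
    ultimately have "?a \<in> span A \<inter> span B" using span_neg by auto
    then have "?a = 0" using assms(5) by blast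
    then have "?a = 0" "?b = 0" using ab by auto
    then show ?thesis
      using v independentD[OF assms(3,1) order_refl, of u v]
        independentD[OF assms(4,2) order_refl, of u v] by blast
  qed
  then show "independent (A \<union> B)"
    using assms(1,2) by (subst dependent_finite) auto
qed

lemma dim_direct_sum:
  assumes D: "finite D" and S: "S \<subseteq> span D" "subspace S" and X: "X \<subseteq> span D" "subspace X"
    and "S \<inter> X = {0}"
  shows "dim {s + x | s x. s \<in> S \<and> x \<in> X} = dim S + dim X"
proof -
  obtain A where A: "finite A" "independent A" "span A = S" "card A = dim S"
    using subspace_finite_basis[OF D S] by metis
  obtain B where B: "finite B" "independent B" "span B = X" "card B = dim X"
    using subspace_finite_basis[OF D X] by metis
  have "independent (A \<union> B)" "A \<inter> B = {}"
    using independent_Un_direct[of A B] A B assms(6) by auto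
  moreover have "span (A \<union> B) = {s + x | s x. s \<in> S \<and> x \<in> X}"
    using A B by (simp add: span_Un)
  ultimately show ?thesis
    using A B dim_span_eq_card_independent[of "A \<union> B"] by (simp add: card_Un_disjoint)
qed

lemma dim_disjoint_le:
  assumes D: "finite D" and L: "L \<subseteq> span D" "subspace L"
    and S: "S \<subseteq> L" "subspace S" and X: "X \<subseteq> L" "subspace X" and "S \<inter> X = {0}"
  shows "dim S + dim X \<le> dim L"
proof -
  have "dim {s + x | s x. s \<in> S \<and> x \<in> X} = dim S + dim X"
    using assms by (intro dim_direct_sum[of D]) auto
  moreover have "dim {s + x | s x. s \<in> S \<and> x \<in> X} \<le> dim L"
    by (rule dim_mono_finite[OF D L(1) subspace_sums L(2)])
       (use S X in \<open>auto intro!: subspace_add[OF L(2)]\<close>)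
  ultimately show ?thesis by simp
qed

lemma subspace_complement:
  assumes D: "finite D" and L: "L \<subseteq> span D" "subspace L" and K: "K \<subseteq> L" "subspace K"
  obtains C where "subspace C" "C \<subseteq> L" "K \<inter> C = {0}" "\<And>x. x \<in> L \<Longrightarrow> \<exists>k\<in>K. \<exists>c\<in>C. x = k + c"
    "dim L = dim K + dim C"
proof -
  obtain A where A: "finite A" "A \<subseteq> K" "independent A" "span A = K"
    using subspace_finite_basis[OF D order_trans[OF K(1) L(1)] K(2)] by metis
  obtain A' where A': "A \<subseteq> A'" "A' \<subseteq> L" "independent A'" "L \<subseteq> span A'"
    using maximal_independent_subset_extend[of A L] A K by blast
  let ?C = "span (A' - A)"
  have spL: "span A' = L" using A' L by (intro span_subspace) auto
  have 1: "?C \<subseteq> L" using spL span_mono[of "A' - A" A'] by auto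
  have 2: "x = 0" if "x \<in> K" "x \<in> ?C" for x
  proof -
    have xA: "x \<in> span A" using that A by simp
    have "representation A' x = representation A x"
      using A'(3) A'(1) xA by (intro representation_extend) auto
    moreover have "representation A' x = representation (A' - A) x"
      using A'(3) that by (intro representation_extend) auto
    ultimately have "representation A' x b = 0" for b
      using representation_ne_zero[of A x b] representation_ne_zero[of "A' - A" x b] by force
    moreover have "x \<in> span A'" using 1 that spL by auto
    ultimately show ?thesis
      using sum_nonzero_representation_eq[OF A'(3), of x] by simp
  qed
  have 3: "\<exists>k\<in>K. \<exists>c\<in>?C. x = k + c" if "x \<in> L" for x
  proof -
    have "A' = A \<union> (A' - A)" using A' by blast
    then have "x \<in> span (A \<union> (A' - A))" using that spL by simp
    then show ?thesis unfolding span_Un A(4) by blast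
  qed
  have int: "K \<inter> ?C = {0}" using 2 subspace_0[OF K(2)] span_zero by blast
  have "L = {k + c | k c. k \<in> K \<and> c \<in> ?C}"
    using 1 3 K(1) subspace_add[OF L(2)] by blast
  then have "dim L = dim K + dim ?C"
    using dim_direct_sum[OF D _ K(2) _ subspace_span int] 1 K(1) L(1) by auto
  then show ?thesis using that[OF subspace_span 1 int] 3 by blast
qed

text \<open>A vector of X missed by the span of the image of a basis would enlarge that image to an
  independent set with too many elements. Later the scalars are those of F, which yields
  surjectivity of \<open>E\<close>-linear maps although \<open>E\<close> need not be a
  field.\<close>

lemma injective_endo_surj_on:
  assumes D: "finite D" and X: "X \<subseteq> span D" "subspace X"
    and f: "Vector_Spaces.linear scale scale f" "f ` X \<subseteq> X" "\<And>x. x \<in> X \<Longrightarrow> f x = 0 \<Longrightarrow> x = 0"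
  shows "f ` X = X"
proof -
  interpret f: Vector_Spaces.linear scale scale f by fact
  obtain A where A: "finite A" "A \<subseteq> X" "independent A" "span A = X"
    using subspace_finite_basis[OF D X] by metis
  have inj: "inj_on f (span A)"
    unfolding A(4) using f(3) f.inj_on_iff_eq_0[OF X(2)] by blast
  then have ind: "independent (f ` A)" using f.independent_injective_image A by blast
  have card: "card (f ` A) = card A"
    by (rule card_image) (rule inj_on_subset[OF inj span_superset])
  have "X \<subseteq> span (f ` A)"
  proof (rule ccontr)
    assume "\<not> ?thesis"
    then obtain w where w: "w \<in> X" "w \<notin> span (f ` A)" by blast
    then have "independent (insert w (f ` A))" using ind by (simp add: independent_insert)
    moreover have "insert w (f ` A) \<subseteq> span A" using w A f(2) by auto
    ultimately have "card (insert w (f ` A)) \<le> card A"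
      using independent_span_bound[OF A(1)] by blast
    moreover have "w \<notin> f ` A" using w span_base by blast
    ultimately show False using card A(1) by simp
  qed
  then show ?thesis using f(2) A(4) by (simp add: f.span_image)
qed

end

lemma (in Vector_Spaces.linear) dim_image_inj:
  assumes "finite D" "X \<subseteq> vs1.span D" "vs1.subspace X" "\<And>x. x \<in> X \<Longrightarrow> f x = 0 \<Longrightarrow> x = 0"
  shows "vs2.dim (f ` X) = vs1.dim X"
proof -
  obtain A where A: "finite A" "A \<subseteq> X" "vs1.independent A" "vs1.span A = X" "card A = vs1.dim X"
    using vs1.subspace_finite_basis[OF assms(1-3)] by metis
  have inj: "inj_on f (vs1.span A)"
    unfolding A(4) using assms(4) inj_on_iff_eq_0[OF assms(3)] by blast
  have "card (f ` A) = card A"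
    by (rule card_image) (rule inj_on_subset[OF inj vs1.span_superset])
  moreover have "vs2.independent (f ` A)"
    using independent_injective_image A inj by blast
  moreover have "vs2.span (f ` A) = f ` X" using A by (simp add: span_image)
  ultimately show ?thesis using A(5) vs2.dim_span_eq_card_independent by metis
qed

text \<open>
  Kernel vectors of \<open>A + t B\<close> for distinct \<open>t\<close> are linearly independent: from a relation
  \<open>\<Sum> c\<^sub>t x\<^sub>t = 0\<close>, injectivity of \<open>A\<close> yields the shorter relation \<open>\<Sum> c\<^sub>t (t - s) / t x\<^sub>t = 0\<close>.
\<close>
lemma pencil_kernel_independent:
  fixes s1 :: "'f::field \<Rightarrow> 'a::ab_group_add \<Rightarrow> 'a" and s2 :: "'f \<Rightarrow> 'b::ab_group_add \<Rightarrow> 'b"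
  assumes A: "Vector_Spaces.linear s1 s2 A" and B: "Vector_Spaces.linear s1 s2 B"
    and X: "module.subspace s1 X" and inj: "\<And>x. x \<in> X \<Longrightarrow> A x = 0 \<Longrightarrow> x = 0"
    and "finite I" "\<And>t. t \<in> I \<Longrightarrow> x t \<in> X \<and> x t \<noteq> 0 \<and> A (x t) + s2 t (B (x t)) = 0"
    and "(\<Sum>t\<in>I. s1 (c t) (x t)) = 0"
  shows "\<forall>t\<in>I. c t = 0"
  using assms(5-)
proof (induction I arbitrary: c rule: finite_induct)
  case empty
  then show ?case by simp
next
  case (insert s I)
  interpret A: Vector_Spaces.linear s1 s2 A by fact
  interpret B: Vector_Spaces.linear s1 s2 B by fact
  have t0: "t \<noteq> 0" if "t \<in> insert s I" for t
    using insert.prems(1)[OF that] inj[of "x t"] by auto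
  have Bx: "B (x t) = s2 (- (1 / t)) (A (x t))" if "t \<in> insert s I" for t
  proof -
    have "A (x t) = - s2 t (B (x t))"
      using insert.prems(1)[OF that] by (simp add: eq_neg_iff_add_eq_0)
    then show ?thesis using t0[OF that] by simp
  qed
  let ?y = "\<Sum>t\<in>insert s I. s1 (c t * (t - s) / t) (x t)"
  have "A ?y = A (\<Sum>t\<in>insert s I. s1 (c t) (x t)) + s2 s (B (\<Sum>t\<in>insert s I. s1 (c t) (x t)))"
    unfolding A.sum B.sum A.vs2.scale_sum_right sum.distrib[symmetric]
  proof (rule sum.cong)
    fix t assume t: "t \<in> insert s I"
    show "A (s1 (c t * (t - s) / t) (x t)) = A (s1 (c t) (x t)) + s2 s (B (s1 (c t) (x t)))"
    proof -
      have k: "c t * (t - s) / t = c t + s * (c t * (- (1 / t)))"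
        using t0[OF t] by (simp add: field_simps)
      show ?thesis
        unfolding A.scale B.scale Bx[OF t] A.vs2.scale_scale A.vs2.scale_left_distrib[symmetric] k ..
    qed
  qed simp
  then have "A ?y = 0" using insert.prems(2) by simp
  moreover have "?y \<in> X"
    using insert.prems(1) by (intro A.vs1.subspace_sum[OF X] A.vs1.subspace_scale[OF X]) auto
  ultimately have "?y = 0" using inj by blast
  then have "(\<Sum>t\<in>I. s1 (c t * (t - s) / t) (x t)) = 0"
    using insert.hyps by simp
  then have "\<forall>t\<in>I. c t * (t - s) / t = 0"
    using insert.IH[of "\<lambda>t. c t * (t - s) / t"] insert.prems by auto
  then have I: "\<forall>t\<in>I. c t = 0" using t0 insert.hyps by auto
  then have "s1 (c s) (x s) = 0"
    using insert.prems(2) insert.hyps by simp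
  then show ?case using I insert.prems(1)[of s] by auto
qed

text \<open>More than \<open>card D\<close> singular parameters would give as many independent
  kernel vectors inside the span of \<open>D\<close>. This takes the place of a determinant that is
  a nonzero polynomial in t.\<close>

lemma finite_singular_pencil:
  fixes s1 :: "'f::field \<Rightarrow> 'a::ab_group_add \<Rightarrow> 'a" and s2 :: "'f \<Rightarrow> 'b::ab_group_add \<Rightarrow> 'b"
  assumes A: "Vector_Spaces.linear s1 s2 A" and B: "Vector_Spaces.linear s1 s2 B"
    and D: "finite D" "X \<subseteq> module.span s1 D" and X: "module.subspace s1 X"
    and inj: "\<And>x. x \<in> X \<Longrightarrow> A x = 0 \<Longrightarrow> x = 0"
  shows "finite {t. \<exists>x\<in>X. x \<noteq> 0 \<and> A x + s2 t (B x) = 0}" (is "finite ?T")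
proof (rule ccontr)
  assume "infinite ?T"
  then obtain I where I: "finite I" "card I = Suc (card D)" "I \<subseteq> ?T"
    using infinite_arbitrarily_large by blast
  interpret A: Vector_Spaces.linear s1 s2 A by fact
  have "\<forall>t\<in>I. \<exists>x. x \<in> X \<and> x \<noteq> 0 \<and> A x + s2 t (B x) = 0"
    using I(3) by blast
  from bchoice[OF this]
  obtain x where x: "\<And>t. t \<in> I \<Longrightarrow> x t \<in> X \<and> x t \<noteq> 0 \<and> A (x t) + s2 t (B (x t)) = 0"
    by blast
  have indep: "\<forall>t\<in>I. c t = 0" if "(\<Sum>t\<in>I. s1 (c t) (x t)) = 0" for c
    using pencil_kernel_independent[OF A B X inj I(1) x that] by blast
  have injx: "inj_on x I"
  proof (rule inj_onI, rule ccontr)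
    fix s t assume st: "s \<in> I" "t \<in> I" "x s = x t" "s \<noteq> t"
    let ?c = "\<lambda>r. if r = s then 1 else if r = t then - 1 else (0::'f)"
    have "(\<Sum>r\<in>I. s1 (?c r) (x r)) = (\<Sum>r\<in>{s,t}. s1 (?c r) (x r))"
      using st I(1) by (intro sum.mono_neutral_right) auto
    also have "\<dots> = 0" using st by simp
    finally show False using indep[of ?c] st by auto
  qed
  have "A.vs1.independent (x ` I)"
  proof (subst A.vs1.dependent_finite)
    show "\<not> (\<exists>u. (\<exists>v\<in>x ` I. u v \<noteq> 0) \<and> (\<Sum>v\<in>x ` I. s1 (u v) v) = 0)"
    proof clarify
      fix u t assume "(\<Sum>v\<in>x ` I. s1 (u v) v) = 0" "t \<in> I" "u (x t) \<noteq> 0"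
      then show False
        using indep[of "\<lambda>t. u (x t)"] by (simp add: sum.reindex[OF injx])
    qed
  qed (use I in simp)
  moreover have "x ` I \<subseteq> A.vs1.span D" using x D by blast
  ultimately have "card (x ` I) \<le> card D"
    using A.vs1.independent_span_bound[OF D(1)] by blast
  then show False using I card_image[OF injx] by simp
qed

subsection \<open>Hermitian modules with a dual pair of bases\<close>

context quadratic_etale
begin

lemma emb_0 [simp]: "emb 0 = 0"
  using emb_add[of 0 0] by simp

lemma emb_minus: "emb (- a) = - emb a"
  using emb_add[of a "- a"] by (simp add: eq_neg_iff_add_eq_0 add.commute)

lemma emb_diff: "emb (a - b) = emb a - emb b"
  using emb_add[of a "- b"] by (simp add: emb_minus)

lemma emb_of_nat: "emb (of_nat k) = of_nat k"
  by (induction k) (auto simp: emb_add emb_one)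

lemma emb_numeral [simp]: "emb (numeral k) = numeral k"
  using emb_of_nat[of "numeral k"] by simp

lemma emb_eq_0_iff [simp]: "emb a = 0 \<longleftrightarrow> a = 0"
proof
  assume a: "emb a = 0"
  obtain \<omega> where u: "\<And>x. \<exists>!pq. x = emb (fst pq) + emb (snd pq) * \<omega>"
    using etale by blast
  have "(a, 0) = (0, 0)"
    using u[of 0] a by (metis add.right_neutral emb_0 fst_conv mult_zero_left snd_conv)
  then show "a = 0" by simp
qed simp

lemma emb_inj: "emb a = emb b \<longleftrightarrow> a = b"
  using emb_eq_0_iff[of "a - b"] by (simp add: emb_diff)

lemma emb_half: "emb (1 / 2) * x + emb (1 / 2) * x = x"
proof -
  have "emb (1 / 2) * x + emb (1 / 2) * x = emb (1 / 2 + 1 / 2) * x"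
    by (simp only: emb_add distrib_right)
  then show ?thesis by (simp add: emb_one)
qed

lemma add_self_eq_0_iff: "(x::'e) + x = 0 \<longleftrightarrow> x = 0"
  using emb_half[of x] by (metis add.right_neutral distrib_left mult_zero_right)

lemma cj_0 [simp]: "cj 0 = 0"
  using cj_emb[of 0] by simp

lemma cj_1 [simp]: "cj 1 = 1"
  using cj_emb[of 1] by (simp add: emb_one)

lemma cj_minus: "cj (- x) = - cj x"
  using cj_add[of x "- x"] by (simp add: eq_neg_iff_add_eq_0 add.commute)

lemma cj_diff: "cj (x - y) = cj x - cj y"
  using cj_add[of x "- y"] by (simp add: cj_minus)

text \<open>Completing the square in \<open>etale\<close>: 2 \<omega> - b squares to the
  discriminant, and a nontrivial involution over F can only change the sign of this
  generator.\<close>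

lemma ex_skew_generator:
  "\<exists>\<delta> D. cj \<delta> = - \<delta> \<and> \<delta> * \<delta> = emb D \<and> D \<noteq> 0 \<and> (\<forall>x. \<exists>p q. x = emb p + emb q * \<delta>)"
proof -
  obtain \<omega> b c where \<omega>: "\<omega> * \<omega> = emb b * \<omega> + emb c" and disc: "b\<^sup>2 + 4 * c \<noteq> 0"
    and u: "\<And>x. \<exists>!pq. x = emb (fst pq) + emb (snd pq) * \<omega>"
    using etale by blast
  define \<delta> where "\<delta> = \<omega> + \<omega> - emb b"
  define D where "D = b\<^sup>2 + 4 * c"
  have "emb (4 * c) = emb (c + c + (c + c))" by simp
  then have four: "emb (4 * c) = emb c + emb c + (emb c + emb c)"
    by (simp only: emb_add)
  have "\<delta> * \<delta> = (\<omega> * \<omega> + \<omega> * \<omega>) + (\<omega> * \<omega> + \<omega> * \<omega>)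
      - (emb b * \<omega> + emb b * \<omega>) - (emb b * \<omega> + emb b * \<omega>) + emb b * emb b"
    unfolding \<delta>_def by (simp add: algebra_simps)
  also have "\<dots> = emb b * emb b + (emb c + emb c + (emb c + emb c))"
    unfolding \<omega> by (simp add: algebra_simps)
  also have "\<dots> = emb D"
    by (simp only: D_def power2_eq_square emb_add emb_mult[of b b] four)
  finally have \<delta>2: "\<delta> * \<delta> = emb D" .
  have "\<omega> = emb (1 / 2) * (\<omega> + \<omega>)"
    using emb_half[of \<omega>] by (simp only: distrib_left)
  then have \<omega>\<delta>: "\<omega> = emb (1 / 2) * \<delta> + emb (b / 2)"
    using emb_mult[of "1 / 2" b] by (simp add: \<delta>_def algebra_simps)
  have gen: "\<exists>p q. x = emb p + emb q * \<delta>" for x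
  proof -
    obtain p q where "x = emb p + emb q * \<omega>" using u[of x] by auto
    also have "\<dots> = emb (p + q * (b / 2)) + emb (q * (1 / 2)) * \<delta>"
      by (subst \<omega>\<delta>) (simp only: emb_add emb_mult distrib_left ac_simps)
    finally have "x = emb (p + q * (b / 2)) + emb (q * (1 / 2)) * \<delta>" .
    then show ?thesis by blast
  qed
  have indep: "p = 0 \<and> q = 0" if pq: "emb p + emb q * \<delta> = 0" for p q
  proof -
    have "0 = emb (p - q * b) + emb (q + q) * \<omega>"
      using pq by (simp add: \<delta>_def emb_add emb_diff emb_mult algebra_simps)
    moreover have "0 = emb 0 + emb 0 * \<omega>" by simp
    ultimately have "(p - q * b, q + q) = (0, 0)"
      using u[of 0] by (metis fst_conv snd_conv)
    then show ?thesis by auto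
  qed
  \<comment> \<open>Applying \<open>cj\<close> twice gives q^2 = 1. The case q = 1 would force p = 0
    and a trivial involution; for q = -1, comparing the squares of \<open>cj \<delta>\<close> and
    \<open>\<delta>\<close> gives p = 0.\<close>
  obtain p q where pq: "cj \<delta> = emb p + emb q * \<delta>" using gen by blast
  have q0: "q \<noteq> 0"
  proof
    assume "q = 0"
    then have "cj (cj \<delta>) = emb p" using pq by (simp add: cj_emb)
    then have "emb (- p) + emb 1 * \<delta> = 0" by (simp add: cj_cj emb_minus emb_one)
    then show False using indep[of "- p" 1] by simp
  qed
  have "\<delta> = emb p + emb q * cj \<delta>"
    using arg_cong[OF pq, of cj] by (simp add: cj_cj cj_add cj_mult cj_emb)
  then have "emb (p + q * p) + emb (q * q - 1) * \<delta> = 0"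
    by (simp add: pq emb_add emb_mult emb_diff emb_one algebra_simps)
  then have pq': "p + q * p = 0" "q * q = 1" using indep by fastforce+
  have "q \<noteq> 1"
  proof
    assume "q = 1"
    then have "p = 0" using pq' by simp
    then have "cj x = x" for x
      using gen[of x] pq \<open>q = 1\<close> by (auto simp: cj_add cj_mult cj_emb emb_one)
    then show False using cj_nontrivial by auto
  qed
  then have q: "q = - 1" using pq'(2) by (simp add: square_eq_1_iff)
  have "cj \<delta> * cj \<delta> = emb D"
    using \<delta>2 by (metis cj_mult cj_emb)
  then have "emb (p * p) + emb (- (p + p)) * \<delta> = 0"
    using \<delta>2 by (simp add: pq q emb_minus emb_one emb_mult emb_add algebra_simps)
  then have "p = 0" using indep by fastforce
  then have "cj \<delta> = - \<delta>" using pq q by (simp add: emb_minus emb_one)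
  then show ?thesis using \<delta>2 disc gen D_def by metis
qed

end

context hermitian_module
begin

lemma form_add_right: "form u (v + w) = form u v + form u w"
  by (subst (1 2 3) form_cj) (simp add: form_add cj_add)

lemma form_scale_right: "form u (scl a v) = cj a * form u v"
  by (subst (1 2) form_cj) (simp add: form_scale cj_mult)

lemma form_0 [simp]: "form 0 v = 0" "form v 0 = 0"
  using form_scale[of 0 0 v] form_scale_right[of v 0 0] by auto

lemma form_minus: "form (- u) v = - form u v" "form u (- v) = - form u v"
  using form_add[of u "- u" v] form_add_right[of u v "- v"]
  by (simp_all add: eq_neg_iff_add_eq_0 add.commute)

lemma form_diff: "form (u - w) v = form u v - form w v" "form u (v - w) = form u v - form u w"
  using form_add[of u "- w" v] form_add_right[of u v "- w"] by (simp_all add: form_minus)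

lemma form_sum: "form (sum f A) v = (\<Sum>a\<in>A. form (f a) v)" "form v (sum f A) = (\<Sum>a\<in>A. form v (f a))"
  by (induction A rule: infinite_finite_induct) (auto simp: form_add form_add_right)

end

text \<open>\<open>B\<close> and \<open>d\<close> are dual in the sense of \<open>frame\<close>, so
  adjoints and traces are finite sums over \<open>B\<close>. The normalization \<open>form_d\<close>
  makes the trace of the identity the rank, by which central elements are later computed.\<close>

locale hermitian_frame = hermitian_module emb cj scl form
  for emb :: "'f::real_or_complex \<Rightarrow> 'e::comm_ring_1"
    and cj :: "'e \<Rightarrow> 'e"
    and scl :: "'e \<Rightarrow> 'v::ab_group_add \<Rightarrow> 'v"
    and form :: "'v \<Rightarrow> 'v \<Rightarrow> 'e" +
  fixes \<delta> :: 'e and D :: 'f and B :: "'v set" and d :: "'v \<Rightarrow> 'v"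
  assumes cj_\<delta>: "cj \<delta> = - \<delta>" and \<delta>_sq: "\<delta> * \<delta> = emb D" and D_nz: "D \<noteq> 0"
    and gen_\<delta>: "\<exists>p q. x = emb p + emb q * \<delta>"
    and finite_B: "finite B" and frame: "(\<Sum>b\<in>B. scl (form v (d b)) b) = v"
    and form_d: "b \<in> B \<Longrightarrow> form b (d b) = 1"
begin

definition \<delta>i :: 'e where "\<delta>i = emb (1 / D) * \<delta>"

lemma \<delta>_\<delta>i [simp]: "\<delta> * \<delta>i = 1" "\<delta>i * \<delta> = 1" "\<delta> * (\<delta>i * x) = x" "\<delta>i * (\<delta> * x) = x"
proof -
  have "\<delta>i * \<delta> = emb (1 / D * D)"
    unfolding emb_mult \<delta>i_def \<delta>_sq[symmetric] by (simp only: mult.assoc)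
  then show 1: "\<delta>i * \<delta> = 1" using D_nz by (simp add: emb_one)
  then show 2: "\<delta> * \<delta>i = 1" by (simp add: mult.commute)
  show "\<delta> * (\<delta>i * x) = x" "\<delta>i * (\<delta> * x) = x"
    using 1 2 by (simp_all flip: mult.assoc)
qed

lemma cj_\<delta>i: "cj \<delta>i = - \<delta>i"
  by (simp add: \<delta>i_def cj_mult cj_emb cj_\<delta>)

lemma scl_\<delta>_\<delta>i [simp]: "scl \<delta> (scl \<delta>i v) = v" "scl \<delta>i (scl \<delta> v) = v"
  by simp_all

lemma scl_\<delta>_eq_0_iff [simp]: "scl \<delta> v = 0 \<longleftrightarrow> v = 0"
  using scl_\<delta>_\<delta>i(2)[of v] by (metis scale_zero_right)

lemma scl_half: "scl (emb (1 / 2)) v + scl (emb (1 / 2)) v = v"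
  using emb_half[of 1] by (simp flip: scale_left_distrib)

lemma fixed_imp_emb:
  assumes "cj a = a"
  shows "\<exists>c. a = emb c"
proof -
  obtain p q where a: "a = emb p + emb q * \<delta>" using gen_\<delta> by blast
  then have "emb q * \<delta> = - (emb q * \<delta>)"
    using assms by (simp add: cj_add cj_mult cj_emb cj_\<delta>)
  then have "emb q * \<delta> + emb q * \<delta> = 0" by (simp only: eq_neg_iff_add_eq_0)
  then have "emb q * \<delta> = 0" by (simp only: add_self_eq_0_iff)
  then show ?thesis using a by auto
qed

text \<open>The trace of \<open>E\<close> over F.\<close>

definition tre :: "'e \<Rightarrow> 'f" where
  "tre a = (THE c. emb c = a + cj a)"

lemma emb_tre: "emb (tre a) = a + cj a"
proof -
  obtain c where "a + cj a = emb c"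
    using fixed_imp_emb[of "a + cj a"] by (auto simp: cj_add cj_cj add.commute)
  then show ?thesis
    unfolding tre_def by (intro theI[where P = "\<lambda>c. emb c = a + cj a" and a = c]) (simp_all add: emb_inj)
qed

lemma tre_eq_iff: "tre a = c \<longleftrightarrow> emb c = a + cj a"
  by (metis emb_tre emb_inj)

lemma tre_add: "tre (a + b) = tre a + tre b"
  by (simp add: tre_eq_iff emb_add emb_tre cj_add)

lemma tre_mult: "tre (emb c * a) = c * tre a"
  by (simp add: tre_eq_iff emb_mult emb_tre cj_mult cj_emb algebra_simps)

lemma tre_0 [simp]: "tre 0 = 0"
  by (simp add: tre_eq_iff)

text \<open>Testing with c = 1 shows that the involution negates a, testing with c =
  \<open>\<delta>\<close> that it fixes a.\<close>

lemma tre_nondegenerate: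
  assumes "\<And>c. tre (c * a) = 0"
  shows "a = 0"
proof -
  have 1: "a + cj a = 0" using assms[of 1] emb_tre[of a] by simp
  have "\<delta> * a + cj (\<delta> * a) = 0" using assms[of \<delta>] emb_tre[of "\<delta> * a"] by simp
  then have "\<delta> * (a - cj a) = 0" by (simp add: cj_mult cj_\<delta> algebra_simps)
  then have "a - cj a = 0" by (metis \<delta>_\<delta>i(4) mult_zero_right)
  then show ?thesis using 1 add_self_eq_0_iff by (metis eq_iff_diff_eq_0)
qed

lemmas form_simps = form_add form_add_right form_scale form_scale_right form_minus form_diff

lemma form_eqI: "(\<And>w. form u w = form v w) \<Longrightarrow> u = v"
  using form_nondegenerate[of "u - v"] by (simp add: form_diff)

lemma form_eqI2: "(\<And>w. form w u = form w v) \<Longrightarrow> u = v"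
  by (rule form_eqI, subst (1 2) form_cj) simp

abbreviation hom :: "('v \<Rightarrow> 'v) \<Rightarrow> bool" where "hom \<equiv> module_hom scl scl"

lemma homI:
  assumes "\<And>u v. x (u + v) = x u + x v" "\<And>a v. x (scl a v) = scl a (x v)"
  shows "hom x"
  using assms module_axioms by (simp add: module_hom_iff)

lemma hom_add: "hom x \<Longrightarrow> x (u + v) = x u + x v"
  by (simp add: module_hom_iff)

lemma hom_scale: "hom x \<Longrightarrow> x (scl a v) = scl a (x v)"
  by (simp add: module_hom_iff)

lemma hom_0: "hom x \<Longrightarrow> x 0 = 0"
  by (rule module_hom.zero)

lemma hom_minus: "hom x \<Longrightarrow> x (- v) = - x v"
  by (rule module_hom.neg)

lemma hom_diff: "hom x \<Longrightarrow> x (u - v) = x u - x v"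
  by (rule module_hom.diff)

lemma hom_sum: "hom x \<Longrightarrow> x (sum f A) = (\<Sum>a\<in>A. x (f a))"
  by (rule module_hom.sum)

lemmas hom_simps = hom_add hom_scale hom_0 hom_minus hom_diff

lemma hom_comp: "hom x \<Longrightarrow> hom y \<Longrightarrow> hom (\<lambda>v. x (y v))"
  by (simp add: module_hom_iff algebra_simps)

lemma hom_o: "hom x \<Longrightarrow> hom y \<Longrightarrow> hom (x \<circ> y)"
  by (simp add: module_hom_iff algebra_simps)

lemma hom_plus: "hom x \<Longrightarrow> hom y \<Longrightarrow> hom (\<lambda>v. x v + y v)"
  by (simp add: module_hom_iff algebra_simps)

lemma hom_sub: "hom x \<Longrightarrow> hom y \<Longrightarrow> hom (\<lambda>v. x v - y v)"
  by (simp add: module_hom_iff algebra_simps)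

lemma hom_scl: "hom x \<Longrightarrow> hom (\<lambda>v. scl a (x v))"
  by (simp add: module_hom_iff algebra_simps)

lemma hom_rank1: "hom (\<lambda>v. scl (form v u) w)"
  by (rule homI) (simp_all add: form_add form_scale algebra_simps)

lemma hom_ident: "hom (\<lambda>v. v)" and hom_zero: "hom (\<lambda>v. 0)" and hom_scl_self: "hom (\<lambda>v. scl a v)"
  using module_axioms by (simp_all add: module_hom_iff algebra_simps)

lemma hom_bracket: "hom x \<Longrightarrow> hom y \<Longrightarrow> hom (lie_bracket x y)"
  unfolding lie_bracket_def by (simp add: module_hom_iff algebra_simps)

lemma hom_setsum: "(\<And>i. i \<in> I \<Longrightarrow> hom (x i)) \<Longrightarrow> hom (\<lambda>v. \<Sum>i\<in>I. x i v)"
  by (induction I rule: infinite_finite_induct) (auto intro: hom_zero hom_plus)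

lemma hom_frame: "hom x \<Longrightarrow> x v = (\<Sum>b\<in>B. scl (form v (d b)) (x b))"
  using hom_sum[of x "\<lambda>b. scl (form v (d b)) b" B] by (simp add: frame hom_scale)

section \<open>Adjoints and traces\<close>

definition adj :: "('v \<Rightarrow> 'v) \<Rightarrow> 'v \<Rightarrow> 'v" where
  "adj x w = (\<Sum>b\<in>B. scl (cj (form (x b) w)) (d b))"

lemma form_adj: "hom x \<Longrightarrow> form (x v) w = form v (adj x w)"
  unfolding adj_def
  by (subst hom_frame[of x v], assumption)
     (auto simp: form_sum form_scale form_scale_right cj_cj intro!: sum.cong)

lemma form_adj': "hom x \<Longrightarrow> form w (x v) = form (adj x w) v"
  by (subst (1 2) form_cj) (simp add: form_adj)

lemma adj_unique: "hom x \<Longrightarrow> (\<And>v w. form (x v) w = form v (y w)) \<Longrightarrow> adj x = y"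
  by (rule ext, rule form_eqI2) (simp flip: form_adj)

lemma hom_adj: "hom x \<Longrightarrow> hom (adj x)"
  by (rule homI; rule form_eqI2)
     (simp_all add: form_add_right form_scale_right flip: form_adj)

definition tr :: "('v \<Rightarrow> 'v) \<Rightarrow> 'e" where
  "tr x = (\<Sum>b\<in>B. form (x b) (d b))"

lemma tr_commute:
  assumes "hom x" "hom y"
  shows "tr (\<lambda>v. x (y v)) = tr (\<lambda>v. y (x v))"
proof -
  have *: "tr (\<lambda>v. x (y v)) = (\<Sum>b\<in>B. \<Sum>c\<in>B. form (y b) (d c) * form (x c) (d b))"
    if "hom x" for x y
    unfolding tr_def by (subst hom_frame[OF that]) (simp add: form_sum form_scale)
  show ?thesis
    unfolding *[OF assms(1)] *[OF assms(2)]
    by (subst sum.swap) (simp add: mult.commute)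
qed

lemma tr_rank1: "tr (\<lambda>v. scl (form v u) w) = form w u"
proof -
  have "tr (\<lambda>v. scl (form v u) w) = form (\<Sum>b\<in>B. scl (form w (d b)) b) u"
    unfolding tr_def by (simp add: form_sum form_scale mult.commute)
  then show ?thesis by (simp add: frame)
qed

lemma tr_add: "tr (\<lambda>v. x v + y v) = tr x + tr y"
  and tr_diff: "tr (\<lambda>v. x v - y v) = tr x - tr y"
  and tr_minus: "tr (\<lambda>v. - x v) = - tr x"
  and tr_scale: "tr (\<lambda>v. scl a (x v)) = a * tr x"
  unfolding tr_def
  by (simp_all add: form_add form_diff form_minus form_scale sum.distrib sum_subtractf sum_negf
      sum_distrib_left)

lemma tr_ident: "tr (\<lambda>v. v) = of_nat (card B)"
  unfolding tr_def by (simp add: form_d)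

section \<open>Underlying vector spaces over F\<close>

definition sF :: "'f \<Rightarrow> 'v \<Rightarrow> 'v" where "sF c v = scl (emb c) v"

sublocale VF: vector_space sF
  by unfold_locales (auto simp: sF_def emb_add emb_mult emb_one algebra_simps)

abbreviation sE :: "'f \<Rightarrow> ('v \<Rightarrow> 'v) \<Rightarrow> 'v \<Rightarrow> 'v" where "sE \<equiv> end_scale emb scl"

sublocale EF: vector_space sE
  by (rule vector_space_end)

lemma sE_apply: "sE c x v = scl (emb c) (x v)"
  by (simp add: end_scale_def)

lemma sum_fun_apply: "(\<Sum>i\<in>I. f i) v = (\<Sum>i\<in>I. f i (v::'v))" for f :: "'i \<Rightarrow> 'v \<Rightarrow> 'v"
  by (induction I rule: infinite_finite_induct) auto

definition VF_gen :: "'v set" where "VF_gen = B \<union> scl \<delta> ` B"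

lemma finite_VF_gen: "finite VF_gen"
  by (simp add: VF_gen_def finite_B)

lemma VF_span_gen: "X \<subseteq> VF.span VF_gen"
proof
  fix v assume "v \<in> X"
  have "scl a b \<in> VF.span VF_gen" if b: "b \<in> B" for a b
  proof -
    obtain p q where "a = emb p + emb q * \<delta>" using gen_\<delta> by blast
    then have "scl a b = sF p b + sF q (scl \<delta> b)"
      by (simp add: sF_def algebra_simps)
    also have "\<dots> \<in> VF.span VF_gen"
      using b by (intro VF.span_add VF.span_scale VF.span_base) (auto simp: VF_gen_def)
    finally show ?thesis .
  qed
  then have "(\<Sum>b\<in>B. scl (form v (d b)) b) \<in> VF.span VF_gen"
    by (intro VF.span_sum)
  then show "v \<in> VF.span VF_gen" by (simp add: frame)
qed

definition EF_gen :: "('v \<Rightarrow> 'v) set" where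
  "EF_gen = (\<lambda>(b, c) v. scl (form v (d b)) c) ` (B \<times> VF_gen)"

lemma finite_EF_gen: "finite EF_gen"
  by (simp add: EF_gen_def finite_B finite_VF_gen)

lemma EF_span_gen: "{x. hom x} \<subseteq> EF.span EF_gen"
proof clarify
  fix x assume x: "hom x"
  have *: "(\<lambda>v. scl (form v (d b)) w) \<in> EF.span EF_gen" if b: "b \<in> B" and w: "w \<in> VF.span VF_gen" for b w
    using w
  proof (induction rule: VF.span_induct_alt)
    case base
    show ?case using EF.span_zero by (simp add: zero_fun_def)
  next
    case (step c u w)
    have "(\<lambda>v. scl (form v (d b)) u) \<in> EF_gen"
      using b step unfolding EF_gen_def by (auto intro!: image_eqI[of _ _ "(b, u)"])
    moreover have "(\<lambda>v. scl (form v (d b)) (sF c u + w))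
        = sE c (\<lambda>v. scl (form v (d b)) u) + (\<lambda>v. scl (form v (d b)) w)"
      by (auto simp: sE_apply sF_def algebra_simps)
    ultimately show ?case using step EF.span_add EF.span_scale EF.span_base by simp
  qed
  have "x = (\<Sum>b\<in>B. (\<lambda>v. scl (form v (d b)) (x b)))"
    by (rule ext) (simp add: sum_fun_apply flip: hom_frame[OF x])
  also have "\<dots> \<in> EF.span EF_gen"
    using VF_span_gen[of UNIV] by (intro EF.span_sum *) auto
  finally show "x \<in> EF.span EF_gen" .
qed

section \<open>Orthogonal complements and projections\<close>

lemma subspace_imp_VF: "subspace S \<Longrightarrow> VF.subspace S"
  unfolding subspace_def VF.subspace_def sF_def by auto

lemma VF_linear_hom: "hom x \<Longrightarrow> Vector_Spaces.linear sF sF x"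
  unfolding Vector_Spaces.linear_iff
  using VF.vector_space_axioms by (auto simp: sF_def hom_simps)

text \<open>With A an F-basis of S, the map sends v to the sum of the vectors a weighted by the
  traces of <v, a>. Its kernel is the orthogonal of S because S is stable under \<open>E\<close> and
  the trace is nondegenerate. Statements on complements thereby become statements on injective
  endomorphisms over F.\<close>

lemma ex_perp_map:
  assumes S: "subspace S"
  obtains \<Psi> where "Vector_Spaces.linear sF sF \<Psi>" "\<And>v. \<Psi> v \<in> S"
    "\<And>v. \<Psi> v = 0 \<longleftrightarrow> v \<in> orth form S"
proof -
  have VS: "VF.subspace S" using S by (rule subspace_imp_VF)
  obtain A where A: "finite A" "A \<subseteq> S" "VF.independent A" "VF.span A = S"
    using VF.subspace_finite_basis[OF finite_VF_gen VF_span_gen VS] by metis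
  define \<Psi> where "\<Psi> v = (\<Sum>a\<in>A. sF (tre (form v a)) a)" for v
  have "Vector_Spaces.linear sF sF \<Psi>"
    unfolding Vector_Spaces.linear_iff
    using VF.vector_space_axioms
    by (auto simp: \<Psi>_def form_add form_scale sF_def tre_add tre_mult emb_add emb_mult
        scale_left_distrib sum.distrib scale_sum_right)
  moreover have "\<Psi> v \<in> S" for v
    unfolding \<Psi>_def using A by (intro VF.subspace_sum[OF VS] VF.subspace_scale[OF VS]) auto
  moreover have "\<Psi> v = 0 \<longleftrightarrow> v \<in> orth form S" for v
  proof
    assume "\<Psi> v = 0"
    then have zero: "tre (form v a) = 0" if "a \<in> A" for a
      using VF.independentD[OF A(3,1) order_refl _ that, of "\<lambda>a. tre (form v a)"] by (simp add: \<Psi>_def)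
    have "VF.subspace {w. tre (form v w) = 0}"
      unfolding VF.subspace_def by (auto simp: form_add_right form_scale_right sF_def tre_add cj_emb tre_mult)
    then have "VF.span A \<subseteq> {w. tre (form v w) = 0}"
      by (intro VF.span_minimal) (auto simp: zero)
    then have tz: "tre (form v w) = 0" if "w \<in> S" for w using that A by auto
    have "form v w = 0" if w: "w \<in> S" for w
    proof (rule tre_nondegenerate)
      fix c
      show "tre (c * form v w) = 0"
        using tz[of "scl (cj c) w"] w subspace_scale[OF S] by (simp add: form_scale_right cj_cj)
    qed
    then show "v \<in> orth form S" by (simp add: orth_def)
  next
    assume "v \<in> orth form S"
    then have "form v a = 0" if "a \<in> A" for a
      using A(2) that by (auto simp: orth_def)
    then show "\<Psi> v = 0" by (simp add: \<Psi>_def)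
  qed
  ultimately show ?thesis using that by blast
qed

lemma subspace_orth: "subspace (orth form S)"
  unfolding subspace_def orth_def by (auto simp: form_add form_scale)

text \<open>The map of \<open>ex_perp_map\<close> is injective on W, hence maps W onto itself; but
  its values lie in S.\<close>

lemma orth_trivial_imp_eq:
  assumes "subspace S" "subspace W" "S \<subseteq> W" "W \<inter> orth form S \<subseteq> {0}"
  shows "S = W"
proof -
  obtain \<Psi> where \<Psi>: "Vector_Spaces.linear sF sF \<Psi>" "\<And>v. \<Psi> v \<in> S"
    "\<And>v. \<Psi> v = 0 \<longleftrightarrow> v \<in> orth form S"
    using ex_perp_map[OF assms(1)] by blast
  have "\<Psi> ` W = W"
    by (rule VF.injective_endo_surj_on[OF finite_VF_gen VF_span_gen])
       (use \<Psi> assms subspace_imp_VF in auto)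
  then have "W \<subseteq> S" using \<Psi>(2) by (metis image_subsetI)
  then show ?thesis using assms(3) by blast
qed

text \<open>The map of \<open>ex_perp_map\<close> restricts to a bijection of N, so its value at v
  is also attained at some u in N, and v - u lies in its kernel.\<close>

lemma orth_complement:
  assumes N: "subspace N" "N \<inter> orth form N \<subseteq> {0}"
  shows "\<exists>u\<in>N. v - u \<in> orth form N"
proof -
  obtain \<Psi> where \<Psi>: "Vector_Spaces.linear sF sF \<Psi>" "\<And>v. \<Psi> v \<in> N"
    "\<And>v. \<Psi> v = 0 \<longleftrightarrow> v \<in> orth form N"
    using ex_perp_map[OF N(1)] by blast
  have "\<Psi> ` N = N"
    by (rule VF.injective_endo_surj_on[OF finite_VF_gen VF_span_gen])
       (use \<Psi> N subspace_imp_VF in auto)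
  then obtain u where u: "u \<in> N" "\<Psi> v = \<Psi> u" using \<Psi>(2)[of v] by (metis imageE)
  interpret \<Psi>: Vector_Spaces.linear sF sF \<Psi> by fact
  have "\<Psi> (v - u) = 0" using u by (simp add: \<Psi>.diff)
  then show ?thesis using u \<Psi>(3) by blast
qed

text \<open>Averaging an \<open>F\<close>-linear projection over the group generated by \<open>\<delta>\<close> makes it \<open>E\<close>-linear.\<close>
lemma ex_hom_projection:
  assumes R: "subspace R"
  obtains \<rho> where "hom \<rho>" "\<And>v. \<rho> v \<in> R" "\<And>v. v \<in> R \<Longrightarrow> \<rho> v = v"
proof -
  interpret p: vector_space_pair sF sF by unfold_locales
  have "Vector_Spaces.linear sF sF (\<lambda>v. v)"
    by (rule VF_linear_hom) (rule hom_ident)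
  then obtain g where g: "\<And>v. g v \<in> R" "Vector_Spaces.linear sF sF g" "\<And>v. v \<in> R \<Longrightarrow> g v = v"
    using p.linear_exists_left_inverse_on[of "\<lambda>v. v" R] subspace_imp_VF[OF R] by auto
  interpret g: Vector_Spaces.linear sF sF g by fact
  define \<rho> where "\<rho> v = scl (emb (1 / 2)) (g v + scl \<delta>i (g (scl \<delta> v)))" for v
  have gs: "g (scl (emb c) v) = scl (emb c) (g v)" for c v
    using g.scale[of c v] by (simp add: sF_def)
  have "g (scl \<delta> (scl \<delta> v)) = scl \<delta> (scl \<delta> (g v))" for v
    using gs[of D v] by (simp add: \<delta>_sq)
  then have \<rho>\<delta>: "\<rho> (scl \<delta> v) = scl \<delta> (\<rho> v)" for v
  proof -
    have "\<rho> (scl \<delta> v) = scl (emb (1 / 2)) (g (scl \<delta> v) + scl \<delta> (g v))"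
      unfolding \<rho>_def \<open>\<And>v. g (scl \<delta> (scl \<delta> v)) = scl \<delta> (scl \<delta> (g v))\<close> scl_\<delta>_\<delta>i ..
    moreover have "scl \<delta> (\<rho> v) = scl (emb (1 / 2)) (scl \<delta> (g v) + g (scl \<delta> v))"
      by (simp only: \<rho>_def scale_left_commute[of \<delta> "emb (1 / 2)"] scale_right_distrib scl_\<delta>_\<delta>i)
    ultimately show ?thesis by (simp add: add.commute)
  qed
  have \<rho>e: "\<rho> (scl (emb c) v) = scl (emb c) (\<rho> v)" for c v
  proof -
    have "g (scl \<delta> (scl (emb c) v)) = scl (emb c) (g (scl \<delta> v))"
      using gs[of c "scl \<delta> v"] by (simp only: scale_left_commute)
    then show ?thesis
      unfolding \<rho>_def gs by (simp add: scale_right_distrib ac_simps)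
  qed
  have \<rho>a: "\<rho> (u + v) = \<rho> u + \<rho> v" for u v
    by (simp add: \<rho>_def scale_right_distrib g.add)
  have "hom \<rho>"
  proof (rule homI)
    fix a v
    obtain p q where a: "a = emb p + emb q * \<delta>" using gen_\<delta> by blast
    have "scl a v = scl (emb p) v + scl (emb q) (scl \<delta> v)"
      by (simp add: a algebra_simps)
    then show "\<rho> (scl a v) = scl a (\<rho> v)"
      by (simp only: \<rho>a \<rho>e \<rho>\<delta>) (simp add: a algebra_simps)
  qed (rule \<rho>a)
  moreover have "\<rho> v \<in> R" for v
    unfolding \<rho>_def by (intro subspace_scale[OF R] subspace_add[OF R] g)
  moreover have "\<rho> v = v" if "v \<in> R" for v
    using that g(3)[OF that] g(3)[OF subspace_scale[OF R that]] by (simp only: \<rho>_def scl_\<delta>_\<delta>i scale_right_distrib scl_half)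
  ultimately show ?thesis using that by blast
qed

end

subsection \<open>Skew endomorphisms of a nondegenerate direct summand\<close>

context hermitian_frame
begin

text \<open>Says that W lies in E[T] u, phrased through stable submodules to avoid polynomials in
  T.\<close>

definition cyclic :: "('v \<Rightarrow> 'v) \<Rightarrow> 'v \<Rightarrow> 'v set \<Rightarrow> bool" where
  "cyclic T u W \<longleftrightarrow> (\<forall>S. subspace S \<longrightarrow> u \<in> S \<longrightarrow> (\<forall>v\<in>S. T v \<in> S) \<longrightarrow> W \<subseteq> S)"

lemma cyclicD:
  "cyclic T u W \<Longrightarrow> subspace S \<Longrightarrow> u \<in> S \<Longrightarrow> (\<And>v. v \<in> S \<Longrightarrow> T v \<in> S) \<Longrightarrow> v \<in> W \<Longrightarrow> v \<in> S"
  unfolding cyclic_def by blast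

text \<open>The infinitesimal isometry belonging to the wedge of u and v. Such maps span the Lie
  algebra over F, see \<open>L_rk_induct\<close>.\<close>

definition rk :: "'v \<Rightarrow> 'v \<Rightarrow> 'v \<Rightarrow> 'v" where
  "rk u v = (\<lambda>w. scl (form w u) v - scl (form w v) u)"

lemma hom_rk: "hom (rk u v)"
  unfolding rk_def by (intro hom_sub hom_rank1)

lemma skew_rk: "form (rk u v w) w' + form w (rk u v w') = 0"
  using form_cj[of w' u] form_cj[of w' v]
  by (simp add: rk_def form_diff form_scale form_scale_right cj_cj flip: form_cj)

text \<open>Pairing a skew m with \<open>rk u v\<close> reads off the trace of the matrix entry <m
  v, u>. This makes \<open>rk\<close> the test element for all statements on the trace form.\<close>

lemma tr_rk:
  assumes "hom m" "\<And>v w. form (m v) w + form v (m w) = 0"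
  shows "tr (\<lambda>w. rk u v (m w)) = emb (tre (form (m v) u))"
proof -
  have m: "form (m v) w = - form v (m w)" for v w
    using assms(2) by (simp add: eq_neg_iff_add_eq_0)
  have "tr (\<lambda>w. rk u v (m w)) = - (tr (\<lambda>w. scl (form w (m u)) v) - tr (\<lambda>w. scl (form w (m v)) u))"
    unfolding rk_def by (simp add: m tr_diff[symmetric] tr_minus[symmetric])
  also have "\<dots> = form u (m v) - form v (m u)" by (simp add: tr_rank1)
  also have "\<dots> = emb (tre (form (m v) u))"
    using m[of v u] form_cj[of u "m v"] by (simp add: emb_tre)
  finally show ?thesis .
qed

lemma linear_bracket:
  assumes "hom T"
  shows "Vector_Spaces.linear sE sE (lie_bracket T)"
  unfolding Vector_Spaces.linear_iff
  using EF.vector_space_axioms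
  by (auto simp: lie_bracket_def sE_apply hom_add[OF assms] hom_scale[OF assms] algebra_simps)

end

text \<open>P is a self-adjoint projection. The identity gives the Lie algebra of U(V), the
  projection onto \<open>V\<^sub>H\<close> that of H, so both are treated at once.\<close>

locale hermitian_summand = hermitian_frame emb cj scl form \<delta> D B d
  for emb :: "'f::real_or_complex \<Rightarrow> 'e::comm_ring_1"
    and cj :: "'e \<Rightarrow> 'e"
    and scl :: "'e \<Rightarrow> 'v::ab_group_add \<Rightarrow> 'v"
    and form :: "'v \<Rightarrow> 'v \<Rightarrow> 'e"
    and \<delta> :: 'e and D :: 'f and B :: "'v set" and d :: "'v \<Rightarrow> 'v" +
  fixes P :: "'v \<Rightarrow> 'v"
  assumes hom_P: "hom P" and P_P [simp]: "P (P v) = P v" and P_form: "form (P v) w = form v (P w)"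
begin

definition EndP :: "('v \<Rightarrow> 'v) set" where
  "EndP = {x. hom x \<and> (\<forall>v. x (P v) = x v) \<and> (\<forall>v. P (x v) = x v)}"

definition L :: "('v \<Rightarrow> 'v) set" where
  "L = {x. hom x \<and> (\<forall>v w. form (x v) w + form v (x w) = 0) \<and> (\<forall>v. x (P v) = x v)}"

definition CT :: "('v \<Rightarrow> 'v) \<Rightarrow> ('v \<Rightarrow> 'v) set" where
  "CT T = {x \<in> EndP. \<forall>v. x (T v) = T (x v)}"

definition LT :: "('v \<Rightarrow> 'v) \<Rightarrow> ('v \<Rightarrow> 'v) set" where
  "LT T = {x \<in> L. \<forall>v. x (T v) = T (x v)}"

lemma EndP_D:
  assumes "x \<in> EndP"
  shows "hom x" "x (P v) = x v" "P (x v) = x v"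
  using assms by (auto simp: EndP_def)

lemma L_D:
  assumes "x \<in> L"
  shows "hom x" "form (x v) w = - form v (x w)" "x (P v) = x v" "P (x v) = x v"
proof -
  show h: "hom x" and P: "\<And>v. x (P v) = x v" using assms by (auto simp: L_def)
  show s: "form (x v) w = - form v (x w)" for v w
    using assms by (auto simp: L_def eq_neg_iff_add_eq_0)
  show "P (x v) = x v"
    by (rule form_eqI) (simp add: P_form s P)
qed

lemma L_I:
  "hom x \<Longrightarrow> (\<And>v w. form (x v) w = - form v (x w)) \<Longrightarrow> (\<And>v. x (P v) = x v) \<Longrightarrow> x \<in> L"
  by (simp add: L_def)

lemma L_subset_EndP: "L \<subseteq> EndP"
  using L_D unfolding EndP_def by blast

lemma L_hom: "L \<subseteq> {x. hom x}"
  using L_D by blast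

lemma EndP_hom: "EndP \<subseteq> {x. hom x}"
  using EndP_D by blast

lemma EF_subspace_EndP: "EF.subspace EndP"
  unfolding EF.subspace_def
  by (auto simp: EndP_def module_hom_iff sE_apply algebra_simps module_axioms
      hom_add[OF hom_P] hom_scale[OF hom_P] hom_0[OF hom_P])

lemma EF_subspace_L: "EF.subspace L"
  unfolding EF.subspace_def
  by (auto simp: L_def module_hom_iff sE_apply form_simps cj_emb algebra_simps module_axioms
      eq_neg_iff_add_eq_0[symmetric] simp flip: distrib_left)

lemma L_span: "L \<subseteq> EF.span EF_gen"
  using L_hom EF_span_gen by blast

lemma L_add: "x \<in> L \<Longrightarrow> y \<in> L \<Longrightarrow> (\<lambda>v. x v + y v) \<in> L"
  using EF.subspace_add[OF EF_subspace_L] by (simp add: plus_fun_def)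

lemma L_scale: "x \<in> L \<Longrightarrow> (\<lambda>v. scl (emb c) (x v)) \<in> L"
  using EF.subspace_scale[OF EF_subspace_L, of x c] by (simp add: end_scale_def)

lemma L_bracket: "x \<in> L \<Longrightarrow> y \<in> L \<Longrightarrow> lie_bracket x y \<in> L"
  by (rule L_I) (auto simp: hom_bracket[unfolded lie_bracket_def] L_D lie_bracket_def form_diff)

lemma unitary_lie_range_P: "unitary_lie scl form (range P) = L"
proof -
  have orth: "v \<in> orth form (range P) \<longleftrightarrow> P v = 0" for v
    unfolding orth_def using form_nondegenerate[of "P v"] by (auto simp flip: P_form)
  have "(\<forall>v\<in>orth form (range P). x v = 0) \<longleftrightarrow> (\<forall>v. x (P v) = x v)" if "hom x" for x
  proof (intro iffI allI ballI)
    fix v assume "\<forall>v\<in>orth form (range P). x v = 0"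
    then have "x (v - P v) = 0" by (simp add: orth hom_diff[OF hom_P])
    then show "x (P v) = x v" by (simp add: hom_diff[OF that])
  next
    fix v assume "\<forall>v. x (P v) = x v" "v \<in> orth form (range P)"
    then show "x v = 0" by (metis orth hom_0[OF that])
  qed
  then show ?thesis unfolding unitary_lie_def L_def by auto
qed

lemma rk_in_L:
  assumes "P u = u" "P v = v"
  shows "rk u v \<in> L"
proof (rule L_I)
  show "rk u v (P w) = rk u v w" for w
    using assms by (simp add: rk_def P_form)
  show "form (rk u v w) w' = - form w (rk u v w')" for w w'
    using skew_rk by (simp add: eq_neg_iff_add_eq_0)
qed (rule hom_rk)

lemma adj_EndP: "x \<in> EndP \<Longrightarrow> adj x \<in> EndP"
  unfolding EndP_def
  by (auto simp: hom_adj simp flip: form_adj P_form intro!: form_eqI2)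

text \<open>The skew and the hermitian part; the latter is \<open>\<delta>\<close> times a skew map
  because \<open>cj \<delta> = - \<delta>\<close>.\<close>

lemma EndP_decompose:
  assumes x: "x \<in> EndP"
  obtains x1 x2 where "x1 \<in> L" "x2 \<in> L" "\<And>v. x v = x1 v + scl \<delta> (x2 v)"
    "\<And>v. adj x v = - x1 v + scl \<delta> (x2 v)"
proof
  let ?h = "emb (1 / 2)"
  note x' = EndP_D[OF x] and a' = EndP_D[OF adj_EndP[OF x]]
  note a = form_adj[OF x'(1)] form_adj'[OF x'(1)]
  show "(\<lambda>v. scl ?h (x v - adj x v)) \<in> L"
    by (rule L_I)
       (simp_all add: hom_scl hom_sub x' a' form_scale form_scale_right cj_emb form_diff a algebra_simps)
  show "(\<lambda>v. scl (?h * \<delta>i) (x v + adj x v)) \<in> L"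
    by (rule L_I)
       (simp_all add: hom_scl hom_plus x' a' form_scale form_scale_right cj_emb cj_mult cj_\<delta>i
         form_add form_add_right a algebra_simps)
  have 2: "scl \<delta> (scl (?h * \<delta>i) (x v + adj x v)) = scl ?h (x v + adj x v)" for v
  proof -
    have "\<delta> * (?h * \<delta>i) = ?h" by (subst mult.left_commute) simp
    then show ?thesis by simp
  qed
  show "x v = scl ?h (x v - adj x v) + scl \<delta> (scl (?h * \<delta>i) (x v + adj x v))" for v
    unfolding 2 using scl_half[of "x v"] by (simp add: algebra_simps)
  show "adj x v = - scl ?h (x v - adj x v) + scl \<delta> (scl (?h * \<delta>i) (x v + adj x v))" for v
    unfolding 2 using scl_half[of "adj x v"] by (simp add: algebra_simps)
qed

text \<open>The test maps are \<open>rk\<close> with first vector scaled by an arbitrary element of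
  \<open>E\<close>; this upgrades the vanishing of a trace to the vanishing of the
  \<open>E\<close>-valued entry.\<close>

lemma L_trace_nondegenerate:
  assumes m: "m \<in> L" and "\<And>\<eta>. \<eta> \<in> L \<Longrightarrow> tr (\<lambda>v. \<eta> (m v)) = 0"
  shows "m = 0"
proof (rule ext, rule form_eqI)
  fix v u
  have skew: "\<And>v w. form (m v) w + form v (m w) = 0" using m by (simp add: L_def)
  have "form (m v) (P u) = 0"
  proof (rule tre_nondegenerate)
    fix c
    have "rk (scl (cj c) (P u)) (P v) \<in> L"
      by (rule rk_in_L) (simp_all add: hom_scale[OF hom_P])
    then have "tre (form (m (P v)) (scl (cj c) (P u))) = 0"
      using assms(2) tr_rk[OF L_D(1)[OF m] skew, of "scl (cj c) (P u)" "P v"] by simp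
    then show "tre (c * form (m v) (P u)) = 0"
      by (simp add: form_scale_right cj_cj L_D[OF m])
  qed
  then show "form (m v) u = form (0 v) u" by (simp add: L_D[OF m] flip: P_form)
qed

text \<open>
  Otherwise \<open>ad T\<close> would be injective, hence surjective, on the endomorphisms with values in \<open>N\<close>,
  so that all of these would have trace zero.
\<close>
lemma ex_commuting_into:
  assumes T: "T \<in> EndP" and N: "subspace N" "\<And>v. v \<in> N \<Longrightarrow> P v = v" "\<And>v. v \<in> N \<Longrightarrow> T v \<in> N"
    and r: "r \<in> N" "r \<noteq> 0"
  shows "\<exists>\<psi>\<in>CT T. \<psi> \<noteq> 0 \<and> (\<forall>v. \<psi> v \<in> N)"
proof (rule ccontr)
  assume none: "\<not> ?thesis"
  let ?J = "{x \<in> EndP. \<forall>v. x v \<in> N}"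
  note T' = EndP_D[OF T]
  have J: "EF.subspace ?J"
    using EF_subspace_EndP N(1)
    unfolding EF.subspace_def subspace_def by (auto simp: sE_apply)
  have "lie_bracket T ` ?J = ?J"
  proof (rule EF.injective_endo_surj_on[OF finite_EF_gen _ J linear_bracket[OF T'(1)]])
    show "?J \<subseteq> EF.span EF_gen" using EndP_hom EF_span_gen by blast
    show "lie_bracket T ` ?J \<subseteq> ?J"
      using N subspace_diff[OF N(1)]
      by (auto simp: EndP_def hom_bracket[unfolded lie_bracket_def] T' lie_bracket_def hom_diff[OF hom_P])
    show "x = 0" if "x \<in> ?J" "lie_bracket T x = 0" for x
      using that none by (auto simp: CT_def lie_bracket_def fun_eq_iff)
  qed
  moreover have "tr (lie_bracket T x) = 0" if "x \<in> ?J" for x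
    using tr_commute[OF T'(1), of x] that by (simp add: lie_bracket_def tr_diff EndP_def)
  ultimately have trJ: "tr x = 0" if "x \<in> ?J" for x using that by (metis (no_types, lifting) imageE)
  have "form r v = 0" for v
  proof -
    have "(\<lambda>w. scl (form w (P v)) r) \<in> ?J"
      using N r subspace_scale[OF N(1)]
      by (auto simp: EndP_def hom_rank1 P_form hom_scale[OF hom_P])
    from trJ[OF this] have "form r (P v) = 0" by (simp add: tr_rank1)
    then show ?thesis using N(2)[OF r(1)] by (simp flip: P_form)
  qed
  then show False using form_nondegenerate r(2) by blast
qed

section \<open>Cyclic vectors and their centralizers\<close>

lemma subspace_range_P: "subspace (range P)"
  using module_hom.subspace_image[OF hom_P subspace_UNIV] .

lemma in_range_P: "v \<in> range P \<longleftrightarrow> P v = v"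
  by (metis P_P rangeE rangeI)

text \<open>The kernel of x is a T-stable submodule containing u.\<close>

lemma cyclic_imp_eq_0:
  assumes "cyclic T u (range P)" and x: "x \<in> CT T" "x u = 0" and T: "hom T"
  shows "x = 0"
proof
  fix v
  have x': "x \<in> EndP" and c: "\<And>v. x (T v) = T (x v)" using x by (auto simp: CT_def)
  have "subspace {v. x v = 0}"
    by (rule module_hom.subspace_kernel[OF EndP_D(1)[OF x']])
  from cyclicD[OF assms(1) this] have "P v \<in> {v. x v = 0}"
    using x(2) by (auto simp: c hom_0[OF T])
  then show "x v = 0 v" by (simp add: EndP_D[OF x'])
qed

lemma adj_CT:
  assumes "x \<in> CT T" "T \<in> L"
  shows "adj x \<in> CT T"
proof -
  have x: "x \<in> EndP" "\<And>v. x (T v) = T (x v)" using assms by (auto simp: CT_def)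
  have "adj x (T w) = T (adj x w)" for w
  proof (rule form_eqI2)
    fix v
    have "form v (adj x (T w)) = - form (T (x v)) w"
      using L_D(2)[OF assms(2), of "x v" w] by (simp flip: form_adj[OF EndP_D(1)[OF x(1)]])
    also have "\<dots> = form v (T (adj x w))"
      using L_D(2)[OF assms(2), of v "adj x w"] form_adj[OF EndP_D(1)[OF x(1)], of "T v" w] x(2)
      by simp
    finally show "form v (adj x (T w)) = form v (T (adj x w))" .
  qed
  then show ?thesis using adj_EndP[OF x(1)] by (simp add: CT_def)
qed

text \<open>N is the orthogonal, inside \<open>range P\<close>, of a proper T-stable submodule
  containing u: skewness of T makes it stable, \<open>orth_trivial_imp_eq\<close> makes it
  nonzero.\<close>

lemma not_cyclic_imp_orth:
  assumes T: "T \<in> L" and u: "P u = u" and "\<not> cyclic T u (range P)"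
  obtains N where "subspace N" "\<And>v. v \<in> N \<Longrightarrow> P v = v" "\<And>v. v \<in> N \<Longrightarrow> T v \<in> N" "N \<noteq> {0}"
    "\<And>v. v \<in> N \<Longrightarrow> form v u = 0"
proof -
  obtain S where S: "subspace S" "u \<in> S" "\<And>v. v \<in> S \<Longrightarrow> T v \<in> S" "\<not> range P \<subseteq> S"
    using assms(3) unfolding cyclic_def by blast
  let ?S = "S \<inter> range P"
  let ?N = "range P \<inter> orth form ?S"
  have S': "subspace ?S" using S(1) subspace_range_P by (rule subspace_inter)
  have TS: "T v \<in> ?S" if "v \<in> ?S" for v using that S(3) L_D(4)[OF T] by (auto simp: in_range_P)
  show ?thesis
  proof
    show "subspace ?N" by (intro subspace_inter subspace_range_P subspace_orth)
    then have "0 \<in> ?N" by (rule subspace_0)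
    moreover have "?N \<subseteq> {0} \<Longrightarrow> False"
      using orth_trivial_imp_eq[OF S' subspace_range_P] S(4) by blast
    ultimately show "?N \<noteq> {0}" by blast
    show "P v = v" if "v \<in> ?N" for v using that by (simp add: in_range_P)
    show "T v \<in> ?N" if "v \<in> ?N" for v
    proof -
      have "form (T v) w = 0" if "w \<in> ?S" for w
        using TS[OF that] \<open>v \<in> ?N\<close> by (simp add: L_D(2)[OF T] orth_def)
      then show ?thesis by (auto simp: orth_def in_range_P L_D(4)[OF T])
    qed
    show "form v u = 0" if "v \<in> ?N" for v
      using that S(2) u by (auto simp: orth_def in_range_P)
  qed
qed

text \<open>Thus cyclicity is the injectivity of a linear map depending linearly on \<open>T\<close>.\<close>
lemma cyclicI:
  assumes T: "T \<in> L" and u: "P u = u" and K: "\<And>x. x \<in> CT T \<Longrightarrow> x u = 0 \<Longrightarrow> x = 0"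
  shows "cyclic T u (range P)"
proof (rule ccontr)
  assume "\<not> ?thesis"
  then obtain N where N: "subspace N" "\<And>v. v \<in> N \<Longrightarrow> P v = v" "\<And>v. v \<in> N \<Longrightarrow> T v \<in> N" "N \<noteq> {0}"
    "\<And>v. v \<in> N \<Longrightarrow> form v u = 0"
    using not_cyclic_imp_orth[OF T u] by metis
  have TE: "T \<in> EndP" using T L_subset_EndP by blast
  obtain r where r: "r \<in> N" "r \<noteq> 0" using N(4) subspace_0[OF N(1)] by blast
  obtain \<psi> where \<psi>: "\<psi> \<in> CT T" "\<psi> \<noteq> 0" "\<And>v. \<psi> v \<in> N"
    using ex_commuting_into[OF TE N(1-3) r] by blast
  have hom: "hom \<psi>" using \<psi>(1) EndP_D(1) by (auto simp: CT_def)
  \<comment> \<open>The adjoint turns a map with values orthogonal to u into a map killing u, to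
    which \<open>K\<close> applies.\<close>
  have "adj \<psi> u = 0"
    by (rule form_eqI2) (simp add: N(5)[OF \<psi>(3)] flip: form_adj[OF hom])
  then have "adj \<psi> = 0" using K[OF adj_CT[OF \<psi>(1) T]] by blast
  then have "form (\<psi> v) w = 0" for v w by (simp add: form_adj[OF hom])
  then have "\<psi> = 0" using form_nondegenerate by (intro ext) (auto simp: zero_fun_def)
  then show False using \<psi>(2) by blast
qed

text \<open>The values at u of the maps in A form a T-stable submodule, since A is closed under
  sums, scalars and composition with T. Such a family A stands for E[T].\<close>

lemma cyclic_fill:
  assumes cyc: "cyclic T u (range P)" and u: "P u = u" and A: "P \<in> A"
    "\<And>x y. x \<in> A \<Longrightarrow> y \<in> A \<Longrightarrow> (\<lambda>v. x v + y v) \<in> A"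
    "\<And>a x. x \<in> A \<Longrightarrow> (\<lambda>v. scl a (x v)) \<in> A" "\<And>x. x \<in> A \<Longrightarrow> (\<lambda>v. T (x v)) \<in> A"
    and v: "P v = v"
  shows "\<exists>x\<in>A. x u = v"
proof -
  let ?S = "{v. \<exists>x\<in>A. x u = v}"
  have "v \<in> ?S"
  proof (rule cyclicD[OF cyc])
    show "subspace ?S"
      unfolding subspace_def
    proof (intro conjI ballI allI)
      show "0 \<in> ?S" using A(3)[OF A(1), of 0] by (intro CollectI bexI[of _ "\<lambda>v. scl 0 (P v)"]) auto
      fix v w assume "v \<in> ?S" "w \<in> ?S"
      then obtain y y' where "y \<in> A" "y' \<in> A" "y u = v" "y' u = w" by blast
      then show "v + w \<in> ?S"
        using A(2)[of y y'] by (intro CollectI bexI[of _ "\<lambda>v. y v + y' v"]) auto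
    next
      fix a v assume "v \<in> ?S"
      then obtain y where "y \<in> A" "y u = v" by blast
      then show "scl a v \<in> ?S"
        using A(3)[of y a] by (intro CollectI bexI[of _ "\<lambda>v. scl a (y v)"]) auto
    qed
    show "u \<in> ?S" using A(1) u by blast
    show "T v \<in> ?S" if v: "v \<in> ?S" for v
    proof -
      obtain y where "y \<in> A" "y u = v" using v by blast
      then show ?thesis using A(4)[of y] by (intro CollectI bexI[of _ "\<lambda>v. T (y v)"]) auto
    qed
    show "v \<in> range P" using v in_range_P by blast
  qed
  then show ?thesis by blast
qed

lemma CT_closed:
  assumes T: "T \<in> EndP"
  shows "P \<in> CT T" "x \<in> CT T \<Longrightarrow> y \<in> CT T \<Longrightarrow> (\<lambda>v. x v + y v) \<in> CT T"
    "x \<in> CT T \<Longrightarrow> y \<in> CT T \<Longrightarrow> (\<lambda>v. x v - y v) \<in> CT T"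
    "x \<in> CT T \<Longrightarrow> (\<lambda>v. scl a (x v)) \<in> CT T" "x \<in> CT T \<Longrightarrow> (\<lambda>v. T (x v)) \<in> CT T"
proof -
  note h = EndP_D[OF T]
  show "P \<in> CT T" using hom_P by (simp add: CT_def EndP_def h)
  show "(\<lambda>v. x v + y v) \<in> CT T" "(\<lambda>v. x v - y v) \<in> CT T" if "x \<in> CT T" "y \<in> CT T"
    using that
    by (auto simp: CT_def EndP_def hom_plus hom_sub hom_add[OF h(1)] hom_diff[OF h(1)] hom_add[OF hom_P]
        hom_diff[OF hom_P])
  show "(\<lambda>v. scl a (x v)) \<in> CT T" "(\<lambda>v. T (x v)) \<in> CT T" if "x \<in> CT T"
    using that by (auto simp: CT_def EndP_def hom_scl hom_comp h hom_scale[OF h(1)] hom_scale[OF hom_P])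
qed

lemma cyclic_ex_commuting:
  assumes "cyclic T u (range P)" "T \<in> EndP" "P u = u" "P v = v"
  shows "\<exists>x\<in>CT T. x u = v"
  by (rule cyclic_fill[OF assms(1,3) CT_closed(1,2,4,5)[OF assms(2)] assms(4)])

lemma EF_subspace_LT: "hom T \<Longrightarrow> EF.subspace (LT T)"
  using EF_subspace_L
  unfolding EF.subspace_def LT_def by (auto simp: sE_apply hom_add hom_scale hom_0)

lemma LT_subset_CT: "LT T \<subseteq> CT T"
  using L_subset_EndP by (auto simp: LT_def CT_def)

text \<open>Both components are combinations of x and \<open>adj x\<close>, and the adjoint commutes
  with T because T is skew.\<close>

lemma CT_decompose:
  assumes "x \<in> CT T" "T \<in> L"
  obtains x1 x2 where "x1 \<in> LT T" "x2 \<in> LT T" "\<And>v. x v = x1 v + scl \<delta> (x2 v)"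
    "\<And>v. adj x v = - x1 v + scl \<delta> (x2 v)"
proof -
  have x: "x \<in> EndP" "\<And>v. x (T v) = T (x v)" using assms by (auto simp: CT_def)
  have a: "adj x (T v) = T (adj x v)" for v
    using adj_CT[OF assms] by (simp add: CT_def)
  obtain x1 x2 where 1: "x1 \<in> L" "x2 \<in> L" "\<And>v. x v = x1 v + scl \<delta> (x2 v)"
    "\<And>v. adj x v = - x1 v + scl \<delta> (x2 v)"
    using EndP_decompose[OF x(1)] by blast
  have T: "hom T" using assms(2) L_D(1) by blast
  have "scl \<delta> (x2 v) + scl \<delta> (x2 v) = x v + adj x v" "x1 v + x1 v = x v - adj x v" for v
    using 1(3,4)[of v] by simp_all
  then have h: "x2 v = scl (\<delta>i * emb (1 / 2)) (x v + adj x v)" "x1 v = scl (emb (1 / 2)) (x v - adj x v)" for v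
    using scl_half[of "x2 v"] scl_half[of "x1 v"]
    by (metis scale_right_distrib scale_scale scl_\<delta>_\<delta>i(2) scl_half)+
  have "x1 \<in> LT T" "x2 \<in> LT T"
    using 1(1,2) by (auto simp: LT_def h x(2) a hom_scale[OF T] hom_add[OF T] hom_diff[OF T])
  then show ?thesis using that 1(3,4) by blast
qed

text \<open>Evaluation at u maps \<open>CT T\<close> bijectively onto \<open>range P\<close>, and
  \<open>CT T\<close> is the direct sum of \<open>LT T\<close> and \<open>\<delta>\<close> times it.
  So all cyclic elements have centralizers of the same dimension.\<close>

lemma cyclic_dim:
  assumes cyc: "cyclic T u (range P)" and T: "T \<in> L" and u: "P u = u"
  shows "2 * EF.dim (LT T) = VF.dim (range P)"
proof -
  have homT: "hom T" using L_D(1)[OF T] .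
  have TE: "T \<in> EndP" using T L_subset_EndP by blast
  let ?ev = "\<lambda>x::'v \<Rightarrow> 'v. x u" and ?ev\<delta> = "\<lambda>x::'v \<Rightarrow> 'v. scl \<delta> (x u)"
  have lin: "Vector_Spaces.linear sE sF ?ev" "Vector_Spaces.linear sE sF ?ev\<delta>"
    unfolding Vector_Spaces.linear_iff using EF.vector_space_axioms VF.vector_space_axioms
    by (auto simp: sE_apply sF_def algebra_simps)
  interpret ev: Vector_Spaces.linear sE sF ?ev by (rule lin)
  interpret ev\<delta>: Vector_Spaces.linear sE sF ?ev\<delta> by (rule lin)
  note sub = EF_subspace_LT[OF homT]
  have fin: "LT T \<subseteq> EF.span EF_gen" using L_span by (auto simp: LT_def)
  have inj: "x = 0" if "x \<in> LT T" "x u = 0" for x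
    using cyclic_imp_eq_0[OF cyc, of x] homT that LT_subset_CT by blast
  let ?X = "?ev ` LT T" and ?Y = "?ev\<delta> ` LT T"
  have dX: "VF.dim ?X = EF.dim (LT T)"
    by (rule ev.dim_image_inj[OF finite_EF_gen fin sub]) (rule inj)
  have dY: "VF.dim ?Y = EF.dim (LT T)"
    by (rule ev\<delta>.dim_image_inj[OF finite_EF_gen fin sub]) (auto intro: inj)
  have sX: "VF.subspace ?X" "VF.subspace ?Y"
    by (rule ev.subspace_image[OF sub], rule ev\<delta>.subspace_image[OF sub])
  \<comment> \<open>A map that is skew and also \<open>\<delta>\<close> times a skew map is both
    skew and hermitian, hence zero.\<close>
  have dis: "x = 0" if x: "x \<in> LT T" and y: "y \<in> LT T" and e: "x u = scl \<delta> (y u)" for x y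
  proof -
    have xL: "x \<in> L" "y \<in> L" using x y by (auto simp: LT_def)
    let ?w = "\<lambda>v. x v - scl \<delta> (y v)"
    have w: "?w \<in> CT T"
      using x y LT_subset_CT by (intro CT_closed(3,4)[OF TE]) auto
    have "?w = 0" by (rule cyclic_imp_eq_0[OF cyc w _ homT]) (simp add: e)
    then have xy: "x v = scl \<delta> (y v)" for v by (simp add: fun_eq_iff)
    have "form (x v) w = 0" for v w
    proof -
      have "form (x v) w = - form v (x w)" by (rule L_D(2)[OF xL(1)])
      also have "\<dots> = \<delta> * form v (y w)" by (simp add: xy form_scale_right cj_\<delta>)
      also have "\<dots> = - form (x v) w" by (simp add: xy form_scale L_D(2)[OF xL(2)])
      finally show ?thesis by (simp only: eq_neg_iff_add_eq_0 add_self_eq_0_iff)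
    qed
    then show ?thesis using form_nondegenerate by (intro ext) (auto simp: zero_fun_def)
  qed
  have "?X \<inter> ?Y = {0}"
  proof (intro equalityI subsetI)
    fix v assume "v \<in> ?X \<inter> ?Y"
    then obtain x y where "x \<in> LT T" "y \<in> LT T" "v = x u" "x u = scl \<delta> (y u)" by auto
    then show "v \<in> {0}" using dis[of x y] by simp
  qed (use VF.subspace_0[OF sX(1)] VF.subspace_0[OF sX(2)] in blast)
  moreover have "{a + b | a b. a \<in> ?X \<and> b \<in> ?Y} = range P"
  proof (intro equalityI subsetI)
    fix v assume "v \<in> {a + b | a b. a \<in> ?X \<and> b \<in> ?Y}"
    then obtain x y where "x \<in> LT T" "y \<in> LT T" "v = x u + scl \<delta> (y u)" by blast
    then show "v \<in> range P"
      unfolding in_range_P by (auto simp: LT_def L_D hom_add[OF hom_P] hom_scale[OF hom_P])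
  next
    fix v assume "v \<in> range P"
    then obtain x where x: "x \<in> CT T" "x u = v"
      using cyclic_ex_commuting[OF cyc TE u] in_range_P by blast
    obtain x1 x2 where "x1 \<in> LT T" "x2 \<in> LT T" "x u = x1 u + scl \<delta> (x2 u)"
      using CT_decompose[OF x(1) T] by metis
    then show "v \<in> {a + b | a b. a \<in> ?X \<and> b \<in> ?Y}" using x(2) by blast
  qed
  ultimately show ?thesis
    using VF.dim_direct_sum[OF finite_VF_gen VF_span_gen sX(1) VF_span_gen sX(2)] dX dY by simp
qed

section \<open>Generic members of a line and regularity\<close>

lemma finite_not_cyclic:
  assumes cyc: "cyclic T u (range P)" and T: "T \<in> L" and u: "P u = u" and \<eta>: "\<eta> \<in> L"
  shows "finite {s. \<not> cyclic (\<lambda>v. T v + scl (emb s) (\<eta> v)) u (range P)}"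
proof -
  have hT: "hom T" and h\<eta>: "hom \<eta>" using T \<eta> L_D(1) by auto
  let ?X = "{x \<in> EndP. x u = 0}"
  have X: "EF.subspace ?X"
    using EF_subspace_EndP unfolding EF.subspace_def by (auto simp: sE_apply)
  \<comment> \<open>By \<open>cyclicI\<close>, a parameter s without cyclicity yields a nonzero map
    killing u in the kernel of ad T + s ad \<eta>. At s = 0 this pencil is injective on such maps
    because T is cyclic.\<close>
  have "finite {s. \<exists>x\<in>?X. x \<noteq> 0 \<and> lie_bracket T x + sE s (lie_bracket \<eta> x) = 0}"
  proof (rule finite_singular_pencil[OF linear_bracket[OF hT] linear_bracket[OF h\<eta>] finite_EF_gen _ X])
    show "?X \<subseteq> EF.span EF_gen" using EndP_hom EF_span_gen by blast
    show "x = 0" if "x \<in> ?X" "lie_bracket T x = 0" for x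
      by (rule cyclic_imp_eq_0[OF cyc _ _ hT])
         (use that in \<open>auto simp: CT_def lie_bracket_def fun_eq_iff\<close>)
  qed
  moreover have "s \<in> {s. \<exists>x\<in>?X. x \<noteq> 0 \<and> lie_bracket T x + sE s (lie_bracket \<eta> x) = 0}"
    if nc: "\<not> cyclic (\<lambda>v. T v + scl (emb s) (\<eta> v)) u (range P)" for s
  proof -
    have SL: "(\<lambda>v. T v + scl (emb s) (\<eta> v)) \<in> L" by (intro L_add T L_scale \<eta>)
    obtain x where x: "x \<in> CT (\<lambda>v. T v + scl (emb s) (\<eta> v))" "x u = 0" "x \<noteq> 0"
      using nc cyclicI[OF SL u] by blast
    then have "x \<in> ?X" by (auto simp: CT_def)
    moreover have hx: "hom x" using x by (auto simp: CT_def EndP_def)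
    moreover have "lie_bracket T x + sE s (lie_bracket \<eta> x) = 0"
    proof
      fix v
      have "x (T v) + scl (emb s) (x (\<eta> v)) = T (x v) + scl (emb s) (\<eta> (x v))"
        using x(1) by (simp add: CT_def hom_add[OF hx] hom_scale[OF hx])
      then show "(lie_bracket T x + sE s (lie_bracket \<eta> x)) v = 0 v"
        by (simp add: lie_bracket_def sE_apply algebra_simps)
    qed
    ultimately show ?thesis using x(3) by blast
  qed
  ultimately show ?thesis by (elim rev_finite_subset) blast
qed

text \<open>On a complement C of \<open>LT \<eta>\<close>, ad(\<eta> + t T) is injective for almost
  all t, and almost all \<eta> + t T are cyclic, so that their centralizers have the dimension of
  \<open>LT T\<close>. A centralizer meeting C trivially has at most the dimension of
  \<open>LT \<eta>\<close>.\<close>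

lemma cyclic_dim_minimal:
  assumes cyc: "cyclic T u (range P)" and T: "T \<in> L" and u: "P u = u" and \<eta>: "\<eta> \<in> L"
  shows "EF.dim (LT T) \<le> EF.dim (LT \<eta>)"
proof -
  have hT: "hom T" and h\<eta>: "hom \<eta>" using T \<eta> L_D(1) by auto
  have sub: "LT \<eta> \<subseteq> L" by (auto simp: LT_def)
  obtain C where C: "EF.subspace C" "C \<subseteq> L" "LT \<eta> \<inter> C = {0}" "EF.dim L = EF.dim (LT \<eta>) + EF.dim C"
    using EF.subspace_complement[OF finite_EF_gen L_span EF_subspace_L sub EF_subspace_LT[OF h\<eta>]]
    by metis
  let ?B1 = "{t. \<exists>x\<in>C. x \<noteq> 0 \<and> lie_bracket \<eta> x + sE t (lie_bracket T x) = 0}"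
  let ?B2 = "{s. \<not> cyclic (\<lambda>v. T v + scl (emb s) (\<eta> v)) u (range P)}"
  have "finite ?B1"
  proof (rule finite_singular_pencil[OF linear_bracket[OF h\<eta>] linear_bracket[OF hT] finite_EF_gen _ C(1)])
    show "C \<subseteq> EF.span EF_gen" using C(2) L_span by blast
    show "x = 0" if "x \<in> C" "lie_bracket \<eta> x = 0" for x
    proof -
      have "x \<in> LT \<eta>" using that C(2) by (auto simp: LT_def lie_bracket_def fun_eq_iff)
      then show ?thesis using that C(3) by blast
    qed
  qed
  moreover have "finite ?B2" using finite_not_cyclic[OF cyc T u \<eta>] .
  \<comment> \<open>The second exceptional set concerns T + s \<eta>, which for s = 1/t is \<eta> +
    t T up to a scalar. Hence its inverses and t = 0 are excluded.\<close>
  ultimately have "finite (?B1 \<union> inverse ` ?B2 \<union> {0})" by blast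
  from ex_new_if_finite[OF infinite_UNIV_char_0 this]
  obtain t where t: "t \<notin> ?B1 \<union> inverse ` ?B2 \<union> {0}" by (rule exE)
  then have t1: "t \<notin> ?B1" and t0: "t \<noteq> 0" by auto
  have t2: "cyclic (\<lambda>v. T v + scl (emb (inverse t)) (\<eta> v)) u (range P)"
  proof (rule ccontr)
    assume "\<not> ?thesis"
    then have "inverse (inverse t) \<in> inverse ` ?B2" by blast
    then show False using t by simp
  qed
  define S where "S = (\<lambda>v. \<eta> v + scl (emb t) (T v))"
  have S: "S \<in> L" unfolding S_def by (intro L_add \<eta> L_scale T)
  have St: "T v + scl (emb (inverse t)) (\<eta> v) = scl (emb (inverse t)) (S v)" for v
    using emb_mult[of "inverse t" t] t0 by (simp add: S_def scale_right_distrib emb_one)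
  have "cyclic S u (range P)"
    unfolding cyclic_def
  proof (intro allI impI)
    fix A assume A: "subspace A" "u \<in> A" "\<forall>v\<in>A. S v \<in> A"
    have "T v + scl (emb (inverse t)) (\<eta> v) \<in> A" if "v \<in> A" for v
      unfolding St using A(3) that by (intro subspace_scale[OF A(1)]) blast
    then show "range P \<subseteq> A" using t2 A(1,2) unfolding cyclic_def by blast
  qed
  then have "EF.dim (LT S) = EF.dim (LT T)"
    using cyclic_dim[OF _ S u] cyclic_dim[OF cyc T u] by simp
  moreover have "EF.dim (LT S) + EF.dim C \<le> EF.dim L"
  proof (rule EF.dim_disjoint_le[OF finite_EF_gen L_span EF_subspace_L _ EF_subspace_LT C(2,1)])
    show "LT S \<subseteq> L" by (auto simp: LT_def)
    show "hom S" using L_D(1)[OF S] .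
    have "x = 0" if x: "x \<in> LT S" "x \<in> C" for x
    proof (rule ccontr)
      assume "x \<noteq> 0"
      have hx: "hom x" using x L_D(1) by (auto simp: LT_def)
      have "(lie_bracket \<eta> x + sE t (lie_bracket T x)) v = 0 v" for v
      proof -
        have "x (S v) = S (x v)" using x by (auto simp: LT_def)
        then show ?thesis
          by (simp add: S_def lie_bracket_def sE_apply hom_add[OF hx] hom_scale[OF hx] algebra_simps)
      qed
      then have "lie_bracket \<eta> x + sE t (lie_bracket T x) = 0" by blast
      then show False using t1 x(2) \<open>x \<noteq> 0\<close> by blast
    qed
    then show "LT S \<inter> C = {0}"
      using EF.subspace_0[OF EF_subspace_LT[OF L_D(1)[OF S]]] EF.subspace_0[OF C(1)] by blast
  qed
  ultimately show ?thesis using C(4) by simp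
qed

text \<open>
  If \<open>[\<eta>, x]\<close> did not lie in the image of \<open>ad T\<close>, then \<open>ad (T + t \<eta>)\<close> would have larger rank than
  \<open>ad T\<close> for generic \<open>t\<close>.
\<close>
lemma bracket_in_image:
  assumes T: "T \<in> L" and reg: "\<And>\<eta>. \<eta> \<in> L \<Longrightarrow> EF.dim (LT T) \<le> EF.dim (LT \<eta>)"
    and x: "x \<in> LT T" and \<eta>: "\<eta> \<in> L"
  shows "\<exists>c\<in>L. lie_bracket \<eta> x = lie_bracket T c"
proof (rule ccontr)
  assume none: "\<not> ?thesis"
  have hT: "hom T" and h\<eta>: "hom \<eta>" using T \<eta> L_D(1) by auto
  have xL: "x \<in> L" and xT: "lie_bracket T x = 0"
    using x by (auto simp: LT_def lie_bracket_def fun_eq_iff)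
  interpret bT: Vector_Spaces.linear sE sE "lie_bracket T" by (rule linear_bracket[OF hT])
  interpret b\<eta>: Vector_Spaces.linear sE sE "lie_bracket \<eta>" by (rule linear_bracket[OF h\<eta>])
  interpret p: vector_space_pair sE sE by unfold_locales
  have sub: "LT T \<subseteq> L" by (auto simp: LT_def)
  obtain C where C: "EF.subspace C" "C \<subseteq> L" "LT T \<inter> C = {0}" "EF.dim L = EF.dim (LT T) + EF.dim C"
    using EF.subspace_complement[OF finite_EF_gen L_span EF_subspace_L sub EF_subspace_LT[OF hT]]
    by metis
  have injC: "c = 0" if "c \<in> C" "lie_bracket T c = 0" for c
  proof -
    have "c \<in> LT T" using that C(2) by (auto simp: LT_def lie_bracket_def fun_eq_iff)
    then show ?thesis using that C(3) by blast
  qed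
  obtain A where A: "finite A" "A \<subseteq> C" "EF.independent A" "EF.span A = C" "card A = EF.dim C"
    using EF.subspace_finite_basis[OF finite_EF_gen order_trans[OF C(2) L_span] C(1)] by metis
  have x0: "x \<noteq> 0"
    using none EF.subspace_0[OF EF_subspace_L] b\<eta>.zero bT.zero by metis
  have xC: "x \<notin> EF.span A" using A(4) C(3) x x0 by blast
  have ind: "EF.independent (insert x A)" using A(3) xC by (simp add: EF.independent_insert)
  have xA: "x \<notin> A" using xC EF.span_base by blast
  let ?v = "lie_bracket \<eta> x"
  \<comment> \<open>On C the pencil f + t g is ad(T + t \<eta>). On x, where ad T vanishes, the
    factor t of [t \<eta>, x] is divided out; f is then injective on the enlarged space because
    [\<eta>, x] is not in the image of ad T.\<close>
  obtain f where f: "Vector_Spaces.linear sE sE f"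
    "\<And>a. a \<in> insert x A \<Longrightarrow> f a = (if a = x then ?v else lie_bracket T a)"
    using p.linear_independent_extend[OF ind, of "\<lambda>a. if a = x then ?v else lie_bracket T a"] by blast
  obtain g where g: "Vector_Spaces.linear sE sE g"
    "\<And>a. a \<in> insert x A \<Longrightarrow> g a = (if a = x then 0 else lie_bracket \<eta> a)"
    using p.linear_independent_extend[OF ind, of "\<lambda>a. if a = x then 0 else lie_bracket \<eta> a"] by blast
  interpret f: Vector_Spaces.linear sE sE f by fact
  interpret g: Vector_Spaces.linear sE sE g by fact
  have fC: "f c = lie_bracket T c" if "c \<in> C" for c
    by (rule p.linear_eq_on[OF f(1) linear_bracket[OF hT], of c A])
       (use that A(4) f(2) xA in auto)
  have gC: "g c = lie_bracket \<eta> c" if "c \<in> C" for c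
    by (rule p.linear_eq_on[OF g(1) linear_bracket[OF h\<eta>], of c A])
       (use that A(4) g(2) xA in auto)
  have fx: "f x = ?v" and gx: "g x = 0" using f(2) g(2) by auto
  let ?X = "EF.span (insert x A)"
  have X: "\<exists>c\<in>C. \<exists>s. y = c + sE s x" if "y \<in> ?X" for y
  proof -
    obtain s where "y - sE s x \<in> C" using \<open>y \<in> ?X\<close> unfolding EF.span_insert A(4) by blast
    then show ?thesis by (intro bexI[of _ "y - sE s x"] exI[of _ s]) auto
  qed
  have XI: "c + sE s x \<in> ?X" if "c \<in> C" for c s
  proof (rule EF.span_add)
    show "c \<in> ?X" using that A(4) EF.span_mono[of A "insert x A"] by blast
    show "sE s x \<in> ?X" by (intro EF.span_scale EF.span_base) simp
  qed
  have XL: "?X \<subseteq> L" using A(2) C(2) xL by (intro EF.span_minimal EF_subspace_L) auto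
  have "finite {t. \<exists>y\<in>?X. y \<noteq> 0 \<and> f y + sE t (g y) = 0}"
  proof (rule finite_singular_pencil[OF f(1) g(1) finite_EF_gen _ EF.subspace_span])
    show "?X \<subseteq> EF.span EF_gen" using XL L_span by blast
    fix y assume y: "y \<in> ?X" "f y = 0"
    then obtain c s where cs: "c \<in> C" "y = c + sE s x" using X by blast
    then have e: "lie_bracket T c + sE s ?v = 0" using y by (simp add: f.add f.scale fC fx)
    have "s = 0"
    proof (rule ccontr)
      assume s: "s \<noteq> 0"
      have "sE s ?v = - lie_bracket T c" using e by (simp add: eq_neg_iff_add_eq_0 add.commute)
      then have "sE (inverse s) (sE s ?v) = lie_bracket T (sE (inverse s) (- c))"
        by (simp only: bT.scale bT.neg)
      then have "?v = lie_bracket T (sE (inverse s) (- c))" using s by simp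
      moreover have "sE (inverse s) (- c) \<in> L"
        using cs(1) C(2) by (intro EF.subspace_scale[OF EF_subspace_L] EF.subspace_neg[OF EF_subspace_L]) auto
      ultimately show False using none by blast
    qed
    then show "y = 0" using cs e injC by simp
  qed
  then have "finite (insert 0 {t. \<exists>y\<in>?X. y \<noteq> 0 \<and> f y + sE t (g y) = 0})" by simp
  from ex_new_if_finite[OF infinite_UNIV_char_0 this]
  obtain t where "t \<notin> insert 0 {t. \<exists>y\<in>?X. y \<noteq> 0 \<and> f y + sE t (g y) = 0}" by (rule exE)
  then have t0: "t \<noteq> 0" and t: "\<And>y. y \<in> ?X \<Longrightarrow> f y + sE t (g y) = 0 \<Longrightarrow> y = 0" by blast+
  define S where "S = (\<lambda>v. T v + scl (emb t) (\<eta> v))"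
  have S: "S \<in> L" unfolding S_def by (intro L_add \<eta> L_scale T)
  have "EF.dim (LT S) + EF.dim ?X \<le> EF.dim L"
  proof (rule EF.dim_disjoint_le[OF finite_EF_gen L_span EF_subspace_L _ EF_subspace_LT XL EF.subspace_span])
    show "LT S \<subseteq> L" by (auto simp: LT_def)
    show "hom S" using L_D(1)[OF S] .
    have "y = 0" if y: "y \<in> LT S" "y \<in> ?X" for y
    proof -
      obtain c s where cs: "c \<in> C" "y = c + sE s x" using X y(2) by blast
      have hy: "hom y" using y L_D(1) by (auto simp: LT_def)
      have "(lie_bracket T y + sE t (lie_bracket \<eta> y)) v = 0 v" for v
      proof -
        have "y (S v) = S (y v)" using y by (auto simp: LT_def)
        then show ?thesis
          by (simp add: S_def lie_bracket_def sE_apply hom_add[OF hy] hom_scale[OF hy] algebra_simps)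
      qed
      then have "lie_bracket T y + sE t (lie_bracket \<eta> y) = 0" by blast
      then have "lie_bracket T c + sE t (lie_bracket \<eta> c) + sE (t * s) ?v = 0"
        by (simp add: cs(2) bT.add bT.scale b\<eta>.add b\<eta>.scale xT EF.scale_right_distrib add.assoc)
      then have "f (c + sE (t * s) x) + sE t (g (c + sE (t * s) x)) = 0"
        by (simp add: f.add f.scale g.add g.scale fC gC fx gx cs(1) add.assoc add.commute add.left_commute)
      then have z: "c + sE (t * s) x = 0" using t XI[OF cs(1)] by blast
      have "t * s = 0"
      proof (rule ccontr)
        assume ts: "t * s \<noteq> 0"
        have "sE (t * s) x = - c" using z by (simp add: eq_neg_iff_add_eq_0 add.commute)
        then have "sE (inverse (t * s)) (sE (t * s) x) = sE (inverse (t * s)) (- c)" by simp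
        then have "x = sE (inverse (t * s)) (- c)"
          by (simp only: EF.scale_scale left_inverse[OF ts] EF.scale_one)
        moreover have "\<dots> \<in> C"
          using cs(1) by (intro EF.subspace_scale[OF C(1)] EF.subspace_neg[OF C(1)])
        ultimately show False using xC A(4) by simp
      qed
      then show ?thesis using z cs(2) t0 by simp
    qed
    then show "LT S \<inter> ?X = {0}"
      using EF.subspace_0[OF EF_subspace_LT[OF L_D(1)[OF S]]] EF.span_zero by blast
  qed
  moreover have "EF.dim ?X = Suc (EF.dim C)"
    using EF.dim_span_eq_card_independent[OF ind] A(1,5) xA by simp
  ultimately show False using reg[OF S] C(4) by simp
qed

text \<open>The trace form of \<eta> against [x, y] equals that of [\<eta>, x] against y. As
  [\<eta>, x] is some [T, c], moving T around the trace leaves c against [y, T] = 0.\<close>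

lemma minimal_imp_abelian:
  assumes T: "T \<in> L" and reg: "\<And>\<eta>. \<eta> \<in> L \<Longrightarrow> EF.dim (LT T) \<le> EF.dim (LT \<eta>)"
    and x: "x \<in> LT T" and y: "y \<in> LT T"
  shows "x (y v) = y (x v)"
proof -
  have L: "x \<in> L" "y \<in> L" and yT: "\<And>v. y (T v) = T (y v)" using x y by (auto simp: LT_def)
  note h = L_D(1)[OF L(1)] L_D(1)[OF L(2)] L_D(1)[OF T]
  have "lie_bracket x y = 0"
  proof (rule L_trace_nondegenerate[OF L_bracket[OF L]])
    fix \<eta> assume \<eta>: "\<eta> \<in> L"
    note h\<eta> = L_D(1)[OF \<eta>]
    obtain c where c: "c \<in> L" "lie_bracket \<eta> x = lie_bracket T c"
      using bracket_in_image[OF T reg x \<eta>] by blast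
    note hc = L_D(1)[OF c(1)]
    have "tr (\<lambda>v. \<eta> (lie_bracket x y v)) = tr (\<lambda>v. \<eta> (x (y v))) - tr (\<lambda>v. \<eta> (y (x v)))"
      by (simp add: lie_bracket_def hom_diff[OF h\<eta>] tr_diff)
    also have "tr (\<lambda>v. \<eta> (y (x v))) = tr (\<lambda>v. x (\<eta> (y v)))"
      using tr_commute[OF h(1) hom_comp[OF h\<eta> h(2)]] by simp
    also have "tr (\<lambda>v. \<eta> (x (y v))) - tr (\<lambda>v. x (\<eta> (y v))) = tr (\<lambda>v. lie_bracket \<eta> x (y v))"
      by (simp add: lie_bracket_def tr_diff)
    also have "\<dots> = tr (\<lambda>v. T (c (y v))) - tr (\<lambda>v. c (T (y v)))"
      unfolding c(2) by (simp add: lie_bracket_def tr_diff)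
    also have "tr (\<lambda>v. T (c (y v))) = tr (\<lambda>v. c (y (T v)))"
      using tr_commute[OF h(3) hom_comp[OF hc h(2)]] by simp
    finally show "tr (\<lambda>v. \<eta> (lie_bracket x y v)) = 0" by (simp add: yT)
  qed
  then show ?thesis by (simp add: lie_bracket_def fun_eq_iff)
qed

end

subsection \<open>The dual of the Lie algebra\<close>

lemma inner_mult_one_cancel:
  fixes c c' :: "'f::real_or_complex"
  assumes "\<And>a. (a * c) \<bullet> 1 = (a * c') \<bullet> 1"
  shows "c = c'"
proof (rule ccontr)
  assume "c \<noteq> c'"
  have "(inverse (c - c') * (c - c')) \<bullet> 1 = 0"
    using assms by (simp only: right_diff_distrib inner_diff_left)
  with \<open>c \<noteq> c'\<close> show False by simp
qed

context hermitian_summand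
begin

lemma L_sE: "x \<in> L \<Longrightarrow> sE a x \<in> L"
  by (rule EF.subspace_scale[OF EF_subspace_L])

lemma L_plus: "x \<in> L \<Longrightarrow> y \<in> L \<Longrightarrow> x + y \<in> L"
  by (rule EF.subspace_add[OF EF_subspace_L])

lemma dual_eq_pairing:
  assumes "\<xi> \<in> lie_dual emb scl L" "x \<in> L"
  shows "\<xi> (sE a x) = \<i> * of_real ((a * pairing emb scl x \<xi>) \<bullet> 1)"
    and "\<xi> x = \<i> * of_real (pairing emb scl x \<xi> \<bullet> 1)"
proof -
  show 1: "\<xi> (sE a x) = \<i> * of_real ((a * pairing emb scl x \<xi>) \<bullet> 1)" for a
    by (rule pairing_eq[OF assms]) (rule L_sE)
  show "\<xi> x = \<i> * of_real (pairing emb scl x \<xi> \<bullet> 1)"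
    using 1[of 1] by simp
qed

lemma pairing_unique:
  assumes "\<xi> \<in> lie_dual emb scl L" "x \<in> L" "\<And>a. \<xi> (sE a x) = \<i> * of_real ((a * c) \<bullet> 1)"
  shows "pairing emb scl x \<xi> = c"
  by (rule inner_mult_one_cancel) (use assms(3) dual_eq_pairing(1)[OF assms(1,2)] in simp)

lemma pairing_add:
  assumes "\<xi> \<in> lie_dual emb scl L" "x \<in> L" "y \<in> L"
  shows "pairing emb scl (x + y) \<xi> = pairing emb scl x \<xi> + pairing emb scl y \<xi>"
proof (rule pairing_unique[OF assms(1) L_plus[OF assms(2,3)]])
  fix a
  have "\<xi> (sE a (x + y)) = \<xi> (sE a x) + \<xi> (sE a y)"
    using assms L_sE by (simp add: EF.scale_right_distrib lie_dual_def)
  then show "\<xi> (sE a (x + y)) = \<i> * of_real ((a * (pairing emb scl x \<xi> + pairing emb scl y \<xi>)) \<bullet> 1)"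
    by (simp add: dual_eq_pairing(1)[OF assms(1)] assms distrib_left inner_add_left)
qed

lemma pairing_scale:
  assumes "\<xi> \<in> lie_dual emb scl L" "x \<in> L"
  shows "pairing emb scl (sE c x) \<xi> = c * pairing emb scl x \<xi>"
  by (rule pairing_unique[OF assms(1) L_sE[OF assms(2)]])
     (simp add: dual_eq_pairing(1)[OF assms] mult.assoc)

lemma pairing_0:
  assumes "\<xi> \<in> lie_dual emb scl L"
  shows "pairing emb scl 0 \<xi> = 0"
  using pairing_scale[OF assms EF.subspace_0[OF EF_subspace_L], of 0] by simp

lemma dual_frame: "(\<Sum>b\<in>B. scl (form v b) (d b)) = v"
proof -
  have "adj (\<lambda>v. v) = (\<lambda>v. v)" by (rule adj_unique[OF hom_ident]) simp
  from fun_cong[OF this, of v] show ?thesis unfolding adj_def by (simp flip: form_cj)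
qed

text \<open>x is half the sum over b of \<open>rk (P (d b)) (P (x b))\<close>: one term of
  \<open>rk\<close> sums to x by \<open>frame\<close>, the other by skewness and
  \<open>dual_frame\<close>.\<close>

lemma L_rk_induct:
  assumes x: "x \<in> L" and X: "EF.subspace X" "\<And>u v. rk (P u) (P v) \<in> X"
  shows "x \<in> X"
proof -
  have "x = sE (1 / 2) (\<Sum>b\<in>B. rk (P (d b)) (P (x b)))"
  proof
    fix w
    have "(\<Sum>b\<in>B. rk (P (d b)) (P (x b))) w
        = (\<Sum>b\<in>B. scl (form (P w) (d b)) (x b)) + (\<Sum>b\<in>B. scl (form (x w) b) (P (d b)))"
      by (simp add: sum_fun_apply rk_def L_D[OF x] P_form[symmetric] sum.distrib[symmetric])
    also have "(\<Sum>b\<in>B. scl (form (P w) (d b)) (x b)) = x w"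
      using hom_frame[OF L_D(1)[OF x], of "P w"] by (simp add: L_D[OF x])
    also have "(\<Sum>b\<in>B. scl (form (x w) b) (P (d b))) = P (\<Sum>b\<in>B. scl (form (x w) b) (d b))"
      by (simp add: hom_sum[OF hom_P] hom_scale[OF hom_P])
    also have "\<dots> = x w" by (simp only: dual_frame L_D(4)[OF x])
    finally show "x w = sE (1 / 2) (\<Sum>b\<in>B. rk (P (d b)) (P (x b))) w"
      using scl_half[of "x w"] by (simp add: sE_apply scale_right_distrib)
  qed
  also have "\<dots> \<in> X"
    by (intro EF.subspace_scale[OF X(1)] EF.subspace_sum[OF X(1)] X(2))
  finally show ?thesis .
qed

text \<open>An element a of \<open>E\<close> is recovered from the traces of a and
  \<open>\<delta>\<close> a as tre(a)/2 + \<open>\<delta>i\<close> tre(\<open>\<delta>\<close> a)/2.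
  For a = <T v, u> with T representing \<xi>, \<open>tr_rk\<close> identifies these traces with the
  pairings with \<open>rk\<close> at v and at \<open>\<delta>\<close> v.\<close>

definition dual_form :: "(('v \<Rightarrow> 'v) \<Rightarrow> complex) \<Rightarrow> 'v \<Rightarrow> 'v \<Rightarrow> 'e" where
  "dual_form \<xi> v u = emb (pairing emb scl (rk (P u) (P v)) \<xi> / 2)
      + \<delta>i * emb (pairing emb scl (rk (P u) (P (scl \<delta> v))) \<xi> / 2)"

text \<open>The element \<open>T\<close> of \<open>L\<close> representing \<open>\<xi>\<close> through the trace form.\<close>
definition rep :: "(('v \<Rightarrow> 'v) \<Rightarrow> complex) \<Rightarrow> 'v \<Rightarrow> 'v" where
  "rep \<xi> u = - (\<Sum>b\<in>B. scl (cj (dual_form \<xi> b u)) (d b))"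

lemma rk_add: "rk u (v + w) = rk u v + rk u w"
  and rk_swap: "rk v u = sE (- 1) (rk u v)"
  and rk_emb: "rk u (scl (emb c) v) = sE c (rk u v)"
  and rk_emb_left: "rk (scl (emb c) u) v = sE c (rk u v)"
  and rk_\<delta>: "rk u (scl \<delta> v) = rk (scl (- \<delta>) u) v"
  by (auto simp: rk_def sE_apply form_simps cj_emb cj_minus cj_\<delta> emb_minus emb_one algebra_simps)

context
  fixes \<xi> assumes \<xi>: "\<xi> \<in> lie_dual emb scl L"
begin

private lemma rkL: "rk (P u) (P v) \<in> L"
  by (rule rk_in_L) simp_all

private lemma rkL_scale: "rk (P u) (scl a (P v)) \<in> L" "rk (scl a (P u)) (P v) \<in> L"
  by (rule rk_in_L; simp add: hom_scale[OF hom_P])+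

private abbreviation f where "f v u \<equiv> pairing emb scl (rk (P u) (P v)) \<xi>"

private lemma f_add: "f (v + w) u = f v u + f w u"
  by (simp add: hom_add[OF hom_P] rk_add pairing_add[OF \<xi>] rkL)

private lemma f_emb: "f (scl (emb c) v) u = c * f v u"
  by (simp add: hom_scale[OF hom_P] rk_emb pairing_scale[OF \<xi>] rkL)

private lemma f_swap: "f u v = - f v u"
  using pairing_scale[OF \<xi> rkL, of "- 1" u v] by (simp add: rk_swap[of "P v" "P u"])

private lemma f_\<delta>: "f (scl \<delta> v) u = - f v (scl \<delta> u)"
proof -
  have "rk (P u) (scl \<delta> (P v)) = rk (scl (emb (- 1)) (scl \<delta> (P u))) (P v)"
    by (simp add: rk_\<delta> emb_minus emb_one)
  also have "\<dots> = sE (- 1) (rk (scl \<delta> (P u)) (P v))"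
    by (rule rk_emb_left)
  finally show ?thesis
    using pairing_scale[OF \<xi> rkL_scale(2), of "- 1" \<delta> u v] by (simp add: hom_scale[OF hom_P])
qed

private lemma df_add: "dual_form \<xi> (v + w) u = dual_form \<xi> v u + dual_form \<xi> w u"
  by (simp add: dual_form_def scale_right_distrib f_add add_divide_distrib emb_add algebra_simps)

private lemma df_scale: "dual_form \<xi> (scl a v) u = a * dual_form \<xi> v u"
proof -
  have emb: "dual_form \<xi> (scl (emb c) v) u = emb c * dual_form \<xi> v u" for c v
  proof -
    have e1: "f (scl \<delta> (scl (emb c) v)) u = c * f (scl \<delta> v) u"
      by (subst scale_left_commute) (rule f_emb)
    have e2: "emb (c * y / 2) = emb c * emb (y / 2)" for y by (simp flip: emb_mult)
    show ?thesis
      unfolding dual_form_def f_emb e1 e2 by (simp only: distrib_left ac_simps)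
  qed
  have \<delta>: "dual_form \<xi> (scl \<delta> v) u = \<delta> * dual_form \<xi> v u" for v
  proof -
    have "f (scl \<delta> (scl \<delta> v)) u = D * f v u"
      using f_emb[where c = D and v = v and u = u] by (simp add: \<delta>_sq)
    moreover have "\<delta>i * emb (D * f v u / 2) = \<delta> * emb (f v u / 2)"
    proof -
      have "\<delta>i * emb (D * (f v u / 2)) = (\<delta>i * (\<delta> * \<delta>)) * emb (f v u / 2)"
        unfolding emb_mult \<delta>_sq by (simp only: mult.assoc)
      then show ?thesis by simp
    qed
    ultimately show ?thesis by (simp add: dual_form_def distrib_left add.commute)
  qed
  obtain p q where a: "a = emb p + emb q * \<delta>" using gen_\<delta> by blast
  have "scl a v = scl (emb p) v + scl (emb q) (scl \<delta> v)" by (simp add: a algebra_simps)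
  then show ?thesis by (simp only: df_add emb \<delta>) (simp add: a algebra_simps)
qed

private lemma df_sum: "dual_form \<xi> (sum g A) u = (\<Sum>a\<in>A. dual_form \<xi> (g a) u)"
  using df_scale[of 0 0 u] by (induction A rule: infinite_finite_induct) (auto simp: df_add)

private lemma df_skew: "dual_form \<xi> u v = - cj (dual_form \<xi> v u)"
proof -
  have "f (scl \<delta> u) v = - f u (scl \<delta> v)" by (rule f_\<delta>)
  also have "\<dots> = f (scl \<delta> v) u" by (subst f_swap) simp
  finally show ?thesis
    using f_swap[of u v]
    by (simp add: dual_form_def cj_add cj_diff cj_mult cj_emb cj_\<delta>i emb_minus)
qed

lemma form_rep: "form (rep \<xi> v) u = dual_form \<xi> v u"
proof -
  have G: "form v (rep \<xi> u) = - dual_form \<xi> v u" for u v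
  proof -
    have "dual_form \<xi> v u = (\<Sum>b\<in>B. form v (d b) * dual_form \<xi> b u)"
      by (subst (1) frame[of v, symmetric]) (simp add: df_sum df_scale)
    then show ?thesis
      unfolding rep_def by (simp add: form_minus form_sum form_scale_right cj_cj mult.commute)
  qed
  then show ?thesis using form_cj[of "rep \<xi> v" u] df_skew[of v u] by (simp add: cj_minus)
qed

lemma rep_in_L: "rep \<xi> \<in> L"
proof (rule L_I)
  have P: "dual_form \<xi> (P v) u = dual_form \<xi> v u" for u v
    by (simp add: dual_form_def hom_scale[OF hom_P])
  show "hom (rep \<xi>)"
    by (rule homI; rule form_eqI) (simp_all add: form_add form_scale form_rep df_add df_scale)
  show "form (rep \<xi> v) w = - form v (rep \<xi> w)" for v w
    using form_cj[of v "rep \<xi> w"] df_skew[of v w] by (simp add: form_rep)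
  show "rep \<xi> (P v) = rep \<xi> v" for v
    by (rule form_eqI) (simp add: form_rep P)
qed

text \<open>Both sides are F-linear in x, and on rank two elements the identity is the definition of
  \<open>dual_form\<close> read through its trace.\<close>

lemma emb_pairing:
  assumes "x \<in> L"
  shows "emb (pairing emb scl x \<xi>) = tr (\<lambda>v. x (rep \<xi> v))"
proof -
  note R = L_D[OF rep_in_L]
  let ?X = "{x \<in> L. emb (pairing emb scl x \<xi>) = tr (\<lambda>v. x (rep \<xi> v))}"
  have "x \<in> ?X"
  proof (rule L_rk_induct[OF assms])
    show "EF.subspace ?X"
      using EF.subspace_0[OF EF_subspace_L] tr_scale[of 0 "\<lambda>v. 0"]
      unfolding EF.subspace_def
      by (auto simp: L_plus L_sE pairing_0[OF \<xi>] pairing_add[OF \<xi>] pairing_scale[OF \<xi>] emb_add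
          emb_mult tr_add tr_scale sE_apply)
    have "tre (dual_form \<xi> v u) = f v u" for u v
    proof -
      have "emb (f v u / 2) + emb (f v u / 2) = emb (f v u)" by (simp flip: emb_add)
      then show ?thesis
        by (simp add: tre_eq_iff dual_form_def cj_add cj_mult cj_emb cj_\<delta>i)
    qed
    then have "tr (\<lambda>w. rk (P u) (P v) (rep \<xi> w)) = emb (f v u)" for u v
      using tr_rk[OF R(1), of "P u" "P v"] R(2)
      by (simp add: eq_neg_iff_add_eq_0[symmetric] form_rep dual_form_def hom_scale[OF hom_P])
    then show "rk (P u) (P v) \<in> ?X" for u v by (simp add: rkL)
  qed
  then show ?thesis by blast
qed

lemma rep_unique:
  assumes T: "T \<in> L" "\<And>x. x \<in> L \<Longrightarrow> emb (pairing emb scl x \<xi>) = tr (\<lambda>v. x (T v))"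
  shows "rep \<xi> = T"
proof -
  let ?m = "\<lambda>v. rep \<xi> v + scl (emb (- 1)) (T v)"
  have "?m \<in> L" by (intro L_add L_scale rep_in_L T)
  then have "?m = 0"
  proof (rule L_trace_nondegenerate)
    fix \<eta> assume \<eta>: "\<eta> \<in> L"
    note h = L_D(1)[OF \<eta>]
    show "tr (\<lambda>v. \<eta> (?m v)) = 0"
      using T(2)[OF \<eta>] emb_pairing[OF \<eta>]
      by (simp add: hom_diff[OF h] tr_diff emb_minus emb_one)
  qed
  then show ?thesis by (simp add: fun_eq_iff emb_minus emb_one)
qed

text \<open>For complex F the functional is, up to the factor i, only the real part of the pairing;
  stability of X under F restores the rest.\<close>

lemma dual_eq_0_iff:
  assumes "\<And>a x. x \<in> X \<Longrightarrow> sE a x \<in> X" "X \<subseteq> L"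
  shows "(\<forall>x\<in>X. \<xi> x = 0) \<longleftrightarrow> (\<forall>x\<in>X. pairing emb scl x \<xi> = 0)"
proof
  assume 0: "\<forall>x\<in>X. \<xi> x = 0"
  show "\<forall>x\<in>X. pairing emb scl x \<xi> = 0"
    using 0 assms by (intro ballI pairing_unique[OF \<xi>]) auto
next
  assume "\<forall>x\<in>X. pairing emb scl x \<xi> = 0"
  then show "\<forall>x\<in>X. \<xi> x = 0" using dual_eq_pairing(2)[OF \<xi>] assms(2) by auto
qed

lemma tr_bracket:
  assumes "hom x" "hom y" "hom T"
  shows "tr (\<lambda>v. lie_bracket x y (T v)) = tr (\<lambda>v. y (lie_bracket T x v))"
proof -
  have "tr (\<lambda>v. x (y (T v))) = tr (\<lambda>v. y (T (x v)))"
    using tr_commute[OF assms(1) hom_comp[OF assms(2,3)]] by simp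
  then show ?thesis by (simp add: lie_bracket_def tr_diff hom_diff[OF assms(2)])
qed

text \<open>By invariance, the trace form of T against [x, y] is that of [T, x] against y, and the
  trace form is nondegenerate on \<open>L\<close>.\<close>

lemma lie_centralizer_eq: "lie_centralizer L \<xi> = LT (rep \<xi>)"
proof -
  have "coad L x \<xi> = 0 \<longleftrightarrow> (\<forall>v. x (rep \<xi> v) = rep \<xi> (x v))" if x: "x \<in> L" for x
  proof -
    note h = L_D(1)[OF x] L_D(1)[OF rep_in_L]
    have "coad L x \<xi> = 0 \<longleftrightarrow> (\<forall>w\<in>lie_bracket x ` L. \<xi> w = 0)"
      by (auto simp: coad_def fun_eq_iff)
    also have "\<dots> \<longleftrightarrow> (\<forall>w\<in>lie_bracket x ` L. pairing emb scl w \<xi> = 0)"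
    proof (rule dual_eq_0_iff)
      interpret b: Vector_Spaces.linear sE sE "lie_bracket x" by (rule linear_bracket[OF h(1)])
      show "sE a w \<in> lie_bracket x ` L" if "w \<in> lie_bracket x ` L" for a w
        using that L_sE by (auto simp flip: b.scale)
      show "lie_bracket x ` L \<subseteq> L" using L_bracket[OF x] by blast
    qed
    also have "\<dots> \<longleftrightarrow> (\<forall>y\<in>L. tr (\<lambda>v. y (lie_bracket (rep \<xi>) x v)) = 0)"
    proof -
      have "pairing emb scl (lie_bracket x y) \<xi> = 0 \<longleftrightarrow> tr (\<lambda>v. y (lie_bracket (rep \<xi>) x v)) = 0"
        if y: "y \<in> L" for y
        using emb_pairing[OF L_bracket[OF x y]] tr_bracket[OF h(1) L_D(1)[OF y] h(2)]
        by (metis emb_eq_0_iff)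
      then show ?thesis by blast
    qed
    also have "\<dots> \<longleftrightarrow> lie_bracket (rep \<xi>) x = 0"
    proof
      assume "lie_bracket (rep \<xi>) x = 0"
      moreover have "tr (\<lambda>v. 0) = 0" using tr_scale[of 0 "\<lambda>v. 0"] by simp
      ultimately show "\<forall>y\<in>L. tr (\<lambda>v. y (lie_bracket (rep \<xi>) x v)) = 0"
        by (auto simp: hom_0[OF L_D(1)])
    qed (use L_trace_nondegenerate[OF L_bracket[OF rep_in_L x]] in blast)
    also have "\<dots> \<longleftrightarrow> (\<forall>v. x (rep \<xi> v) = rep \<xi> (x v))"
      by (auto simp: lie_bracket_def fun_eq_iff)
    finally show ?thesis .
  qed
  then show ?thesis unfolding lie_centralizer_def LT_def by blast
qed

end

text \<open>For x and T in \<open>L\<close> the trace of x T already lies in F, so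
  \<open>tre\<close> doubles it; hence the division by 2.\<close>

definition dual_of :: "('v \<Rightarrow> 'v) \<Rightarrow> ('v \<Rightarrow> 'v) \<Rightarrow> complex" where
  "dual_of T x = (if x \<in> L then \<i> * of_real ((tre (tr (\<lambda>v. x (T v))) / 2) \<bullet> 1) else 0)"

lemma dual_of_in_dual: "dual_of T \<in> lie_dual emb scl L"
proof -
  have "(of_real r * c) \<bullet> 1 = r * (c \<bullet> 1)" for r and c :: 'f
    by (simp flip: scaleR_conv_of_real)
  then show ?thesis
    unfolding lie_dual_def
    by (auto simp: dual_of_def L_plus L_sE sE_apply tr_add tr_scale tre_add tre_mult
        add_divide_distrib inner_add_left distrib_left simp flip: times_divide_eq_right)
qed

lemma pairing_dual_of:
  assumes "x \<in> L"
  shows "pairing emb scl x (dual_of T) = tre (tr (\<lambda>v. x (T v))) / 2"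
  by (rule pairing_unique[OF dual_of_in_dual assms])
     (simp add: dual_of_def L_sE assms sE_apply tr_scale tre_mult)

lemma rep_dual_of:
  assumes T: "T \<in> L"
  shows "rep (dual_of T) = T"
proof (rule rep_unique[OF dual_of_in_dual T])
  fix x assume x: "x \<in> L"
  let ?X = "{x \<in> L. \<exists>c. tr (\<lambda>v. x (T v)) = emb c}"
  have "x \<in> ?X"
  proof (rule L_rk_induct[OF x])
    show "EF.subspace ?X"
      using EF.subspace_0[OF EF_subspace_L] tr_scale[of 0 "\<lambda>v. 0"]
      unfolding EF.subspace_def
      by (auto simp: L_plus L_sE tr_add tr_scale sE_apply simp flip: emb_add emb_mult intro: exI[of _ 0])
    show "rk (P u) (P v) \<in> ?X" for u v
      using tr_rk[OF L_D(1)[OF T], of "P u" "P v"] L_D(2)[OF T] rk_in_L[of "P u" "P v"] by auto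
  qed
  then obtain c where c: "tr (\<lambda>v. x (T v)) = emb c" by blast
  have "tre (emb c) = c + c" by (simp only: tre_eq_iff emb_add cj_emb)
  then show "emb (pairing emb scl x (dual_of T)) = tr (\<lambda>v. x (T v))"
    by (simp add: pairing_dual_of[OF x] c)
qed

lemma lie_regular_iff:
  assumes \<xi>: "\<xi> \<in> lie_dual emb scl L"
  shows "lie_regular emb scl L \<xi> \<longleftrightarrow> (\<forall>\<eta>\<in>L. EF.dim (LT (rep \<xi>)) \<le> EF.dim (LT \<eta>))"
proof -
  have "(\<forall>\<zeta>\<in>lie_dual emb scl L. EF.dim (LT (rep \<xi>)) \<le> EF.dim (LT (rep \<zeta>)))
      \<longleftrightarrow> (\<forall>\<eta>\<in>L. EF.dim (LT (rep \<xi>)) \<le> EF.dim (LT \<eta>))"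
    using rep_in_L dual_of_in_dual rep_dual_of by (intro iffI ballI) (metis, blast)
  then show ?thesis
    by (simp add: lie_regular_def \<xi> lie_centralizer_eq cong: ball_cong)
qed

lemma dual_eqI:
  assumes "\<xi> \<in> lie_dual emb scl L" "\<zeta> \<in> lie_dual emb scl L" "rep \<xi> = rep \<zeta>"
  shows "\<xi> = \<zeta>"
proof
  fix x
  show "\<xi> x = \<zeta> x"
  proof (cases "x \<in> L")
    case True
    then have "pairing emb scl x \<xi> = pairing emb scl x \<zeta>"
      using emb_pairing[OF assms(1) True] emb_pairing[OF assms(2) True] assms(3) by (simp flip: emb_inj)
    then show ?thesis using dual_eq_pairing(2)[OF assms(1) True] dual_eq_pairing(2)[OF assms(2) True] by simp
  qed (use assms in \<open>auto simp: lie_dual_def\<close>)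
qed

end

subsection \<open>The coadjoint orbits of the stabilizer of a vector\<close>

locale ggp_frame = hermitian_frame emb cj scl form \<delta> D B d
  for emb :: "'f::real_or_complex \<Rightarrow> 'e::comm_ring_1"
    and cj :: "'e \<Rightarrow> 'e"
    and scl :: "'e \<Rightarrow> 'v::ab_group_add \<Rightarrow> 'v"
    and form :: "'v \<Rightarrow> 'v \<Rightarrow> 'e"
    and \<delta> :: 'e and D :: 'f and B :: "'v set" and d :: "'v \<Rightarrow> 'v" +
  fixes e :: 'v and qi :: 'e
  assumes form_e_qi: "form e e * qi = 1"
begin

lemma cj_form_e: "cj (form e e) = form e e"
  by (rule form_cj[symmetric])

lemma cj_qi: "cj qi = qi"
proof -
  have "cj (form e e * qi) = 1" by (simp add: form_e_qi)
  then have "form e e * cj qi = 1" by (simp add: cj_mult cj_form_e)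
  then have "qi = qi * (form e e * cj qi)" by simp
  also have "\<dots> = (form e e * qi) * cj qi" by (simp only: ac_simps)
  finally show ?thesis by (simp add: form_e_qi)
qed

definition Q :: "'v \<Rightarrow> 'v" where "Q v = scl (form v e * qi) e"

definition PH :: "'v \<Rightarrow> 'v" where "PH v = v - Q v"

lemma hom_Q: "hom Q"
  by (rule homI) (simp_all add: Q_def form_add form_scale algebra_simps)

lemma hom_PH: "hom PH"
  unfolding PH_def by (intro hom_sub hom_ident hom_Q)

lemma form_Q: "form (Q v) w = form v (Q w)"
  using form_cj[of e w] by (simp add: Q_def form_scale form_scale_right cj_mult cj_qi ac_simps)

lemma Q_e: "Q e = e" and PH_e [simp]: "PH e = 0"
  by (simp_all add: Q_def PH_def form_e_qi)

lemma form_PH_e [simp]: "form (PH v) e = 0" "form e (PH v) = 0"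
proof -
  show "form (PH v) e = 0" by (simp add: PH_def form_diff form_Q Q_e)
  then show "form e (PH v) = 0" using form_cj[of e "PH v"] by simp
qed

lemma PH_eq_self_iff: "PH v = v \<longleftrightarrow> form v e = 0"
proof
  assume "PH v = v"
  then show "form v e = 0" by (metis form_PH_e(1))
qed (simp add: PH_def Q_def)

lemma PH_plus_Q: "PH v + Q v = v"
  by (simp add: PH_def)

sublocale G: hermitian_summand emb cj scl form \<delta> D B d "\<lambda>v. v"
  by unfold_locales (simp_all add: hom_ident)

sublocale HL: hermitian_summand emb cj scl form \<delta> D B d PH
proof (intro hermitian_summand.intro hermitian_summand_axioms.intro)
  show "hermitian_frame emb cj scl form \<delta> D B d" by (rule hermitian_frame_axioms)
  show "hom PH" by (rule hom_PH)
  show "PH (PH v) = PH v" for v by (simp add: PH_eq_self_iff)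
  show "form (PH v) w = form v (PH w)" for v w by (simp add: PH_def form_diff form_Q)
qed

lemma unitary_lie_UNIV: "unitary_lie scl form UNIV = G.L"
  using G.unitary_lie_range_P by simp

lemma VH_eq: "ggp_VH scl form e = range PH"
proof -
  have "v \<in> ggp_VH scl form e \<longleftrightarrow> form v e = 0" for v
  proof
    assume "v \<in> ggp_VH scl form e"
    then have "form v (scl 1 e) = 0" unfolding ggp_VH_def orth_def by blast
    then show "form v e = 0" by simp
  qed (auto simp: ggp_VH_def orth_def form_scale_right)
  then show ?thesis by (simp add: set_eq_iff HL.in_range_P PH_eq_self_iff)
qed

lemma unitary_lie_VH: "unitary_lie scl form (ggp_VH scl form e) = HL.L"
  by (simp add: VH_eq HL.unitary_lie_range_P)

lemma HL_L_iff: "x \<in> HL.L \<longleftrightarrow> x \<in> G.L \<and> x e = 0"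
proof
  assume x: "x \<in> HL.L"
  then have "x e = x (PH e)" by (simp only: HL.L_D(3))
  then have "x e = 0" by (simp add: hom_0[OF HL.L_D(1)[OF x]])
  then show "x \<in> G.L \<and> x e = 0" using x by (auto simp: HL.L_def G.L_def)
next
  assume x: "x \<in> G.L \<and> x e = 0"
  have "x (PH v) = x v" for v
    using x hom_diff[OF G.L_D(1), of x v] hom_scale[OF G.L_D(1), of x] by (simp add: PH_def Q_def)
  then show "x \<in> HL.L" using x by (auto simp: HL.L_def G.L_def)
qed

definition HU :: "('v \<Rightarrow> 'v) set" where
  "HU = {g. hom g \<and> bij g \<and> (\<forall>u v. form (g u) (g v) = form u v) \<and> g e = e}"

lemma unitary_group_VH: "unitary_group scl form (ggp_VH scl form e) = HU"
proof -
  have o: "v \<in> orth form (range PH) \<longleftrightarrow> PH v = 0" for v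
    unfolding orth_def using form_nondegenerate[of "PH v"] by (auto simp flip: HL.P_form)
  have "(\<forall>v\<in>orth form (range PH). g v = v) \<longleftrightarrow> g e = e" if "hom g" for g
  proof
    assume "g e = e"
    show "\<forall>v\<in>orth form (range PH). g v = v"
    proof
      fix v assume "v \<in> orth form (range PH)"
      then have "v = Q v" using PH_plus_Q[of v] by (simp add: o)
      then show "g v = v" using \<open>g e = e\<close> hom_scale[OF that, of "form v e * qi" e] by (simp add: Q_def)
    qed
  qed (simp add: o)
  then show ?thesis unfolding unitary_group_def VH_eq HU_def by blast
qed

lemma HU_D:
  assumes "g \<in> HU"
  shows "hom g" "bij g" "form (g u) (g v) = form u v" "g e = e" "inv g (g v) = v" "g (inv g v) = v"
  using assms bij_is_inj[of g] bij_is_surj[of g] by (auto simp: HU_def surj_f_inv_f)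

lemma HU_inv:
  assumes g: "g \<in> HU"
  shows "inv g \<in> HU"
proof -
  note g' = HU_D[OF g]
  have "hom (inv g)"
    by (rule homI; rule injD[OF bij_is_inj[OF g'(2)]])
       (simp_all add: g'(6) hom_add[OF g'(1)] hom_scale[OF g'(1)])
  moreover have "form (inv g u) (inv g v) = form u v" for u v
    using g'(3)[of "inv g u" "inv g v"] by (simp add: g'(6))
  moreover have "inv g e = e" using g'(5)[of e] by (simp add: g'(4))
  ultimately show ?thesis using bij_imp_bij_inv[OF g'(2)] by (simp add: HU_def)
qed

lemma HU_comp: "g \<in> HU \<Longrightarrow> h \<in> HU \<Longrightarrow> g \<circ> h \<in> HU"
  by (auto simp: HU_def hom_o bij_comp)

lemma conj_L:
  assumes g: "g \<in> HU" and x: "x \<in> G.L"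
  shows "g \<circ> x \<circ> inv g \<in> G.L"
proof (rule G.L_I)
  note g' = HU_D[OF g] and i = HU_D[OF HU_inv[OF g]] and x' = G.L_D[OF x]
  show "hom (g \<circ> x \<circ> inv g)" by (intro hom_o g'(1) x'(1) i(1))
  show "form ((g \<circ> x \<circ> inv g) v) w = - form v ((g \<circ> x \<circ> inv g) w)" for v w
  proof -
    have "form (g (x (inv g v))) w = form (x (inv g v)) (inv g w)"
      using g'(3)[of "x (inv g v)" "inv g w"] by (simp add: g'(6))
    also have "\<dots> = - form (inv g v) (x (inv g w))" by (rule x'(2))
    also have "\<dots> = - form v (g (x (inv g w)))"
      using g'(3)[of "inv g v" "x (inv g w)"] by (simp add: g'(6))
    finally show ?thesis by simp
  qed
qed simp

lemma conj_L':
  assumes g: "g \<in> HU" and x: "x \<in> G.L"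
  shows "inv g \<circ> x \<circ> g \<in> G.L"
  using conj_L[OF HU_inv[OF g] x] by (simp add: inv_inv_eq[OF HU_D(2)[OF g]])

context
  fixes g \<xi> assumes g: "g \<in> HU" and \<xi>: "\<xi> \<in> lie_dual emb scl G.L"
begin

lemma Coad_in_dual: "Coad G.L g \<xi> \<in> lie_dual emb scl G.L"
proof -
  note i = HU_D(1)[OF HU_inv[OF g]]
  have add: "inv g \<circ> (x + y) \<circ> g = (inv g \<circ> x \<circ> g) + (inv g \<circ> y \<circ> g)" for x y :: "'v \<Rightarrow> 'v"
    by (auto simp: hom_add[OF i])
  have sc: "inv g \<circ> sE c x \<circ> g = sE c (inv g \<circ> x \<circ> g)" for c x
    by (auto simp: sE_apply hom_scale[OF i])
  show ?thesis
    using \<xi> conj_L'[OF g] unfolding lie_dual_def Coad_def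
    by (auto simp: G.L_plus G.L_sE add sc)
qed

lemma rep_Coad: "G.rep (Coad G.L g \<xi>) = g \<circ> G.rep \<xi> \<circ> inv g"
proof (rule G.rep_unique[OF Coad_in_dual conj_L[OF g G.rep_in_L[OF \<xi>]]])
  note g' = HU_D[OF g] and i = HU_D(1)[OF HU_inv[OF g]] and T = G.L_D(1)[OF G.rep_in_L[OF \<xi>]]
  fix x assume x: "x \<in> G.L"
  note hx = G.L_D(1)[OF x]
  have sc: "inv g \<circ> sE c x \<circ> g = sE c (inv g \<circ> x \<circ> g)" for c
    by (auto simp: sE_apply hom_scale[OF i])
  have "pairing emb scl x (Coad G.L g \<xi>) = pairing emb scl (inv g \<circ> x \<circ> g) \<xi>"
    using G.dual_eq_pairing(1)[OF \<xi> conj_L'[OF g x]]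
    by (intro G.pairing_unique[OF Coad_in_dual x]) (simp add: Coad_def G.L_sE[OF x] sc)
  then have "emb (pairing emb scl x (Coad G.L g \<xi>)) = tr (\<lambda>v. inv g (x (g (G.rep \<xi> v))))"
    using G.emb_pairing[OF \<xi> conj_L'[OF g x]] by simp
  also have "\<dots> = tr (\<lambda>v. x (g (G.rep \<xi> (inv g v))))"
    using tr_commute[OF i hom_comp[OF hx hom_comp[OF g'(1) T]]] by simp
  finally show "emb (pairing emb scl x (Coad G.L g \<xi>)) = tr (\<lambda>v. x ((g \<circ> G.rep \<xi> \<circ> inv g) v))"
    by simp
qed

lemma Coad_eq_iff:
  assumes "\<zeta> \<in> lie_dual emb scl G.L"
  shows "Coad G.L g \<xi> = \<zeta> \<longleftrightarrow> (\<forall>v. g (G.rep \<xi> v) = G.rep \<zeta> (g v))"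
proof -
  note g' = HU_D[OF g]
  have "Coad G.L g \<xi> = \<zeta> \<longleftrightarrow> g \<circ> G.rep \<xi> \<circ> inv g = G.rep \<zeta>"
    using G.dual_eqI[OF Coad_in_dual assms] rep_Coad by metis
  also have "\<dots> \<longleftrightarrow> (\<forall>v. g (G.rep \<xi> v) = G.rep \<zeta> (g v))"
    by (auto simp: fun_eq_iff) (metis g'(5), metis g'(6))
  finally show ?thesis .
qed

end

subsubsection \<open>Cyclic functionals are stable\<close>

lemma form_funpow:
  assumes T: "T \<in> G.L"
  shows "form ((T ^^ i) e) ((T ^^ j) e) = (- 1) ^ j * form ((T ^^ (i + j)) e) e"
proof (induction j arbitrary: i)
  case (Suc j)
  have "form ((T ^^ i) e) ((T ^^ Suc j) e) = - form ((T ^^ Suc i) e) ((T ^^ j) e)"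
    using G.L_D(2)[OF T, of "(T ^^ i) e" "(T ^^ j) e"] by simp
  also have "\<dots> = (- 1) ^ Suc j * form ((T ^^ (i + Suc j)) e) e" using Suc.IH[of "Suc i"] by simp
  finally show ?case .
qed simp

lemma funpow_span_stable:
  assumes hT: "hom T" and v: "v \<in> span (range (\<lambda>i. (T ^^ i) e))"
  shows "T v \<in> span (range (\<lambda>i. (T ^^ i) e))"
  using v
proof (induction rule: span_induct_alt)
  case (step c x y)
  then obtain i where "x = (T ^^ i) e" by auto
  then have "T x \<in> span (range (\<lambda>i. (T ^^ i) e))"
    by (auto intro!: span_base range_eqI[of _ _ "Suc i"])
  then show ?case using step by (simp add: hom_add[OF hT] hom_scale[OF hT] span_add span_scale)
qed (simp add: hom_0[OF hT] span_zero)

lemma cyclic_span: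
  assumes T: "T \<in> G.L" and cyc: "cyclic T e UNIV"
  shows "span (range (\<lambda>i. (T ^^ i) e)) = UNIV"
proof -
  have "e \<in> span (range (\<lambda>i. (T ^^ i) e))" by (auto intro!: span_base range_eqI[of _ _ 0])
  then show ?thesis
    using cyclicD[OF cyc subspace_span] funpow_span_stable[OF G.L_D(1)[OF T]] by blast
qed

text \<open>By skewness the moments determine all products <T^i e, T^j e>, so p(T) e -> p(T') e
  should be an isometry. T' is not assumed cyclic; its cyclicity comes out because g is injective,
  hence bijective.\<close>

lemma same_moments_conjugate:
  assumes T: "T \<in> G.L" and T': "T' \<in> G.L" and cyc: "cyclic T e UNIV"
    and mom: "\<And>i. form ((T' ^^ i) e) e = form ((T ^^ i) e) e"
  obtains g where "g \<in> HU" "\<And>v. g (T v) = T' (g v)"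
proof -
  have hT: "hom T" and hT': "hom T'" using T T' G.L_D(1) by auto
  let ?W = "span (range (\<lambda>i. (T' ^^ i) e))"
  have mom2: "form ((T' ^^ i) e) ((T' ^^ j) e) = form ((T ^^ i) e) ((T ^^ j) e)" for i j
    by (simp add: form_funpow T T' mom)
  note TW = funpow_span_stable[OF hT']
  \<comment> \<open>Vectors with a partner in \<open>?W\<close> that has the same products with the
    T'^j e. Partners sidestep the question whether p(T) e -> p(T') e is well defined.\<close>
  let ?S = "{v. \<exists>w\<in>?W. \<forall>j. form w ((T' ^^ j) e) = form v ((T ^^ j) e)}"
  have S: "v \<in> ?S" for v
  proof (rule cyclicD[OF cyc])
    show "subspace ?S"
      unfolding subspace_def
    proof (intro conjI ballI allI)
      show "0 \<in> ?S" by (intro CollectI bexI[of _ 0]) (auto simp: span_zero)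
      fix a b assume "a \<in> ?S" "b \<in> ?S"
      then obtain w w' where "w \<in> ?W" "w' \<in> ?W" "\<forall>j. form w ((T' ^^ j) e) = form a ((T ^^ j) e)"
        "\<forall>j. form w' ((T' ^^ j) e) = form b ((T ^^ j) e)" by blast
      then show "a + b \<in> ?S"
        by (intro CollectI bexI[of _ "w + w'"]) (auto simp: form_add span_add)
    next
      fix c a assume "a \<in> ?S"
      then obtain w where "w \<in> ?W" "\<forall>j. form w ((T' ^^ j) e) = form a ((T ^^ j) e)" by blast
      then show "scl c a \<in> ?S"
        by (intro CollectI bexI[of _ "scl c w"]) (auto simp: form_scale span_scale)
    qed
    have "e \<in> ?W" by (auto intro!: span_base range_eqI[of _ _ 0])
    then show "e \<in> ?S" using mom2[of 0] by auto
    show "T v \<in> ?S" if v: "v \<in> ?S" for v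
    proof -
      obtain w where w: "w \<in> ?W" "\<And>j. form w ((T' ^^ j) e) = form v ((T ^^ j) e)"
        using v by blast
      have "form (T' w) ((T' ^^ j) e) = form (T v) ((T ^^ j) e)" for j
        using w(2)[of "Suc j"] by (simp add: G.L_D(2)[OF T] G.L_D(2)[OF T'])
      then show ?thesis using TW[OF w(1)] by blast
    qed
  qed simp
  \<comment> \<open>Partners are chosen for the vectors of \<open>B\<close> only;
    \<open>frame\<close> extends the choice linearly.\<close>
  define c where "c b = (SOME w. w \<in> ?W \<and> (\<forall>j. form w ((T' ^^ j) e) = form b ((T ^^ j) e)))" for b
  have c: "c b \<in> ?W \<and> (\<forall>j. form (c b) ((T' ^^ j) e) = form b ((T ^^ j) e))" for b
    unfolding c_def by (rule someI_ex) (use S[of b] in blast)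
  define g where "g v = (\<Sum>b\<in>B. scl (form v (d b)) (c b))" for v
  have hg: "hom g" unfolding g_def by (rule hom_setsum) (rule hom_rank1)
  have gf: "form (g v) ((T' ^^ j) e) = form v ((T ^^ j) e)" for v j
  proof -
    have "form (g v) ((T' ^^ j) e) = form (\<Sum>b\<in>B. scl (form v (d b)) b) ((T ^^ j) e)"
      using c by (simp add: g_def form_sum form_scale)
    then show ?thesis by (simp add: frame)
  qed
  have gW: "g v \<in> ?W" for v
    unfolding g_def using c by (intro span_sum span_scale) blast
  have all: "A = UNIV" if "subspace A" "\<And>j. (T ^^ j) e \<in> A" for A
    using span_minimal[of "range (\<lambda>i. (T ^^ i) e)" A] that cyclic_span[OF T cyc] by auto
  have "v = 0" if "g v = 0" for v
  proof -
    have "{w. form v w = 0} = UNIV"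
      by (rule all) (use gf[of v] that in \<open>auto simp: subspace_def form_add_right form_scale_right\<close>)
    then show ?thesis using form_nondegenerate[of v] by blast
  qed
  note g0 = this
  have "g ` UNIV = UNIV"
    by (rule VF.injective_endo_surj_on[OF finite_VF_gen VF_span_gen])
       (use g0 VF_linear_hom[OF hg] in auto)
  moreover have "inj g" using g0 by (simp add: module_hom.inj_iff_eq_0[OF hg])
  ultimately have bij: "bij g" by (simp add: bij_def)
  then have W: "?W = UNIV" using gW by (metis UNIV_eq_I bij_pointE)
  have gT: "g ((T ^^ i) e) = (T' ^^ i) e" for i
  proof -
    let ?u = "g ((T ^^ i) e) - (T' ^^ i) e"
    have "?W \<subseteq> {w. form ?u w = 0}"
    proof (rule span_minimal)
      show "subspace {w. form ?u w = 0}"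
        by (auto simp: subspace_def form_add_right form_scale_right)
      show "range (\<lambda>i. (T' ^^ i) e) \<subseteq> {w. form ?u w = 0}"
        by (auto simp: form_diff(1) gf mom2)
    qed
    then have "?u = 0" using W form_nondegenerate[of ?u] by blast
    then show ?thesis by simp
  qed
  have com: "g (T v) = T' (g v)" for v
  proof -
    have "{v. g (T v) = T' (g v)} = UNIV"
    proof (rule all)
      show "subspace {v. g (T v) = T' (g v)}"
        by (auto simp: subspace_def hom_0[OF hT] hom_0[OF hT'] hom_0[OF hg] hom_add[OF hT] hom_add[OF hT']
            hom_add[OF hg] hom_scale[OF hT] hom_scale[OF hT'] hom_scale[OF hg])
      show "(T ^^ j) e \<in> {v. g (T v) = T' (g v)}" for j
        using gT[of "Suc j"] gT[of j] by simp
    qed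
    then show ?thesis by blast
  qed
  have "form (g v) (g w) = form v w" for v w
  proof -
    have "{w. form (g v) (g w) = form v w} = UNIV"
      by (rule all) (auto simp: subspace_def hom_0[OF hg] hom_add[OF hg] hom_scale[OF hg]
          form_add_right form_scale_right gT gf)
    then show ?thesis by blast
  qed
  then have "g \<in> HU" using hg bij gT[of 0] by (simp add: HU_def)
  then show ?thesis using that com by blast
qed

end

text \<open>For \<open>F = \<complex>\<close> the formula solves the linear system giving the coordinates of \<open>c\<close> in the basis \<open>1, j\<close>.\<close>
lemma real_or_complex_coordinates:
  "\<exists>(j::'f::real_or_complex) k. \<forall>c. c = of_real ((c \<bullet> 1 + k * ((j * c) \<bullet> 1)) / (1 + k * k))
     + of_real ((k * (c \<bullet> 1) - (j * c) \<bullet> 1) / (1 + k * k)) * j"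
  using real_or_complex[where 'a = 'f, folded of_real_def, unfolded scaleR_conv_of_real]
proof
  have one: "(1::'f) \<bullet> 1 = 1" by (simp add: dot_square_norm)
  have re: "(of_real r * c) \<bullet> 1 = r * (c \<bullet> 1)" for r and c :: 'f
    by (simp flip: scaleR_conv_of_real)
  {
    assume *: "\<forall>c::'f. \<exists>r. c = of_real r"
    have "c = of_real (c \<bullet> 1)" for c :: 'f
      using * re[of _ 1] one by (metis mult.right_neutral)
    then show ?thesis by (intro exI[of _ 0]) simp
  next
    assume "\<exists>j::'f. j * j = - 1 \<and> (\<forall>c. \<exists>r s. c = of_real r + of_real s * j)"
    then obtain j :: 'f where j: "j * j = - 1"
      and gen: "\<And>c. \<exists>r s. c = of_real r + of_real s * j" by blast
    define k where "k = j \<bullet> 1"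
    have k: "1 + k * k \<noteq> 0" by (metis add_pos_nonneg zero_less_one zero_le_square less_irrefl)
    have "c = of_real ((c \<bullet> 1 + k * ((j * c) \<bullet> 1)) / (1 + k * k))
        + of_real ((k * (c \<bullet> 1) - (j * c) \<bullet> 1) / (1 + k * k)) * j" for c
    proof -
      obtain r s where c: "c = of_real r + of_real s * j" using gen by blast
      have 1: "c \<bullet> 1 = r + s * k"
        using re[of r 1] re[of s j] one by (simp add: c inner_add_left k_def)
      have "j * c = of_real r * j + of_real s * (j * j)"
        by (simp add: c algebra_simps)
      then have 2: "(j * c) \<bullet> 1 = r * k - s"
        using re[of r j] re[of s 1] one by (simp add: j inner_diff_left k_def)
      have "r = (c \<bullet> 1 + k * ((j * c) \<bullet> 1)) / (1 + k * k)"
        "s = (k * (c \<bullet> 1) - (j * c) \<bullet> 1) / (1 + k * k)"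
        using k unfolding 1 2 by (simp_all add: field_simps)
      with c show ?thesis by metis
    qed
    then show ?thesis by blast
  }
qed

context ggp_frame
begin

section \<open>Closedness of the level sets of the moments\<close>

lemma closed_lie_dual: "closed (lie_dual emb scl G.L)"
proof -
  have co: "continuous_on UNIV (\<lambda>\<xi>::('v \<Rightarrow> 'v) \<Rightarrow> complex. \<xi> x)" for x by simp
  have "lie_dual emb scl G.L =
     (\<Inter>x\<in>G.L. \<Inter>y\<in>G.L. {\<xi>. \<xi> (x + y) = \<xi> x + \<xi> y}) \<inter>
     (\<Inter>r. \<Inter>x\<in>G.L. {\<xi>. \<xi> (sE (of_real r) x) = of_real r * \<xi> x}) \<inter>
     (\<Inter>x\<in>G.L. {\<xi>. Re (\<xi> x) = 0}) \<inter> (\<Inter>x\<in>- G.L. {\<xi>. \<xi> x = 0})"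
    unfolding lie_dual_def by blast
  also have "closed \<dots>"
    by (intro closed_Int closed_INT ballI closed_Collect_eq continuous_intros co)
  finally show ?thesis .
qed

abbreviation dualG :: "(('v \<Rightarrow> 'v) \<Rightarrow> complex) set" where "dualG \<equiv> lie_dual emb scl G.L"

text \<open>The product topology gives continuity of evaluations. The pairing c is recovered from
  those at x and j x, that is, from the real parts of c and j c.\<close>

lemma continuous_pairing:
  assumes x: "x \<in> G.L"
  shows "continuous_on dualG (\<lambda>\<xi>. pairing emb scl x \<xi>)"
proof -
  have co: "continuous_on dualG (\<lambda>\<xi>. \<xi> y)" for y
    by (rule continuous_on_subset[OF continuous_on_product_coordinates]) simp
  have Im: "(a * pairing emb scl x \<xi>) \<bullet> 1 = Im (\<xi> (sE a x))" if "\<xi> \<in> dualG" for a \<xi>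
    using G.dual_eq_pairing(1)[OF that x] by simp
  have Im1: "pairing emb scl x \<xi> \<bullet> 1 = Im (\<xi> x)" if "\<xi> \<in> dualG" for \<xi>
    using G.dual_eq_pairing(2)[OF that x] by simp
  obtain j :: 'f and k where
    c: "\<And>c. c = of_real ((c \<bullet> 1 + k * ((j * c) \<bullet> 1)) / (1 + k * k))
      + of_real ((k * (c \<bullet> 1) - (j * c) \<bullet> 1) / (1 + k * k)) * j"
    using real_or_complex_coordinates by blast
  have "1 + k * k \<noteq> 0" by (metis add_pos_nonneg zero_less_one zero_le_square less_irrefl)
  then have "continuous_on dualG (\<lambda>\<xi>. of_real ((Im (\<xi> x) + k * Im (\<xi> (sE j x))) / (1 + k * k))
      + of_real ((k * Im (\<xi> x) - Im (\<xi> (sE j x))) / (1 + k * k)) * j :: 'f)"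
    by (intro continuous_intros co) auto
  then show ?thesis
    by (rule continuous_on_eq) (subst (3) c, simp only: Im Im1)
qed

text \<open>\<open>E\<close> carries no topology here; continuity refers to the coordinates with respect to \<open>1, \<delta>\<close>.\<close>
definition Econt :: "((('v \<Rightarrow> 'v) \<Rightarrow> complex) \<Rightarrow> 'e) \<Rightarrow> bool" where
  "Econt f \<longleftrightarrow> (\<exists>\<alpha> \<beta>. continuous_on dualG \<alpha> \<and> continuous_on dualG \<beta> \<and>
     (\<forall>\<xi>\<in>dualG. f \<xi> = emb (\<alpha> \<xi>) + emb (\<beta> \<xi>) * \<delta>))"

lemma Econt_const: "Econt (\<lambda>\<xi>. a)"
proof -
  obtain p q where "a = emb p + emb q * \<delta>" using gen_\<delta> by blast
  then show ?thesis unfolding Econt_def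
    by (intro exI[of _ "\<lambda>_. p"] exI[of _ "\<lambda>_. q"]) auto
qed

lemma Econt_emb: "continuous_on dualG \<alpha> \<Longrightarrow> Econt (\<lambda>\<xi>. emb (\<alpha> \<xi>))"
  unfolding Econt_def by (intro exI[of _ \<alpha>] exI[of _ "\<lambda>_. 0"]) auto

lemma Econt_add:
  assumes "Econt f" "Econt g"
  shows "Econt (\<lambda>\<xi>. f \<xi> + g \<xi>)"
proof -
  obtain \<alpha> \<beta> \<alpha>' \<beta>' where f: "continuous_on dualG \<alpha>" "continuous_on dualG \<beta>"
    "\<And>\<xi>. \<xi> \<in> dualG \<Longrightarrow> f \<xi> = emb (\<alpha> \<xi>) + emb (\<beta> \<xi>) * \<delta>"
    and g: "continuous_on dualG \<alpha>'" "continuous_on dualG \<beta>'"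
    "\<And>\<xi>. \<xi> \<in> dualG \<Longrightarrow> g \<xi> = emb (\<alpha>' \<xi>) + emb (\<beta>' \<xi>) * \<delta>"
    using assms unfolding Econt_def by blast
  show ?thesis unfolding Econt_def
    by (intro exI[of _ "\<lambda>\<xi>. \<alpha> \<xi> + \<alpha>' \<xi>"] exI[of _ "\<lambda>\<xi>. \<beta> \<xi> + \<beta>' \<xi>"])
       (auto simp: f g emb_add algebra_simps intro!: continuous_intros)
qed

lemma Econt_mult:
  assumes "Econt f" "Econt g"
  shows "Econt (\<lambda>\<xi>. f \<xi> * g \<xi>)"
proof -
  obtain \<alpha> \<beta> \<alpha>' \<beta>' where f: "continuous_on dualG \<alpha>" "continuous_on dualG \<beta>"
    "\<And>\<xi>. \<xi> \<in> dualG \<Longrightarrow> f \<xi> = emb (\<alpha> \<xi>) + emb (\<beta> \<xi>) * \<delta>"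
    and g: "continuous_on dualG \<alpha>'" "continuous_on dualG \<beta>'"
    "\<And>\<xi>. \<xi> \<in> dualG \<Longrightarrow> g \<xi> = emb (\<alpha>' \<xi>) + emb (\<beta>' \<xi>) * \<delta>"
    using assms unfolding Econt_def by blast
  have mult: "(emb p + emb q * \<delta>) * (emb r + emb s * \<delta>)
      = emb (p * r + q * s * D) + emb (p * s + q * r) * \<delta>" for p q r s
  proof -
    have "(emb p + emb q * \<delta>) * (emb r + emb s * \<delta>)
        = emb p * emb r + emb q * emb s * (\<delta> * \<delta>) + (emb p * emb s + emb q * emb r) * \<delta>"
      by (simp add: algebra_simps)
    then show ?thesis by (simp add: \<delta>_sq emb_add emb_mult)
  qed
  show ?thesis unfolding Econt_def
    by (intro exI[of _ "\<lambda>\<xi>. \<alpha> \<xi> * \<alpha>' \<xi> + \<beta> \<xi> * \<beta>' \<xi> * D"] exI[of _ "\<lambda>\<xi>. \<alpha> \<xi> * \<beta>' \<xi> + \<beta> \<xi> * \<alpha>' \<xi>"])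
       (auto simp: f g mult intro!: continuous_intros)
qed

lemma Econt_sum: "(\<And>i. i \<in> I \<Longrightarrow> Econt (f i)) \<Longrightarrow> Econt (\<lambda>\<xi>. \<Sum>i\<in>I. f i \<xi>)"
  by (induction I rule: infinite_finite_induct) (auto intro: Econt_const Econt_add)

lemma Econt_cong: "Econt f \<Longrightarrow> (\<And>\<xi>. \<xi> \<in> dualG \<Longrightarrow> f \<xi> = g \<xi>) \<Longrightarrow> Econt g"
  unfolding Econt_def by (auto 0 4)

lemma Econt_dual_form: "Econt (\<lambda>\<xi>. G.dual_form \<xi> v u)"
proof -
  have "rk u w \<in> G.L" for w by (rule G.rk_in_L) simp_all
  then show ?thesis
    unfolding G.dual_form_def
    by (intro Econt_add Econt_mult Econt_const Econt_emb continuous_intros continuous_pairing) auto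
qed

text \<open>The vector w stays arbitrary in the induction because expanding T^i e in the frame
  replaces it by the dual vectors.\<close>

lemma Econt_moment: "Econt (\<lambda>\<xi>. form ((G.rep \<xi> ^^ i) e) w)"
proof (induction i arbitrary: w)
  case 0
  show ?case by (simp add: Econt_const)
next
  case (Suc i)
  have "Econt (\<lambda>\<xi>. \<Sum>b\<in>B. form ((G.rep \<xi> ^^ i) e) (d b) * G.dual_form \<xi> b w)"
    by (intro Econt_sum Econt_mult Suc.IH Econt_dual_form)
  then show ?case
  proof (rule Econt_cong)
    fix \<xi> assume \<xi>: "\<xi> \<in> dualG"
    have "G.rep \<xi> ((G.rep \<xi> ^^ i) e) = (\<Sum>b\<in>B. scl (form ((G.rep \<xi> ^^ i) e) (d b)) (G.rep \<xi> b))"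
      by (rule hom_frame[OF G.L_D(1)[OF G.rep_in_L[OF \<xi>]]])
    then show "(\<Sum>b\<in>B. form ((G.rep \<xi> ^^ i) e) (d b) * G.dual_form \<xi> b w)
        = form ((G.rep \<xi> ^^ Suc i) e) w"
      by (simp add: form_sum form_scale G.form_rep[OF \<xi>])
  qed
qed

lemma emb_\<delta>_eq_iff: "emb p + emb q * \<delta> = emb r + emb s * \<delta> \<longleftrightarrow> p = r \<and> q = s"
proof
  assume eq: "emb p + emb q * \<delta> = emb r + emb s * \<delta>"
  have eq': "emb p - emb q * \<delta> = emb r - emb s * \<delta>"
    using arg_cong[OF eq, of cj] by (simp add: cj_add cj_mult cj_emb cj_\<delta>)
  have "(emb p + emb q * \<delta>) + (emb p - emb q * \<delta>) = (emb r + emb s * \<delta>) + (emb r - emb s * \<delta>)"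
    by (simp only: eq eq')
  then have "emb (p + p) = emb (r + r)" by (simp add: emb_mult)
  then have p: "p = r" by (simp only: emb_inj) simp
  then have "emb q * \<delta> * \<delta>i = emb s * \<delta> * \<delta>i" using eq by simp
  then show "p = r \<and> q = s" using p by (simp add: mult.assoc emb_inj)
qed simp

lemma closed_Econt_eq:
  assumes "Econt f"
  shows "closed {\<xi> \<in> dualG. f \<xi> = a}"
proof -
  obtain \<alpha> \<beta> where f: "continuous_on dualG \<alpha>" "continuous_on dualG \<beta>"
    "\<And>\<xi>. \<xi> \<in> dualG \<Longrightarrow> f \<xi> = emb (\<alpha> \<xi>) + emb (\<beta> \<xi>) * \<delta>"
    using assms unfolding Econt_def by blast
  obtain p q where a: "a = emb p + emb q * \<delta>" using gen_\<delta> by blast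
  have "{\<xi> \<in> dualG. f \<xi> = a} = {\<xi> \<in> dualG. \<alpha> \<xi> = p} \<inter> {\<xi> \<in> dualG. \<beta> \<xi> = q}"
    by (auto simp: f(3) a emb_\<delta>_eq_iff)
  also have "closed \<dots>"
    by (intro closed_Int continuous_closed_preimage_constant f(1,2) closed_lie_dual)
  finally show ?thesis .
qed

lemma cyclic_imp_stable:
  assumes \<tau>: "\<tau> \<in> dualG" and cyc: "cyclic (G.rep \<tau>) e UNIV"
  shows "lie_stable G.L HU \<tau>"
  unfolding lie_stable_def
proof
  let ?T = "G.rep \<tau>"
  note T = G.rep_in_L[OF \<tau>]
  note hT = G.L_D(1)[OF T]
  have "g = (\<lambda>v. v)" if g: "g \<in> HU" "Coad G.L g \<tau> = \<tau>" for g
  proof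
    fix v
    have gT: "g (?T v) = ?T (g v)" for v using Coad_eq_iff[OF g(1) \<tau> \<tau>] g(2) by blast
    note g' = HU_D[OF g(1)]
    have "v \<in> {v. g v = v}"
    proof (rule cyclicD[OF cyc])
      show "subspace {v. g v = v}"
        by (auto simp: subspace_def hom_0[OF g'(1)] hom_add[OF g'(1)] hom_scale[OF g'(1)])
    qed (auto simp: g' gT)
    then show "g v = v" by simp
  qed
  then have "{g \<in> HU. Coad G.L g \<tau> = \<tau>} \<subseteq> {\<lambda>v. v}" by blast
  then show "finite {g \<in> HU. Coad G.L g \<tau> = \<tau>}" by (rule finite_subset) simp
  have "(\<lambda>g. Coad G.L g \<tau>) ` HU
      = (\<Inter>i. {\<xi> \<in> dualG. form ((G.rep \<xi> ^^ i) e) e = form ((?T ^^ i) e) e})"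
  proof (intro equalityI subsetI)
    fix \<xi> assume "\<xi> \<in> (\<lambda>g. Coad G.L g \<tau>) ` HU"
    then obtain g where g: "g \<in> HU" "\<xi> = Coad G.L g \<tau>" by blast
    note g' = HU_D[OF g(1)]
    have \<xi>: "\<xi> \<in> dualG" using Coad_in_dual[OF g(1) \<tau>] g(2) by simp
    have gT: "G.rep \<xi> (g v) = g (?T v)" for v using Coad_eq_iff[OF g(1) \<tau> \<xi>] g(2) by simp
    have "(G.rep \<xi> ^^ i) e = g ((?T ^^ i) e)" for i
      by (induction i) (simp_all add: g' gT)
    then have "form ((G.rep \<xi> ^^ i) e) e = form ((?T ^^ i) e) e" for i
      using g'(3)[of "(?T ^^ i) e" e] by (simp add: g'(4))
    then show "\<xi> \<in> (\<Inter>i. {\<xi> \<in> dualG. form ((G.rep \<xi> ^^ i) e) e = form ((?T ^^ i) e) e})"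
      using \<xi> by blast
  next
    fix \<xi> assume "\<xi> \<in> (\<Inter>i. {\<xi> \<in> dualG. form ((G.rep \<xi> ^^ i) e) e = form ((?T ^^ i) e) e})"
    then have \<xi>: "\<xi> \<in> dualG" and mom: "\<And>i. form ((G.rep \<xi> ^^ i) e) e = form ((?T ^^ i) e) e"
      by blast+
    obtain g where g: "g \<in> HU" "\<And>v. g (?T v) = G.rep \<xi> (g v)"
      using same_moments_conjugate[OF T G.rep_in_L[OF \<xi>] cyc mom] by metis
    then have "Coad G.L g \<tau> = \<xi>" using Coad_eq_iff[OF g(1) \<tau> \<xi>] by blast
    then show "\<xi> \<in> (\<lambda>g. Coad G.L g \<tau>) ` HU" using g(1) by blast
  qed
  then show "closed ((\<lambda>g. Coad G.L g \<tau>) ` HU)"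
    using closed_Econt_eq[OF Econt_moment] by (simp add: closed_INT)
qed

subsubsection \<open>Stable functionals are cyclic\<close>

lemma infinite_stabilizer:
  assumes \<tau>: "\<tau> \<in> dualG" and S: "infinite S" "inj_on a S"
    and a: "\<And>s. s \<in> S \<Longrightarrow> a s \<in> HU" "\<And>s v. s \<in> S \<Longrightarrow> a s (G.rep \<tau> v) = G.rep \<tau> (a s v)"
  shows "infinite {g \<in> HU. Coad G.L g \<tau> = \<tau>}"
proof -
  have "a ` S \<subseteq> {g \<in> HU. Coad G.L g \<tau> = \<tau>}"
    using a Coad_eq_iff[OF _ \<tau> \<tau>] by blast
  moreover have "infinite (a ` S)" using S finite_imageD by blast
  ultimately show ?thesis using finite_subset by blast
qed

lemma HU_I:
  assumes "hom g" "hom h" "\<And>v. g (h v) = v" "\<And>v. h (g v) = v" "g e = e"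
    "\<And>v w. form (g v) w = form v (h w)"
  shows "g \<in> HU"
proof -
  have "bij g" using assms(3,4) by (intro bijI') metis+
  then show ?thesis using assms by (auto simp: HU_def)
qed

lemma unstable_nondegenerate:
  assumes \<tau>: "\<tau> \<in> dualG" and N: "subspace N" "\<And>v. v \<in> N \<Longrightarrow> G.rep \<tau> v \<in> N" "N \<noteq> {0}"
    "\<And>v. v \<in> N \<Longrightarrow> form v e = 0" and nd: "N \<inter> orth form N \<subseteq> {0}"
  shows "infinite {g \<in> HU. Coad G.L g \<tau> = \<tau>}"
proof -
  let ?T = "G.rep \<tau>"
  note T = G.L_D[OF G.rep_in_L[OF \<tau>]]
  define p where "p v = (SOME u. u \<in> N \<and> v - u \<in> orth form N)" for v
  have p: "p v \<in> N" "v - p v \<in> orth form N" for v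
    using someI_ex[of "\<lambda>u. u \<in> N \<and> v - u \<in> orth form N"] orth_complement[OF N(1) nd, of v]
    unfolding p_def by blast+
  have pu: "p v = u" if "u \<in> N" "v - u \<in> orth form N" for u v
  proof -
    have "p v - u \<in> N" using subspace_diff[OF N(1)] p(1) that(1) by blast
    moreover have "p v - u = (v - u) - (v - p v)" by simp
    then have "p v - u \<in> orth form N" using subspace_diff[OF subspace_orth] p(2) that(2) by metis
    ultimately show ?thesis using nd by auto
  qed
  have hp: "hom p"
  proof (rule homI)
    show "p (u + v) = p u + p v" for u v
    proof (rule pu)
      show "p u + p v \<in> N" by (intro subspace_add[OF N(1)] p)
      have "u + v - (p u + p v) = (u - p u) + (v - p v)" by simp
      then show "u + v - (p u + p v) \<in> orth form N"
        using subspace_add[OF subspace_orth] p(2) by metis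
    qed
    show "p (scl a v) = scl a (p v)" for a v
    proof (rule pu)
      show "scl a (p v) \<in> N" by (intro subspace_scale[OF N(1)] p)
      show "scl a v - scl a (p v) \<in> orth form N"
        using subspace_scale[OF subspace_orth p(2)] by (simp add: scale_right_diff_distrib)
    qed
  qed
  have pp: "p u = u" if "u \<in> N" for u
    using that subspace_0[OF subspace_orth] by (intro pu) auto
  have orthD: "form (v - p v) w = 0" if "w \<in> N" for v w using p(2) that by (auto simp: orth_def)
  have pf: "form (p v) w = form v (p w)" for v w
  proof -
    have "form (p v) (w - p w) = 0"
      using orthD[OF p(1), of w v] form_cj[of "p v" "w - p w"] by simp
    moreover have "form (v - p v) (p w) = 0" using orthD[OF p(1)] .
    ultimately show ?thesis by (simp add: form_diff)
  qed
  have pT: "p (?T v) = ?T (p v)" for v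
  proof (rule pu)
    show "?T (p v) \<in> N" using N(2) p(1) by blast
    have "form (?T (v - p v)) w = 0" if "w \<in> N" for w
      using N(2)[OF that] orthD by (simp add: T(2))
    then show "?T v - ?T (p v) \<in> orth form N" by (simp add: orth_def hom_diff[OF T(1)])
  qed
  have pe: "p e = 0"
  proof (rule pu)
    show "0 \<in> N" using subspace_0[OF N(1)] .
    show "e - 0 \<in> orth form N" using N(4) form_cj[of e] by (auto simp: orth_def)
  qed
  obtain r where r: "r \<in> N" "r \<noteq> 0" using N(3) subspace_0[OF N(1)] by blast
  define c where "c s = 1 - s * s * D" for s :: 'f
  text \<open>The Cayley parametrization \<open>(1 + s \<delta>) / (1 - s \<delta>)\<close> of the elements of norm one.\<close>
  define a where "a s = (1 + emb s * \<delta>) * (1 + emb s * \<delta>) * emb (1 / c s)" for s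
  let ?S = "{s. c s \<noteq> 0}"
  have c: "(1 + emb s * \<delta>) * (1 - emb s * \<delta>) = emb (c s)" for s
  proof -
    have "(1 + emb s * \<delta>) * (1 - emb s * \<delta>) = 1 - emb s * emb s * (\<delta> * \<delta>)"
      by (simp add: algebra_simps)
    then show ?thesis by (simp add: c_def \<delta>_sq emb_diff emb_mult emb_one)
  qed
  have ci: "emb (c s) * emb (1 / c s) = 1" if "s \<in> ?S" for s
    using that by (simp add: emb_one flip: emb_mult)
  have cja: "cj (a s) = (1 - emb s * \<delta>) * (1 - emb s * \<delta>) * emb (1 / c s)" for s
    by (simp add: a_def cj_mult cj_add cj_emb cj_\<delta>)
  have a1: "a s * cj (a s) = 1" if "s \<in> ?S" for s
  proof -
    have "a s * cj (a s) = ((1 + emb s * \<delta>) * (1 - emb s * \<delta>) * emb (1 / c s))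
        * ((1 + emb s * \<delta>) * (1 - emb s * \<delta>) * emb (1 / c s))"
      unfolding cja unfolding a_def by (simp only: ac_simps)
    then show ?thesis by (simp add: c ci[OF that])
  qed
  have au: "a s * (1 - emb s * \<delta>) = 1 + emb s * \<delta>" if "s \<in> ?S" for s
  proof -
    have "a s * (1 - emb s * \<delta>)
        = (1 + emb s * \<delta>) * (((1 + emb s * \<delta>) * (1 - emb s * \<delta>)) * emb (1 / c s))"
      unfolding a_def by (simp only: ac_simps)
    then show ?thesis by (simp only: c ci[OF that]) simp
  qed
  \<comment> \<open>Multiplication by b on N and the identity on its orthogonal; an isometry when b
    has norm one.\<close>
  define k where "k b v = v + scl (b - 1) (p v)" for b v
  have hk: "hom (k b)" for b
    unfolding k_def by (intro hom_plus hom_ident hom_scl hp)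
  have kk: "k b (k b' v) = k (b * b') v" for b b' v
    unfolding k_def by (simp add: hom_add[OF hp] hom_diff[OF hp] hom_scale[OF hp] pp[OF p(1)] algebra_simps)
  have k1: "k 1 v = v" for v by (simp add: k_def)
  have HU: "k (a s) \<in> HU" if s: "s \<in> ?S" for s
  proof (rule HU_I[OF hk hk[of "cj (a s)"]])
    show "k (a s) (k (cj (a s)) v) = v" "k (cj (a s)) (k (a s) v) = v" for v
      using a1[OF s] by (simp_all add: kk k1 mult.commute)
    show "k (a s) e = e" by (simp add: k_def pe)
    show "form (k (a s) v) w = form v (k (cj (a s)) w)" for v w
      by (simp add: k_def form_add form_add_right form_scale form_scale_right cj_diff cj_cj pf)
  qed
  have com: "k b (?T v) = ?T (k b v)" for b v
    by (simp add: k_def pT hom_add[OF T(1)] hom_scale[OF T(1)])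
  have inj: "s = t" if st: "s \<in> ?S" "t \<in> ?S" "k (a s) = k (a t)" for s t
  proof -
    have "k (a s) r = k (a t) r" using st by simp
    then have "scl (a s) r = scl (a t) r" by (simp add: k_def pp[OF r(1)] algebra_simps)
    \<comment> \<open>\<open>E\<close> may have zero divisors, so denominators are cleared instead
      of comparing \<open>a s\<close> and \<open>a t\<close>. What remains is 2 (s - t)
      \<open>\<delta>\<close> r = 0, where \<open>\<delta>\<close> is a unit and r is
      nonzero.\<close>
    then have "scl ((1 - emb s * \<delta>) * (1 - emb t * \<delta>)) (scl (a s) r)
        = scl ((1 - emb s * \<delta>) * (1 - emb t * \<delta>)) (scl (a t) r)" by simp
    moreover have "(1 - emb s * \<delta>) * (1 - emb t * \<delta>) * a s = (1 - emb t * \<delta>) * (a s * (1 - emb s * \<delta>))"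
      "(1 - emb s * \<delta>) * (1 - emb t * \<delta>) * a t = (1 - emb s * \<delta>) * (a t * (1 - emb t * \<delta>))"
      by (simp_all only: ac_simps)
    ultimately have "scl ((1 - emb t * \<delta>) * (1 + emb s * \<delta>)) r = scl ((1 - emb s * \<delta>) * (1 + emb t * \<delta>)) r"
      by (simp only: scale_scale au[OF st(1)] au[OF st(2)])
    moreover have "(1 - emb t * \<delta>) * (1 + emb s * \<delta>) - (1 - emb s * \<delta>) * (1 + emb t * \<delta>) = emb (2 * (s - t)) * \<delta>"
      by (simp add: emb_mult emb_diff algebra_simps)
    ultimately have "scl (emb (2 * (s - t)) * \<delta>) r = 0"
      by (metis (no_types, lifting) right_minus_eq scale_left_diff_distrib)
    then have "scl (emb (2 * (s - t))) (scl \<delta> r) = 0" by simp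
    then have "sF (2 * (s - t)) (scl \<delta> r) = 0" by (simp only: sF_def)
    then show "s = t" using r(2) by simp
  qed
  have "finite {s. c s = 0}"
  proof (cases "\<exists>s0. c s0 = 0")
    case True
    then obtain s0 where s0: "c s0 = 0" by blast
    have "s = s0 \<or> s = - s0" if "c s = 0" for s
    proof -
      have "(s - s0) * (s + s0) * D = 0"
        using that s0 by (simp add: c_def algebra_simps)
      then show ?thesis using D_nz by (auto simp: eq_neg_iff_add_eq_0)
    qed
    then have "{s. c s = 0} \<subseteq> {s0, - s0}" by blast
    then show ?thesis by (rule finite_subset) simp
  qed auto
  then have "infinite (- {s. c s = 0})"
    using infinite_UNIV_char_0[where 'a = 'f] by (simp add: finite_compl)
  then have S: "infinite ?S" by (simp add: Collect_neg_eq)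
  have "inj_on (\<lambda>s. k (a s)) ?S" using inj by (rule inj_onI)
  from infinite_stabilizer[OF \<tau> S this HU com] show ?thesis .
qed

end

context ggp_frame
begin

text \<open>\<pi> and its adjoint \<sigma> project onto two isotropic submodules in duality, the
  first being R, both orthogonal to e. The vanishing of \<sigma> \<pi> and \<pi> \<sigma> expresses
  the isotropy of the two images.\<close>

definition isotropic_projection :: "'v set \<Rightarrow> ('v \<Rightarrow> 'v) \<Rightarrow> ('v \<Rightarrow> 'v) \<Rightarrow> bool" where
  "isotropic_projection R \<pi> \<sigma> \<longleftrightarrow> hom \<pi> \<and> hom \<sigma> \<and> (\<forall>v w. form (\<pi> v) w = form v (\<sigma> w)) \<and>
     (\<forall>v. \<pi> (\<pi> v) = \<pi> v \<and> \<sigma> (\<sigma> v) = \<sigma> v \<and> \<sigma> (\<pi> v) = 0 \<and> \<pi> (\<sigma> v) = 0) \<and>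
     \<pi> e = 0 \<and> \<sigma> e = 0 \<and> (\<forall>v. \<pi> v \<in> R) \<and> (\<forall>v\<in>R. \<pi> v = v)"

text \<open>
  An idempotent \<open>\<pi>\<close> onto the isotropic \<open>R\<close> is corrected to \<open>\<pi> - \<pi> \<pi>\<^sup>* / 2\<close>, so that the image of
  its adjoint \<open>\<sigma>\<close> becomes isotropic as well.
\<close>
lemma ex_isotropic_projection:
  assumes R: "subspace R" "\<And>v w. v \<in> R \<Longrightarrow> w \<in> R \<Longrightarrow> form v w = 0" "\<And>v. v \<in> R \<Longrightarrow> form v e = 0"
  shows "\<exists>\<pi> \<sigma>. isotropic_projection R \<pi> \<sigma>"
proof -
  obtain \<rho> where \<rho>: "hom \<rho>" "\<And>v. \<rho> v \<in> R" "\<And>v. v \<in> R \<Longrightarrow> \<rho> v = v"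
    using ex_hom_projection[OF R(1)] by metis
  \<comment> \<open>Composition with \<open>PH\<close> makes the projection kill e; on R nothing
    changes, since R is orthogonal to e.\<close>
  define q where "q v = \<rho> (PH v)" for v
  define a where "a = adj q"
  let ?h = "emb (1 / 2)"
  define \<pi> where "\<pi> v = q v - scl ?h (q (a v))" for v
  define \<sigma> where "\<sigma> v = a v - scl ?h (q (a v))" for v
  have hq: "hom q" unfolding q_def by (rule hom_comp[OF \<rho>(1) hom_PH])
  have ha: "hom a" unfolding a_def by (rule hom_adj[OF hq])
  have qa: "form (q v) w = form v (a w)" for v w unfolding a_def by (rule form_adj[OF hq])
  have aq: "form (a v) w = form v (q w)" for v w unfolding a_def by (rule form_adj'[OF hq, symmetric])
  have qR: "q v \<in> R" for v by (simp add: q_def \<rho>(2))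
  have qid: "q v = v" if "v \<in> R" for v
    using that R(3)[OF that] by (simp add: q_def \<rho>(3) PH_eq_self_iff[THEN iffD2])
  have aq0: "a (q v) = 0" for v
    by (rule form_eqI2) (simp add: R(2)[OF qR qR] flip: qa)
  have aa: "a (a v) = a v" for v
    by (rule form_eqI2) (simp add: qid[OF qR] flip: qa)
  have qe: "q e = 0" by (simp add: q_def hom_0[OF \<rho>(1)])
  have ae: "a e = 0" by (rule form_eqI2) (simp add: R(3)[OF qR] flip: qa)
  have h: "hom \<pi>" "hom \<sigma>"
    unfolding \<pi>_def \<sigma>_def by (intro hom_sub hom_scl hom_comp[OF hq ha] hq ha)+
  have \<pi>R: "\<pi> v \<in> R" for v
    unfolding \<pi>_def by (intro subspace_diff[OF R(1)] subspace_scale[OF R(1)] qR)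
  have aR: "a v = 0" if "v \<in> R" for v using aq0[of v] qid[OF that] by simp
  have \<pi>id: "\<pi> v = v" if "v \<in> R" for v
    using that by (simp add: \<pi>_def qid aR hom_0[OF hq])
  have half: "scl ?h v = v - scl ?h v" for v using scl_half[of v] by (simp add: algebra_simps)
  have a\<sigma>: "a (\<sigma> v) = a v" for v
    by (simp add: \<sigma>_def hom_diff[OF ha] hom_scale[OF ha] aa aq0)
  have q\<sigma>: "q (\<sigma> v) = scl ?h (q (a v))" for v
    using half[of "q (a v)"] by (simp add: \<sigma>_def hom_diff[OF hq] hom_scale[OF hq] qid[OF qR])
  have "isotropic_projection R \<pi> \<sigma>"
    unfolding isotropic_projection_def
  proof (intro conjI allI ballI)
    show "form (\<pi> v) w = form v (\<sigma> w)" for v w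
      by (simp add: \<pi>_def \<sigma>_def form_diff form_scale form_scale_right cj_emb qa aq)
    show "\<pi> (\<pi> v) = \<pi> v" for v by (rule \<pi>id[OF \<pi>R])
    show "\<sigma> (\<sigma> v) = \<sigma> v" for v by (simp add: \<sigma>_def[of "\<sigma> v"] a\<sigma>) (simp add: \<sigma>_def)
    show "\<sigma> (\<pi> v) = 0" for v by (simp add: \<sigma>_def aR[OF \<pi>R] hom_0[OF hq])
    show "\<pi> (\<sigma> v) = 0" for v by (simp add: \<pi>_def a\<sigma> q\<sigma>)
    show "\<pi> e = 0" "\<sigma> e = 0" by (simp_all add: \<pi>_def \<sigma>_def qe ae hom_0[OF hq])
  qed (use h \<pi>R \<pi>id in auto)
  then show ?thesis by blast
qed

text \<open>A closed orbit contains the limit point, whose stabilizer contains the whole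
  one-parameter group. Conjugating back, \<tau> itself gets an infinite stabilizer.\<close>

lemma unstable_isotropic:
  assumes \<tau>: "\<tau> \<in> dualG" and R: "subspace R" "\<And>v. v \<in> R \<Longrightarrow> G.rep \<tau> v \<in> R" "r \<in> R" "r \<noteq> 0"
    "\<And>v w. v \<in> R \<Longrightarrow> w \<in> R \<Longrightarrow> form v w = 0" "\<And>v. v \<in> R \<Longrightarrow> form v e = 0"
  shows "\<not> lie_stable G.L HU \<tau>"
proof
  assume st: "lie_stable G.L HU \<tau>"
  define T where "T = G.rep \<tau>"
  have TL: "T \<in> G.L" unfolding T_def by (rule G.rep_in_L[OF \<tau>])
  note hT = G.L_D(1)[OF TL] and sT = G.L_D(2)[OF TL]
  have RT: "\<And>v. v \<in> R \<Longrightarrow> T v \<in> R" using R(2) by (simp add: T_def)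
  obtain \<pi> \<sigma> where "isotropic_projection R \<pi> \<sigma>"
    using ex_isotropic_projection[of R] R(1,5,6) by blast
  then have h: "hom \<pi>" "hom \<sigma>" and ps: "\<And>v w. form (\<pi> v) w = form v (\<sigma> w)"
    and idem: "\<And>v. \<pi> (\<pi> v) = \<pi> v" "\<And>v. \<sigma> (\<sigma> v) = \<sigma> v" "\<And>v. \<sigma> (\<pi> v) = 0" "\<And>v. \<pi> (\<sigma> v) = 0"
    and e0: "\<pi> e = 0" "\<sigma> e = 0" and \<pi>R: "\<And>v. \<pi> v \<in> R" and \<pi>id: "\<And>v. v \<in> R \<Longrightarrow> \<pi> v = v"
    unfolding isotropic_projection_def by blast+
  have sp: "form (\<sigma> v) w = form v (\<pi> w)" for v w
    using ps[of w v] form_cj[of "\<sigma> v" w] form_cj[of v "\<pi> w"] by simp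
  define \<kappa> where "\<kappa> v = v - \<pi> v - \<sigma> v" for v
  have h\<kappa>: "hom \<kappa>" unfolding \<kappa>_def by (intro hom_sub hom_ident h)
  have kk: "form (\<kappa> v) w = form v (\<kappa> w)" for v w
    by (simp add: \<kappa>_def form_diff ps sp)
  note hs = hom_add[OF h(1)] hom_add[OF h(2)] hom_add[OF h\<kappa>] hom_add[OF hT]
    hom_scale[OF h(1)] hom_scale[OF h(2)] hom_scale[OF h\<kappa>] hom_scale[OF hT]
    hom_diff[OF h(1)] hom_diff[OF h(2)] hom_diff[OF hT]
    hom_0[OF h(1)] hom_0[OF h(2)] hom_0[OF h\<kappa>] hom_0[OF hT]
  have idk: "\<kappa> (\<kappa> v) = \<kappa> v" "\<kappa> (\<pi> v) = 0" "\<kappa> (\<sigma> v) = 0" "\<pi> (\<kappa> v) = 0" "\<sigma> (\<kappa> v) = 0" for v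
    by (simp_all add: \<kappa>_def hs idem)
  have T\<pi>: "T (\<pi> v) = \<pi> (T (\<pi> v))" for v using \<pi>id[OF RT[OF \<pi>R]] by simp
  have \<sigma>T: "\<sigma> (T v) = \<sigma> (T (\<sigma> v))" for v
  proof (rule form_eqI)
    fix w
    have "form (\<sigma> (T v)) w = - form v (T (\<pi> w))" by (simp add: sp sT)
    also have "\<dots> = - form v (\<pi> (T (\<pi> w)))" by (simp flip: T\<pi>)
    also have "\<dots> = form (\<sigma> (T (\<sigma> v))) w" by (simp add: sp sT)
    finally show "form (\<sigma> (T v)) w = form (\<sigma> (T (\<sigma> v))) w" .
  qed
  \<comment> \<open>Weights 1, 0 and -1 on R, on the image of \<kappa> and on the image of
    \<sigma>.\<close>
  define a where "a t v = \<kappa> v + scl (emb t) (\<pi> v) + scl (emb (1 / t)) (\<sigma> v)" for t v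
  have ha: "hom (a t)" for t unfolding a_def by (intro hom_plus hom_scl h h\<kappa>)
  have cancel: "scl (emb t) (scl (emb (1 / t)) v) = v" "scl (emb (1 / t)) (scl (emb t) v) = v"
    if "t \<noteq> 0" for t v
    using that by (simp_all add: emb_one flip: emb_mult)
  have dec: "\<kappa> v + \<pi> v + \<sigma> v = v" for v by (simp add: \<kappa>_def)
  have aa: "a t (a (1 / t) v) = v" if t: "t \<noteq> 0" for t v
    using dec[of v] cancel[OF t] t by (simp add: a_def hs idem idk)
  have aHU: "a t \<in> HU" if t: "t \<noteq> 0" for t
  proof (rule HU_I[OF ha ha[of "1 / t"]])
    show "a t (a (1 / t) v) = v" "a (1 / t) (a t v) = v" for v
      using aa[OF t, of v] aa[of "1 / t" v] t by simp_all
    show "a t e = e" by (simp add: a_def \<kappa>_def e0)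
    show "form (a t v) w = form v (a (1 / t) w)" for v w
      by (simp add: a_def form_add form_add_right form_scale form_scale_right cj_emb kk ps sp)
  qed
  \<comment> \<open>The parts of T of weight 0, 1 and 2 under conjugation by \<open>a t\<close>.
    Those of negative weight vanish because T preserves R and, by skewness, \<sigma> T = \<sigma> T
    \<sigma>. So the conjugate of T is polynomial in t and tends to \<open>T0\<close>.\<close>
  define T0 where "T0 v = \<kappa> (T (\<kappa> v)) + \<pi> (T (\<pi> v)) + \<sigma> (T (\<sigma> v))" for v
  define T1 where "T1 v = \<pi> (T (\<kappa> v)) + \<kappa> (T (\<sigma> v))" for v
  define T2 where "T2 v = \<pi> (T (\<sigma> v))" for v
  have c3: "hom (\<lambda>v. x (T (y v)))" if "hom x" "hom y" for x y
    by (rule hom_comp[OF that(1) hom_comp[OF hT that(2)]])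
  have T0L: "T0 \<in> G.L" unfolding T0_def
    by (rule G.L_I) (simp_all add: hom_plus c3 h h\<kappa> form_add form_add_right kk ps sp sT)
  have T1L: "T1 \<in> G.L" unfolding T1_def
    by (rule G.L_I) (simp_all add: hom_plus c3 h h\<kappa> form_add form_add_right kk ps sp sT)
  have T2L: "T2 \<in> G.L" unfolding T2_def
    by (rule G.L_I) (simp_all add: c3 h ps sp sT)
  have aT: "a t (T v) = T0 (a t v) + scl (emb t) (T1 (a t v)) + scl (emb (t * t)) (T2 (a t v))"
    if t: "t \<noteq> 0" for t v
  proof -
    have T\<kappa>: "T (\<kappa> v) = \<kappa> (T (\<kappa> v)) + \<pi> (T (\<kappa> v))"
      using dec[of "T (\<kappa> v)"] \<sigma>T[of "\<kappa> v"] by (simp add: idk hs)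
    have T\<sigma>: "T (\<sigma> v) = \<kappa> (T (\<sigma> v)) + \<pi> (T (\<sigma> v)) + \<sigma> (T (\<sigma> v))"
      using dec[of "T (\<sigma> v)"] by simp
    have "a t (T v) = a t (T (\<kappa> v)) + a t (T (\<pi> v)) + a t (T (\<sigma> v))"
      by (subst dec[of v, symmetric]) (simp only: hom_add[OF hT] hom_add[OF ha])
    also have "a t (T (\<kappa> v)) = \<kappa> (T (\<kappa> v)) + scl (emb t) (\<pi> (T (\<kappa> v)))"
      by (subst T\<kappa>) (simp add: a_def hs idem idk)
    also have "a t (T (\<pi> v)) = scl (emb t) (\<pi> (T (\<pi> v)))"
      by (subst T\<pi>) (simp add: a_def hs idem idk)
    also have "a t (T (\<sigma> v)) = \<kappa> (T (\<sigma> v)) + scl (emb t) (\<pi> (T (\<sigma> v))) + scl (emb (1 / t)) (\<sigma> (T (\<sigma> v)))"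
      by (simp add: a_def)
    finally have l: "a t (T v) = \<kappa> (T (\<kappa> v)) + scl (emb t) (\<pi> (T (\<kappa> v))) + scl (emb t) (\<pi> (T (\<pi> v)))
      + (\<kappa> (T (\<sigma> v)) + scl (emb t) (\<pi> (T (\<sigma> v))) + scl (emb (1 / t)) (\<sigma> (T (\<sigma> v))))" .
    have tt: "scl (emb (t * t)) (scl (emb (1 / t)) w) = scl (emb t) w" for w
      using t by (simp flip: emb_mult)
    have "T0 (a t v) = \<kappa> (T (\<kappa> v)) + scl (emb t) (\<pi> (T (\<pi> v))) + scl (emb (1 / t)) (\<sigma> (T (\<sigma> v)))"
      by (simp add: T0_def a_def hs idem idk)
    moreover have "scl (emb t) (T1 (a t v)) = scl (emb t) (\<pi> (T (\<kappa> v))) + \<kappa> (T (\<sigma> v))"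
      using cancel[OF t] by (simp add: T1_def a_def hs idem idk scale_right_distrib)
    moreover have "scl (emb (t * t)) (T2 (a t v)) = scl (emb t) (\<pi> (T (\<sigma> v)))"
      using tt by (simp add: T2_def a_def hs idem idk)
    ultimately show ?thesis unfolding l by (simp add: algebra_simps)
  qed
  define Tt where "Tt t v = T0 v + scl (emb t) (T1 v) + scl (emb (t * t)) (T2 v)" for t v
  have TtL: "Tt t \<in> G.L" for t unfolding Tt_def by (intro G.L_add G.L_scale T0L T1L T2L)
  have orb: "G.dual_of (Tt t) \<in> (\<lambda>g. Coad G.L g \<tau>) ` HU" if t: "t \<noteq> 0" for t
  proof -
    have "Coad G.L (a t) \<tau> = G.dual_of (Tt t)"
      using Coad_eq_iff[OF aHU[OF t] \<tau> G.dual_of_in_dual] aT[OF t]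
      by (simp add: G.rep_dual_of[OF TtL] Tt_def T_def)
    then show ?thesis using aHU[OF t] by (metis imageI)
  qed
  have "continuous_on UNIV (\<lambda>t::real. G.dual_of (Tt (of_real t)))"
  proof (rule continuous_on_coordinatewise_then_product)
    fix x
    show "continuous_on UNIV (\<lambda>t::real. G.dual_of (Tt (of_real t)) x)"
    proof (cases "x \<in> G.L")
      case True
      note hx = G.L_D(1)[OF True]
      have "tre (tr (\<lambda>v. x (Tt t v))) = tre (tr (\<lambda>v. x (T0 v))) + t * tre (tr (\<lambda>v. x (T1 v)))
          + t * t * tre (tr (\<lambda>v. x (T2 v)))" for t
        by (simp add: Tt_def hom_add[OF hx] hom_scale[OF hx] tr_add tr_scale tre_add tre_mult)
      then show ?thesis
        by (simp add: G.dual_of_def True) (auto intro!: continuous_intros)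
    qed (simp add: G.dual_of_def)
  qed
  then have "isCont (\<lambda>t::real. G.dual_of (Tt (of_real t))) 0"
    by (simp add: continuous_on_eq_continuous_at)
  then have lim: "((\<lambda>t::real. G.dual_of (Tt (of_real t))) \<longlongrightarrow> G.dual_of (Tt (of_real 0))) (at 0)"
    by (simp add: isCont_def)
  have Tt0: "Tt (of_real 0) = T0" by (auto simp: Tt_def)
  have "G.dual_of T0 \<in> (\<lambda>g. Coad G.L g \<tau>) ` HU"
  proof (rule Lim_in_closed_set[OF _ _ _ lim[unfolded Tt0]])
    show "closed ((\<lambda>g. Coad G.L g \<tau>) ` HU)" using st by (simp add: lie_stable_def)
    show "eventually (\<lambda>t::real. G.dual_of (Tt (of_real t)) \<in> (\<lambda>g. Coad G.L g \<tau>) ` HU) (at 0)"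
      unfolding eventually_at_filter using orb by (intro always_eventually) auto
  qed simp
  then obtain g where g: "g \<in> HU" "Coad G.L g \<tau> = G.dual_of T0" by auto
  note g' = HU_D[OF g(1)]
  have gT: "g (T v) = T0 (g v)" for v
    using Coad_eq_iff[OF g(1) \<tau> G.dual_of_in_dual[of T0]] g(2) by (simp add: G.rep_dual_of[OF T0L] T_def)
  have aT0: "a t (T0 v) = T0 (a t v)" for t v
    by (simp add: a_def T0_def hs idem idk)
  define k where "k t = inv g \<circ> a t \<circ> g" for t
  have "infinite {h \<in> HU. Coad G.L h \<tau> = \<tau>}"
  proof (rule infinite_stabilizer[OF \<tau>, of "- {0}" k])
    show "infinite (- {0::'f})"
      using infinite_UNIV_char_0[where 'a = 'f] by (simp add: finite_compl)
    show "k t \<in> HU" if "t \<in> - {0}" for t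
      unfolding k_def using that by (intro HU_comp HU_inv g(1) aHU) auto
    show "k t (G.rep \<tau> v) = G.rep \<tau> (k t v)" for t v
    proof -
      have "g (T (inv g (a t (g v)))) = T0 (a t (g v))" by (simp add: gT g'(6))
      then have "T (inv g (a t (g v))) = inv g (T0 (a t (g v)))" using g'(5) by metis
      then show ?thesis by (simp add: k_def gT aT0 flip: T_def)
    qed
    have "s = t" if "k s = k t" for s t
    proof -
      \<comment> \<open>The vector \<open>inv g r\<close> separates the parameters: r lies in R,
        where \<open>a t\<close> is multiplication by t.\<close>
      have "k s (inv g r) = k t (inv g r)" using that by simp
      then have "a s r = a t r" using g'(6) by (simp add: k_def) metis
      moreover have "a t r = sF t r" for t
      proof -
        have "r = \<pi> r" using \<pi>id[OF R(3)] by simp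
        then have "\<sigma> r = 0" "\<kappa> r = 0" "\<pi> r = r" using idem(3)[of r] idk(2)[of r] by simp_all
        then show ?thesis by (simp add: a_def sF_def)
      qed
      ultimately show ?thesis using R(4) by simp
    qed
    then show "inj_on k (- {0})" by (rule inj_onI)
  qed
  then show False using st by (simp add: lie_stable_def)
qed

lemma stable_imp_cyclic:
  assumes \<tau>: "\<tau> \<in> dualG" and st: "lie_stable G.L HU \<tau>"
  shows "cyclic (G.rep \<tau>) e UNIV"
proof (rule ccontr)
  let ?T = "G.rep \<tau>"
  note TL = G.rep_in_L[OF \<tau>]
  assume "\<not> ?thesis"
  then have "\<not> cyclic ?T e (range (\<lambda>v. v))" by simp
  then obtain N where N: "subspace N" "\<And>v. v \<in> N \<Longrightarrow> ?T v \<in> N" "N \<noteq> {0}" "\<And>v. v \<in> N \<Longrightarrow> form v e = 0"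
    using G.not_cyclic_imp_orth[OF TL refl] by metis
  let ?R = "N \<inter> orth form N"
  show False
  proof (cases "?R \<subseteq> {0}")
    case True
    then show ?thesis using unstable_nondegenerate[OF \<tau> N True] st by (simp add: lie_stable_def)
  next
    case False
    then obtain r where r: "r \<in> ?R" "r \<noteq> 0" by blast
    have "form (?T v) w = 0" if "v \<in> orth form N" "w \<in> N" for v w
      using that N(2) by (simp add: G.L_D(2)[OF TL] orth_def)
    then have TR: "?T v \<in> ?R" if "v \<in> ?R" for v
      using that N(2) by (auto simp: orth_def)
    have sub: "subspace ?R" using N(1) subspace_orth by (rule subspace_inter)
    have "\<not> lie_stable G.L HU \<tau>"
    proof (rule unstable_isotropic[OF \<tau> sub TR r])
      show "form v w = 0" if "v \<in> ?R" "w \<in> ?R" for v w using that by (auto simp: orth_def)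
      show "form v e = 0" if "v \<in> ?R" for v using that N(4) by blast
    qed
    then show ?thesis using st by simp
  qed
qed

end

subsection \<open>Cyclicity and the bilinear form\<close>

context hermitian_summand
begin

text \<open>An element of \<open>CT T\<close> is determined by its value at u, and
  \<open>cyclic_fill\<close> attains that value in A. This is the equality of the commutant with
  E[T], in the form of an induction principle.\<close>

lemma CT_induct:
  assumes cyc: "cyclic T u (range P)" and T: "T \<in> EndP" and u: "P u = u" and A: "A \<subseteq> CT T"
    "P \<in> A" "\<And>x y. x \<in> A \<Longrightarrow> y \<in> A \<Longrightarrow> (\<lambda>v. x v + y v) \<in> A"
    "\<And>a x. x \<in> A \<Longrightarrow> (\<lambda>v. scl a (x v)) \<in> A" "\<And>x. x \<in> A \<Longrightarrow> (\<lambda>v. T (x v)) \<in> A"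
    and x: "x \<in> CT T"
  shows "x \<in> A"
proof -
  have xu: "P (x u) = x u" using x by (auto simp: CT_def EndP_def)
  obtain y where y: "y \<in> A" "y u = x u"
    using cyclic_fill[OF cyc u A(2-5) xu] by blast
  have "(\<lambda>v. x v - y v) = 0"
    by (rule cyclic_imp_eq_0[OF cyc _ _ EndP_D(1)[OF T]])
       (use CT_closed(3)[OF T x] A(1) y in auto)
  then have "x = y" by (simp add: fun_eq_iff)
  then show ?thesis using y(1) by simp
qed

lemma CT_commutative:
  assumes cyc: "cyclic T u (range P)" and T: "T \<in> EndP" and u: "P u = u"
    and x: "x \<in> CT T" and y: "y \<in> CT T"
  shows "x (y v) = y (x v)"
proof -
  let ?A = "{x \<in> CT T. \<forall>v. x (y v) = y (x v)}"
  have yE: "y \<in> EndP" and yT: "\<And>v. y (T v) = T (y v)" using y by (auto simp: CT_def)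
  note hy = EndP_D[OF yE]
  have "x \<in> ?A"
  proof (rule CT_induct[OF cyc T u _ _ _ _ _ x])
    show "P \<in> ?A" using CT_closed(1)[OF T] by (simp add: hy)
    show "(\<lambda>v. x v + x' v) \<in> ?A" if "x \<in> ?A" "x' \<in> ?A" for x x'
      using that CT_closed(2)[OF T] by (simp add: hom_add[OF hy(1)])
    show "(\<lambda>v. scl a (x v)) \<in> ?A" if "x \<in> ?A" for x a
      using that CT_closed(4)[OF T] by (simp add: hom_scale[OF hy(1)])
    show "(\<lambda>v. T (x v)) \<in> ?A" if "x \<in> ?A" for x
      using that CT_closed(5)[OF T] by (simp add: yT)
  qed blast
  then show ?thesis by blast
qed

end

context ggp_frame
begin

section \<open>Compression to the hyperplane and the algebra of a cyclic element\<close>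

definition TH :: "('v \<Rightarrow> 'v) \<Rightarrow> 'v \<Rightarrow> 'v" where "TH T v = PH (T (PH v))"

lemma TH_in_L:
  assumes "T \<in> G.L"
  shows "TH T \<in> HL.L"
proof (rule HL.L_I)
  show "hom (TH T)"
    unfolding TH_def[abs_def] by (rule hom_comp[OF hom_PH hom_comp[OF G.L_D(1)[OF assms] hom_PH]])
  show "form (TH T v) w = - form v (TH T w)" for v w
    by (simp add: TH_def HL.P_form G.L_D(2)[OF assms])
  show "TH T (PH v) = TH T v" for v by (simp add: TH_def)
qed

lemma restrict_in_dual:
  assumes "\<tau> \<in> dualG"
  shows "dual_restrict HL.L \<tau> \<in> lie_dual emb scl HL.L"
proof -
  have "x \<in> G.L" if "x \<in> HL.L" for x using that HL_L_iff by blast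
  then show ?thesis
    using assms by (simp add: lie_dual_def dual_restrict_def HL.L_plus HL.L_sE)
qed

lemma rep_restrict:
  assumes \<tau>: "\<tau> \<in> dualG"
  shows "HL.rep (dual_restrict HL.L \<tau>) = TH (G.rep \<tau>)"
proof (rule HL.rep_unique[OF restrict_in_dual[OF \<tau>] TH_in_L[OF G.rep_in_L[OF \<tau>]]])
  fix x assume x: "x \<in> HL.L"
  let ?T = "G.rep \<tau>"
  have xG: "x \<in> G.L" using x HL_L_iff by blast
  note hx = HL.L_D[OF x] and hT = G.L_D(1)[OF G.rep_in_L[OF \<tau>]]
  have "dual_restrict HL.L \<tau> (sE a x) = \<tau> (sE a x)" for a
    using HL.L_sE[OF x] by (simp add: dual_restrict_def)
  then have "pairing emb scl x (dual_restrict HL.L \<tau>) = pairing emb scl x \<tau>"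
    by (simp add: pairing_def)
  then have "emb (pairing emb scl x (dual_restrict HL.L \<tau>)) = tr (\<lambda>v. PH (x (?T v)))"
    using G.emb_pairing[OF \<tau> xG] by (simp add: hx)
  also have "\<dots> = tr (\<lambda>v. x (?T (PH v)))"
    using tr_commute[OF hom_PH hom_comp[OF hx(1) hT]] by simp
  finally show "emb (pairing emb scl x (dual_restrict HL.L \<tau>)) = tr (\<lambda>v. x (TH ?T v))"
    by (simp add: TH_def hx)
qed

text \<open>The preimage under \<open>PH\<close> of a stable submodule containing
  \<open>PH (T e)\<close> contains e and is T-stable, because T w differs from
  \<open>T (PH w)\<close> by a multiple of T e.\<close>

lemma cyclic_TH:
  assumes T: "T \<in> G.L" and cyc: "cyclic T e UNIV"
  shows "cyclic (TH T) (PH (T e)) (range PH)"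
  unfolding cyclic_def
proof (intro allI impI subsetI)
  fix S v assume S: "subspace S" "PH (T e) \<in> S" "\<forall>v\<in>S. TH T v \<in> S" and v: "v \<in> range PH"
  note hT = G.L_D(1)[OF T]
  let ?A = "{w. PH w \<in> S}"
  have "v \<in> ?A"
  proof (rule cyclicD[OF cyc])
    show "subspace ?A"
      using S(1) by (auto simp: subspace_def hom_0[OF hom_PH] hom_add[OF hom_PH] hom_scale[OF hom_PH])
    show "e \<in> ?A" using subspace_0[OF S(1)] by simp
    show "T w \<in> ?A" if w: "w \<in> ?A" for w
    proof -
      have "T w = T (PH w) + scl (form w e * qi) (T e)"
        using hom_add[OF hT, of "PH w" "Q w"] hom_scale[OF hT, of "form w e * qi" e]
        by (simp add: PH_plus_Q) (simp add: Q_def)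
      then have "PH (T w) = TH T (PH w) + scl (form w e * qi) (PH (T e))"
        by (simp add: hom_add[OF hom_PH] hom_scale[OF hom_PH] TH_def)
      then show ?thesis
        using S w by (auto intro!: subspace_add[OF S(1)] subspace_scale[OF S(1)])
    qed
  qed simp
  then show "v \<in> S" using v HL.in_range_P by simp
qed

context
  fixes T assumes T: "T \<in> G.L" and cyc: "cyclic T e UNIV"
begin

private lemma cycR: "cyclic T e (range (\<lambda>v. v))" using cyc by simp

private lemma TE: "T \<in> G.EndP" using T G.L_subset_EndP by blast

private lemma cycH: "cyclic (TH T) (PH (T e)) (range PH)" by (rule cyclic_TH[OF T cyc])

private lemma THL: "TH T \<in> HL.L" by (rule TH_in_L[OF T])

private lemma THE: "TH T \<in> HL.EndP" using THL HL.L_subset_EndP by blast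

text \<open>The element p(T) with p(T) e = v; through it V is identified with the commutative
  algebra \<open>CT T\<close>.\<close>

private definition X :: "'v \<Rightarrow> 'v \<Rightarrow> 'v" where "X v = (SOME x. x \<in> G.CT T \<and> x e = v)"

private lemma X: "X v \<in> G.CT T" "X v e = v"
proof -
  have "\<exists>x. x \<in> G.CT T \<and> x e = v"
    using G.cyclic_ex_commuting[OF cycR TE refl refl, of v] by blast
  from someI_ex[OF this] show "X v \<in> G.CT T" "X v e = v" unfolding X_def by auto
qed

private lemma CT_D:
  assumes "x \<in> G.CT T"
  shows "hom x" "x (T v) = T (x v)"
  using assms by (auto simp: G.CT_def G.EndP_def)

private lemma CT_I: "hom x \<Longrightarrow> (\<And>v. x (T v) = T (x v)) \<Longrightarrow> x \<in> G.CT T"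
  by (auto simp: G.CT_def G.EndP_def)

private lemma CT_eqI:
  assumes "x \<in> G.CT T" "y \<in> G.CT T" "x e = y e"
  shows "x = y"
proof -
  have "(\<lambda>v. x v - y v) = 0"
    by (rule G.cyclic_imp_eq_0[OF cycR G.CT_closed(3)[OF TE assms(1,2)] _ G.L_D(1)[OF T]])
       (simp add: assms(3))
  then show ?thesis by (simp add: fun_eq_iff)
qed

private lemma CT_comm: "x \<in> G.CT T \<Longrightarrow> y \<in> G.CT T \<Longrightarrow> x (y v) = y (x v)"
  by (rule G.CT_commutative[OF cycR TE refl])

text \<open>
  The symmetric bilinear form \<open>(p(T) e, q(T) e) \<mapsto> \<langle>p(T) q(T) e, e\<rangle>\<close>, for which \<open>T\<close> and the
  projections onto \<open>E e\<close> and \<open>V\<^sub>H\<close> are self-adjoint.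
\<close>
private definition bf :: "'v \<Rightarrow> 'v \<Rightarrow> 'e" where "bf v w = form (X v w) e"

private lemma X_eqI: "x \<in> G.CT T \<Longrightarrow> x e = v \<Longrightarrow> X v = x"
  using CT_eqI X by metis

private lemma X_add: "X (v + w) u = X v u + X w u"
proof -
  have "X (v + w) = (\<lambda>u. X v u + X w u)"
    by (rule X_eqI) (auto intro!: CT_I hom_plus simp: X CT_D[OF X(1)] hom_add[OF G.L_D(1)[OF T]])
  then show ?thesis by simp
qed

private lemma X_scale: "X (scl a v) u = scl a (X v u)"
proof -
  have "X (scl a v) = (\<lambda>u. scl a (X v u))"
    by (rule X_eqI) (auto intro!: CT_I hom_scl simp: X CT_D[OF X(1)] hom_scale[OF G.L_D(1)[OF T]])
  then show ?thesis by simp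
qed

private lemma X_e: "X e u = u"
proof -
  have "X e = (\<lambda>u. u)" by (rule X_eqI) (auto intro!: CT_I hom_ident)
  then show ?thesis by simp
qed

private lemma bf_linear:
  "bf (v + w) u = bf v u + bf w u" "bf u (v + w) = bf u v + bf u w"
  "bf (scl a v) u = a * bf v u" "bf u (scl a v) = a * bf u v"
  by (simp_all add: bf_def X_add X_scale form_add form_scale hom_add[OF CT_D(1)[OF X(1)]]
      hom_scale[OF CT_D(1)[OF X(1)]])

private lemma bf_e: "bf v e = form v e" "bf e v = form v e"
  by (simp_all add: bf_def X X_e)

private lemma bf_CT:
  assumes x: "x \<in> G.CT T"
  shows "bf (x v) w = bf v (x w)"
proof -
  have "X (x v) = (\<lambda>u. x (X v u))"
    by (rule X_eqI)
       (auto intro!: CT_I hom_comp[OF CT_D(1)[OF x] CT_D(1)[OF X(1)]] simp: X CT_D(2)[OF X(1)] CT_D(2)[OF x])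
  then show ?thesis by (simp add: bf_def CT_comm[OF x X(1)])
qed

text \<open>The vector e is the unit of the algebra, so \<open>bf\<close> with e on either side is
  <v, e>; this makes the projection \<open>Q\<close> onto the line of e self-adjoint.\<close>

private lemma bf_PH: "bf (PH v) w = bf v (PH w)"
proof -
  have "bf (Q v) w = bf v (Q w)"
    by (simp add: Q_def bf_linear bf_e ac_simps)
  moreover have "bf (PH v) w + bf (Q v) w = bf v w" "bf v (PH w) + bf v (Q w) = bf v w"
    using bf_linear(1)[of "PH v" "Q v" w] bf_linear(2)[of v "PH w" "Q w"] by (simp_all add: PH_plus_Q)
  ultimately show ?thesis by (metis add_right_cancel)
qed

private lemma T_CT: "T \<in> G.CT T"
  by (rule CT_I) (simp_all add: G.L_D(1)[OF T])

text \<open>Self-adjointness of \<open>TH T\<close> propagates to its whole commutant by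
  \<open>CT_induct\<close>.\<close>

private lemma bf_HCT:
  assumes y: "y \<in> HL.CT (TH T)"
  shows "bf (y v) w = bf v (y w)"
proof -
  let ?A = "{y \<in> HL.CT (TH T). \<forall>v w. bf (y v) w = bf v (y w)}"
  have TH: "bf (TH T v) w = bf v (TH T w)" for v w
    by (simp add: TH_def bf_PH bf_CT[OF T_CT])
  have "y \<in> ?A"
  proof (rule HL.CT_induct[OF cycH THE _ _ _ _ _ _ y])
    note closed = HL.CT_closed[OF THE]
    show "PH \<in> ?A" using closed(1) by (simp add: bf_PH)
    show "(\<lambda>v. x v + x' v) \<in> ?A" if "x \<in> ?A" "x' \<in> ?A" for x x'
      using that closed(2) by (simp add: bf_linear)
    show "(\<lambda>v. scl a (x v)) \<in> ?A" if "x \<in> ?A" for x a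
      using that closed(4) by (simp add: bf_linear)
    show "(\<lambda>v. TH T (x v)) \<in> ?A" if "x \<in> ?A" for x
      using that closed(5) by (auto simp: TH HL.CT_def)
  qed auto
  then show ?thesis by blast
qed

private lemma LT_CT: "x \<in> G.LT T \<Longrightarrow> x \<in> G.CT T" "y \<in> HL.LT (TH T) \<Longrightarrow> y \<in> HL.CT (TH T)"
  using G.LT_subset_CT HL.LT_subset_CT by blast+

text \<open>Self-adjointness for \<open>bf\<close> reverses words: <x y T e, e> = <T y x e, e>.
  Skewness for the hermitian form turns this into the claim. It is what lets a vanishing trace in F
  detect the \<open>E\<close>-valued product.\<close>

lemma cyclic_form_skew:
  assumes x: "x \<in> G.LT T" and y: "y \<in> HL.LT (TH T)"
  shows "cj (form (y (T e)) (x e)) = - form (y (T e)) (x e)"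
proof -
  have xL: "x \<in> G.L" and yL: "y \<in> G.L" using x y HL_L_iff by (auto simp: G.LT_def HL.LT_def)
  have "bf (x (y (T e))) e = bf e (T (y (x e)))"
    by (simp add: bf_CT[OF LT_CT(1)[OF x]] bf_CT[OF T_CT] bf_HCT[OF LT_CT(2)[OF y]])
  then have "form (x (y (T e))) e = form (T (y (x e))) e" by (simp add: bf_e)
  then have "- form (y (T e)) (x e) = form (x e) (y (T e))"
    using G.L_D(2)[OF xL, of "y (T e)" e] G.L_D(2)[OF yL, of "x e" "T e"] G.L_D(2)[OF T, of "y (x e)" e]
    by simp
  then show ?thesis using form_cj[of "x e" "y (T e)"] by simp
qed

text \<open>The vectors y (T e) span \<open>V\<^sub>H\<close> over \<open>E\<close>, so x e is a
  multiple of e; commuting with the cyclic T, x is then that scalar.\<close>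

lemma cyclic_left_radical:
  assumes x: "x \<in> G.LT T" and 0: "\<And>y. y \<in> HL.LT (TH T) \<Longrightarrow> form (y (T e)) (x e) = 0"
  shows "x \<in> lie_center G.L"
proof -
  have "form (PH w) (x e) = 0" for w
  proof -
    have "\<exists>y\<in>HL.CT (TH T). y (PH (T e)) = PH w"
      by (rule HL.cyclic_ex_commuting[OF cycH THE]) simp_all
    then obtain y where y: "y \<in> HL.CT (TH T)" "y (PH (T e)) = PH w" by blast
    obtain y1 y2 where d: "y1 \<in> HL.LT (TH T)" "y2 \<in> HL.LT (TH T)" "\<And>v. y v = y1 v + scl \<delta> (y2 v)"
      using HL.CT_decompose[OF y(1) THL] by metis
    have "y (PH (T e)) = y (T e)" using y(1) by (auto simp: HL.CT_def HL.EndP_def)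
    then show ?thesis
      using y(2) 0[OF d(1)] 0[OF d(2)] d(3)[of "T e"] by (metis form_add form_scale add_0 mult_zero_right)
  qed
  then have "PH (x e) = 0" by (intro form_eqI2) (simp flip: HL.P_form)
  then have xe: "x e = scl (form (x e) e * qi) e" using PH_plus_Q[of "x e"] by (simp add: Q_def)
  have xs: "x = (\<lambda>v. scl (form (x e) e * qi) v)"
    by (rule CT_eqI[OF LT_CT(1)[OF x]])
       (use xe in \<open>auto intro!: CT_I hom_scl_self simp: hom_scale[OF G.L_D(1)[OF T]]\<close>)
  have "lie_bracket x y = 0" if "y \<in> G.L" for y
    by (subst xs) (auto simp: lie_bracket_def hom_scale[OF G.L_D(1)[OF that]])
  then show ?thesis using x by (auto simp: lie_center_def G.LT_def)
qed

lemma cyclic_right_radical: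
  assumes y: "y \<in> HL.LT (TH T)" and 0: "\<And>x. x \<in> G.LT T \<Longrightarrow> form (y (T e)) (x e) = 0"
  shows "y = 0"
proof (rule HL.cyclic_imp_eq_0[OF cycH LT_CT(2)[OF y] _ HL.L_D(1)[OF THL]])
  have "form (y (T e)) w = 0" for w
  proof -
    obtain x1 x2 where d: "x1 \<in> G.LT T" "x2 \<in> G.LT T" "\<And>v. X w v = x1 v + scl \<delta> (x2 v)"
      using G.CT_decompose[OF X(1) T] by metis
    have "w = x1 e + scl \<delta> (x2 e)" using d(3)[of e] X(2) by simp
    then show ?thesis using 0[OF d(1)] 0[OF d(2)] by (simp add: form_add_right form_scale_right)
  qed
  then have "y (T e) = 0" by (rule form_nondegenerate)
  then show "y (PH (T e)) = 0" using y by (auto simp: HL.LT_def HL.L_def)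
qed

end

text \<open>Commuting with all \<open>rk u v\<close> gives <w, u> z v = <z w, u> v on
  \<open>V\<^sub>H\<close>. Contracting w and u along the frame makes z a scalar, and skewness puts
  that scalar in F \<open>\<delta>\<close>.\<close>

lemma lie_center_scalar:
  assumes z: "z \<in> lie_center HL.L" "z \<noteq> 0"
  obtains s where "s \<noteq> 0" "\<And>v. z v = scl (emb s * \<delta>) (PH v)"
proof -
  have zL: "z \<in> HL.L" and zc: "\<And>y. y \<in> HL.L \<Longrightarrow> lie_bracket z y = 0"
    using z by (auto simp: lie_center_def)
  note hz = HL.L_D[OF zL]
  have key: "scl (form w u) (z v) = scl (form (z w) u) v" if u: "PH u = u" and v: "PH v = v" for u v w
  proof -
    have c: "z (rk u v' w) = rk u v' (z w)" if "PH v' = v'" for v'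
      using fun_cong[OF zc[OF HL.rk_in_L[OF u that]], of w] by (simp add: lie_bracket_def)
    have 1: "scl (form w u) (z v) - scl (form w v) (z u) = scl (form (z w) u) v - scl (form (z w) v) u"
      using c[OF v] by (simp add: rk_def hom_diff[OF hz(1)] hom_scale[OF hz(1)])
    \<comment> \<open>Replacing v by \<open>\<delta>\<close> v changes the sign of the second terms;
      adding both relations isolates the terms in <w, u>.\<close>
    have "scl \<delta> (scl (form w u) (z v) + scl (form w v) (z u)) = scl \<delta> (scl (form (z w) u) v + scl (form (z w) v) u)"
      using c[of "scl \<delta> v"] v
      by (simp add: rk_def hom_add[OF hz(1)] hom_scale[OF hz(1)] hom_scale[OF hom_PH] form_scale_right
          cj_\<delta> scale_right_distrib ac_simps)
    then have "scl \<delta>i (scl \<delta> (scl (form w u) (z v) + scl (form w v) (z u)))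
      = scl \<delta>i (scl \<delta> (scl (form (z w) u) v + scl (form (z w) v) u))" by (rule arg_cong)
    then have 2: "scl (form w u) (z v) + scl (form w v) (z u) = scl (form (z w) u) v + scl (form (z w) v) u"
      by (simp only: scl_\<delta>_\<delta>i)
    let ?a = "scl (form w u) (z v)" and ?b = "scl (form (z w) u) v"
    have "(?a - scl (form w v) (z u)) + (?a + scl (form w v) (z u)) = (?b - scl (form (z w) v) u) + (?b + scl (form (z w) v) u)"
      by (simp only: 1 2)
    then have "?a + ?a = ?b + ?b" by (simp add: algebra_simps)
    then have "scl (emb (1 / 2)) (?a + ?a) = scl (emb (1 / 2)) (?b + ?b)" by (rule arg_cong)
    then show ?thesis by (simp only: scale_right_distrib scl_half)
  qed
  have sum: "scl (tr PH) (z v) = scl (tr z) v" if v: "PH v = v" for v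
  proof -
    have "scl (tr PH) (z v) = (\<Sum>b\<in>B. scl (form b (PH (d b))) (z v))"
      by (simp add: tr_def scale_sum_left HL.P_form)
    also have "\<dots> = (\<Sum>b\<in>B. scl (form (z b) (PH (d b))) v)"
      by (intro sum.cong refl key v) simp
    also have "\<dots> = scl (tr z) v"
      by (simp add: tr_def scale_sum_left hz flip: HL.P_form)
    finally show ?thesis .
  qed
  have "Q = (\<lambda>v. scl (form v (scl qi e)) e)"
    by (auto simp: Q_def form_scale_right cj_qi mult.commute)
  then have "tr Q = 1" using tr_rank1[of "scl qi e" e] form_e_qi by (simp add: form_scale_right cj_qi mult.commute)
  then have trP: "tr PH = of_nat (card B) - 1"
    unfolding PH_def by (simp add: tr_diff tr_ident)
  have "card B \<noteq> 0"
  proof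
    assume "card B = 0"
    then have "B = {}" using finite_B by simp
    then have "v = 0" for v :: 'v using frame[of v] by simp
    then have "z = 0" by (intro ext) simp
    then show False using z(2) by simp
  qed
  moreover have "card B \<noteq> 1"
  proof
    assume "card B = 1"
    then obtain b where b: "B = {b}" using card_1_singletonE by blast
    have fr: "v = scl (form v (d b)) b" for v using frame[of v] b by simp
    define c where "c = form e (d b)"
    have ec: "e = scl c b" unfolding c_def by (rule fr)
    have "c * (form b e * qi) = 1" using form_e_qi by (subst (asm) (1) ec) (simp add: form_scale mult.assoc)
    then have "Q b = b" by (subst Q_def, subst (2) ec) (simp add: mult.commute)
    then have "PH b = 0" by (simp add: PH_def)
    then have "PH v = 0" for v using hom_scale[OF hom_PH, of "form v (d b)" b] fr[of v] by simp
    then have "z = 0" using hz(3) hom_0[OF hz(1)] by (intro ext) (metis zero_fun_apply)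
    then show False using z(2) by simp
  qed
  \<comment> \<open>A nonzero z rules out rank 0 and 1 of V, so the rank n of
    \<open>V\<^sub>H\<close> is invertible in F.\<close>
  ultimately obtain n where n: "card B = n + 1" "n \<noteq> 0" by (metis add.commute add.left_neutral not0_implies_Suc plus_1_eq_Suc)
  then have trP: "tr PH = emb (of_nat n)" using trP by (simp add: emb_of_nat)
  define a where "a = emb (1 / of_nat n) * tr z"
  have ni: "emb (1 / of_nat n) * emb (of_nat n) = 1" using n(2) by (simp add: emb_one flip: emb_mult)
  have za: "z v = scl a (PH v)" for v
  proof -
    have "scl (tr PH) (z (PH v)) = scl (tr z) (PH v)" by (rule sum) simp
    then have "scl (emb (1 / of_nat n)) (scl (tr PH) (z (PH v))) = scl (emb (1 / of_nat n)) (scl (tr z) (PH v))"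
      by simp
    then show ?thesis by (simp add: trP ni hz a_def)
  qed
  have "(a + cj a) * form (PH v) w = 0" for v w
    using hz(2)[of v w] by (simp add: za form_scale form_scale_right HL.P_form distrib_right)
  then have "(\<Sum>b\<in>B. (a + cj a) * form (PH b) (d b)) = 0" by simp
  then have "(a + cj a) * tr PH = 0" by (simp only: tr_def sum_distrib_left)
  then have "(a + cj a) * (emb (1 / of_nat n) * emb (of_nat n)) = 0"
    unfolding trP by (metis mult.left_commute mult_zero_right)
  then have sk: "a + cj a = 0" by (simp add: ni)
  obtain p q where a: "a = emb p + emb q * \<delta>" using gen_\<delta> by blast
  have "emb p + emb p = 0" using sk by (simp add: a cj_add cj_mult cj_emb cj_\<delta>)
  then have "emb p = 0" by (simp only: add_self_eq_0_iff)
  then have aq: "a = emb q * \<delta>" using a by simp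
  have "q \<noteq> 0"
  proof
    assume "q = 0"
    then have "z = 0" using za aq by (intro ext) simp
    then show False using z(2) by simp
  qed
  then show ?thesis using that za aq by blast
qed

section \<open>The bilinear form attached to a central element\<close>

context
  fixes \<tau> T z s
  assumes \<tau>: "\<tau> \<in> dualG" and T_def: "T = G.rep \<tau>"
    and s: "s \<noteq> 0" and z: "\<And>v. z v = scl (emb s * \<delta>) (PH v)"
begin

private lemma TL: "T \<in> G.L" unfolding T_def by (rule G.rep_in_L[OF \<tau>])

text \<open>z is a scalar on \<open>V\<^sub>H\<close> and kills e, so its bracket with m = [x, y]
  only retains the components of m between the line of e and \<open>V\<^sub>H\<close>: a rank two
  map, to which \<open>tr_rk\<close> applies. Moreover m e = - y (x e), because y kills e.\<close>

lemma pairing_double_bracket: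
  assumes x: "x \<in> G.L" and y: "y \<in> HL.L"
  shows "pairing emb scl (lie_bracket z (lie_bracket x y)) \<tau>
    = tre (emb s * \<delta> * qi * form (y (T e)) (x e))"
proof -
  let ?c = "emb s * \<delta> * qi"
  have yG: "y \<in> G.L" "y e = 0" using y HL_L_iff by auto
  have cjc: "cj ?c = - ?c" by (simp add: cj_mult cj_emb cj_\<delta> cj_qi)
  define m where "m = lie_bracket x y"
  have m: "m \<in> G.L" unfolding m_def by (rule G.L_bracket[OF x yG(1)])
  note hm = G.L_D[OF m]
  have "lie_bracket z m = rk (m e) (scl ?c e)"
  proof
    fix w
    have "lie_bracket z m w = scl (emb s * \<delta>) (m (Q w) - Q (m w))"
      by (simp add: lie_bracket_def z PH_def hom_diff[OF hm(1)] hom_scale[OF hm(1)] algebra_simps)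
    also have "\<dots> = scl (emb s * \<delta>) (scl (form w e * qi) (m e) + scl (form w (m e) * qi) e)"
      by (simp add: Q_def hom_scale[OF hm(1)] hm(2))
    also have "\<dots> = rk (m e) (scl ?c e) w"
      unfolding rk_def form_scale_right cjc by (simp add: scale_right_distrib ac_simps)
    finally show "lie_bracket z m w = rk (m e) (scl ?c e) w" .
  qed
  moreover have "rk (m e) (scl ?c e) \<in> G.L" by (rule G.rk_in_L) simp_all
  ultimately have "emb (pairing emb scl (lie_bracket z m) \<tau>) = tr (\<lambda>v. rk (m e) (scl ?c e) (T v))"
    using G.emb_pairing[OF \<tau>] by (simp add: T_def)
  also have "\<dots> = emb (tre (form (T (scl ?c e)) (m e)))"
    by (rule tr_rk[OF G.L_D(1)[OF TL]]) (simp add: G.L_D(2)[OF TL])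
  also have "form (T (scl ?c e)) (m e) = ?c * form (y (T e)) (x e)"
    using G.L_D(2)[OF yG(1), of "T e" "x e"]
    by (simp add: m_def lie_bracket_def yG(2) hom_0[OF G.L_D(1)[OF x]] hom_scale[OF G.L_D(1)[OF TL]]
        form_scale form_minus)
  finally show ?thesis by (simp add: emb_inj m_def)
qed

private abbreviation b where
  "b x y \<equiv> pairing emb scl (lie_bracket z (lie_bracket x y)) \<tau>"

private lemma LT_L: "x \<in> G.LT T \<Longrightarrow> x \<in> G.L" "y \<in> HL.LT (TH T) \<Longrightarrow> y \<in> HL.L"
  by (auto simp: G.LT_def HL.LT_def)

private lemma bracket_z_0: "lie_bracket z 0 = 0"
  by (auto simp: lie_bracket_def z hom_0[OF hom_PH])

private lemma center_radical:
  assumes x: "x \<in> lie_center G.L"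
  shows "x \<in> G.LT T" "y \<in> HL.L \<Longrightarrow> b x y = 0"
proof -
  have xL: "x \<in> G.L" and c: "\<And>y. y \<in> G.L \<Longrightarrow> lie_bracket x y = 0" using x by (auto simp: lie_center_def)
  show "x \<in> G.LT T" using xL c[OF TL] by (auto simp: G.LT_def lie_bracket_def fun_eq_iff)
  show "b x y = 0" if "y \<in> HL.L"
    using c[of y] that HL_L_iff bracket_z_0 G.pairing_0[OF \<tau>] by simp
qed

lemma cyclic_nondegenerate:
  assumes cyc: "cyclic T e UNIV"
  shows "nondegenerate_mod (G.LT T) (lie_center G.L) (HL.LT (TH T)) b"
proof -
  \<comment> \<open>The involution negates both the coefficient \<open>?c\<close> and the product
    \<open>?k\<close>, so \<open>?c * ?k\<close> lies in F and its trace is twice itself;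
    \<open>?c\<close> is a unit.\<close>
  have b0: "form (y (T e)) (x e) = 0" if x: "x \<in> G.LT T" and y: "y \<in> HL.LT (TH T)" and "b x y = 0" for x y
  proof -
    let ?k = "form (y (T e)) (x e)" and ?c = "emb s * \<delta> * qi"
    have "tre (?c * ?k) = 0"
      using pairing_double_bracket[OF LT_L(1)[OF x] LT_L(2)[OF y]] \<open>b x y = 0\<close> by simp
    then have "?c * ?k + cj (?c * ?k) = 0" using emb_tre[of "?c * ?k"] by simp
    then have "?c * ?k + ?c * ?k = 0"
      by (simp add: cj_mult cj_emb cj_\<delta> cj_qi cyclic_form_skew[OF TL cyc x y])
    then have "?c * ?k = 0" by (simp only: add_self_eq_0_iff)
    then have "form e e * (emb (1 / s) * (\<delta>i * (?c * ?k))) = 0" by simp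
    moreover have "form e e * (emb (1 / s) * (\<delta>i * (?c * ?k)))
        = (form e e * qi) * ((emb (1 / s) * emb s) * ((\<delta> * \<delta>i) * ?k))"
      by (simp only: ac_simps)
    moreover have "emb (1 / s) * emb s = 1" using s by (simp add: emb_one flip: emb_mult)
    ultimately show ?thesis by (simp add: form_e_qi)
  qed
  show ?thesis
    unfolding nondegenerate_mod_def
  proof (intro conjI equalityI subsetI)
    fix x assume "x \<in> {x \<in> G.LT T. \<forall>y\<in>HL.LT (TH T). b x y = 0}"
    then show "x \<in> lie_center G.L" using b0 by (intro cyclic_left_radical[OF TL cyc]) auto
  next
    fix x assume "x \<in> lie_center G.L"
    then show "x \<in> {x \<in> G.LT T. \<forall>y\<in>HL.LT (TH T). b x y = 0}"
      using center_radical LT_L(2) by blast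
  next
    fix y assume "y \<in> {y \<in> HL.LT (TH T). \<forall>x\<in>G.LT T. b x y = 0}"
    then have "y = 0" using b0 by (intro cyclic_right_radical[OF TL cyc]) auto
    then show "y \<in> {0}" by simp
  next
    fix y :: "'v \<Rightarrow> 'v" assume "y \<in> {0}"
    then have y: "y = 0" by simp
    have "lie_bracket x 0 = 0" if "x \<in> G.L" for x
      using hom_0[OF G.L_D(1)[OF that]] by (auto simp: lie_bracket_def)
    then show "y \<in> {y \<in> HL.LT (TH T). \<forall>x\<in>G.LT T. b x y = 0}"
      using y bracket_z_0 G.pairing_0[OF \<tau>] LT_L(1)
        EF.subspace_0[OF HL.EF_subspace_LT[OF HL.L_D(1)[OF TH_in_L[OF TL]]]] by auto
  qed
qed

lemma nondegenerate_imp_cyclic: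
  assumes reg: "\<And>\<eta>. \<eta> \<in> HL.L \<Longrightarrow> EF.dim (HL.LT (TH T)) \<le> EF.dim (HL.LT \<eta>)"
    and rad: "\<And>x. x \<in> G.LT T \<Longrightarrow> (\<And>y. y \<in> HL.LT (TH T) \<Longrightarrow> b x y = 0) \<Longrightarrow> x \<in> lie_center G.L"
  shows "cyclic T e UNIV"
proof (rule ccontr)
  assume "\<not> ?thesis"
  then have "\<not> cyclic T e (range (\<lambda>v. v))" by simp
  then obtain N where N: "subspace N" "\<And>v. v \<in> N \<Longrightarrow> T v \<in> N" "N \<noteq> {0}" "\<And>v. v \<in> N \<Longrightarrow> form v e = 0"
    using G.not_cyclic_imp_orth[OF TL refl] by metis
  note THL = TH_in_L[OF TL]
  have THE: "TH T \<in> HL.EndP" using THL HL.L_subset_EndP by blast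
  have PN: "PH v = v" if "v \<in> N" for v using N(4)[OF that] by (simp add: PH_eq_self_iff)
  have TN: "TH T v = T v" if "v \<in> N" for v
    using PN[OF that] PN[OF N(2)[OF that]] by (simp add: TH_def)
  obtain r where r: "r \<in> N" "r \<noteq> 0" using N(3) subspace_0[OF N(1)] by blast
  have THN: "TH T v \<in> N" if "v \<in> N" for v using TN[OF that] N(2)[OF that] by simp
  obtain \<psi> where \<psi>: "\<psi> \<in> HL.CT (TH T)" "\<psi> \<noteq> 0" "\<And>v. \<psi> v \<in> N"
    using HL.ex_commuting_into[OF THE N(1) PN THN r] by blast
  have h\<psi>: "hom \<psi>" and \<psi>T: "\<And>v. \<psi> (TH T v) = TH T (\<psi> v)"
    using \<psi>(1) by (auto simp: HL.CT_def HL.EndP_def)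
  let ?N = "range \<psi>"
  have sub: "subspace ?N" using module_hom.subspace_image[OF h\<psi> subspace_UNIV] .
  \<comment> \<open>On N the compression agrees with T, so the image of \<psi> is stable under T
    itself.\<close>
  have TN1: "T v \<in> ?N" if v: "v \<in> ?N" for v
  proof -
    obtain w where "v = \<psi> w" using v by blast
    then have "T v = \<psi> (TH T w)" using TN[OF \<psi>(3)] \<psi>T by simp
    then show ?thesis by blast
  qed
  obtain \<psi>1 \<psi>2 where d: "\<psi>1 \<in> HL.LT (TH T)" "\<psi>2 \<in> HL.LT (TH T)" "\<And>v. \<psi> v = \<psi>1 v + scl \<delta> (\<psi>2 v)"
    using HL.CT_decompose[OF \<psi>(1) THL] by metis
  have yN: "y v \<in> ?N" if y: "y \<in> HL.LT (TH T)" and v: "v \<in> ?N" for y v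
  proof -
    obtain w where w: "v = \<psi> w" using v by blast
    have hy: "hom y" using HL.L_D(1)[OF LT_L(2)[OF y]] .
    have "y v = \<psi> (y w)"
      using HL.minimal_imp_abelian[OF THL reg y d(1), of w] HL.minimal_imp_abelian[OF THL reg y d(2), of w]
      by (simp add: w d(3) hom_add[OF hy] hom_scale[OF hy])
    then show ?thesis by blast
  qed
  obtain r' where r': "r' \<in> ?N" "r' \<noteq> 0" using \<psi>(2) by (auto simp: fun_eq_iff)
  have TE: "T \<in> G.EndP" using TL G.L_subset_EndP by blast
  obtain \<sigma> where \<sigma>: "\<sigma> \<in> G.CT T" "\<sigma> \<noteq> 0" "\<And>v. \<sigma> v \<in> ?N"
    using G.ex_commuting_into[OF TE sub refl TN1 r'] by blast
  have h\<sigma>: "hom \<sigma>" using \<sigma>(1) by (auto simp: G.CT_def G.EndP_def)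
  obtain x1 x2 where x: "x1 \<in> G.LT T" "x2 \<in> G.LT T" "\<And>v. \<sigma> v = x1 v + scl \<delta> (x2 v)"
    "\<And>v. adj \<sigma> v = - x1 v + scl \<delta> (x2 v)"
    using G.CT_decompose[OF \<sigma>(1) TL] by metis
  have Ne: "form v e = 0" if "v \<in> ?N" for v using that \<psi>(3) N(4) by blast
  have ae: "adj \<sigma> e = 0"
    by (rule form_eqI2) (simp add: Ne[OF \<sigma>(3)] flip: form_adj[OF h\<sigma>])
  \<comment> \<open>\<sigma> e need not vanish, but \<open>adj \<sigma> e = 0\<close> makes x1 e and
    x2 e multiples of \<sigma> e, which places both in the image of \<psi>.\<close>
  then have x12: "x1 e = scl \<delta> (x2 e)" using x(4)[of e] by simp
  then have "\<sigma> e = x1 e + x1 e" using x(3)[of e] by simp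
  then have "x1 e = scl (emb (1 / 2)) (\<sigma> e)" using scl_half[of "x1 e"] by (simp only: scale_right_distrib)
  then have x1N: "x1 e \<in> ?N" using subspace_scale[OF sub \<sigma>(3)] by simp
  have "x2 e = scl \<delta>i (x1 e)" using x12 by simp
  then have x2N: "x2 e \<in> ?N" using subspace_scale[OF sub x1N] by simp
  \<comment> \<open>Up to sign and conjugation, <y T e, x' e> is <T y x' e, e>. Both y and T
    preserve \<open>?N\<close>, which is orthogonal to e.\<close>
  have cen: "x' \<in> lie_center G.L" if x': "x' \<in> G.LT T" "x' e \<in> ?N" for x'
  proof (rule rad[OF x'(1)])
    fix y assume y: "y \<in> HL.LT (TH T)"
    have yG: "y \<in> G.L" using LT_L(2)[OF y] HL_L_iff by blast
    have "form (T (y (x' e))) e = 0" by (intro Ne TN1 yN[OF y] x'(2))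
    then have "form (y (x' e)) (T e) = 0" using G.L_D(2)[OF TL, of "y (x' e)" e] by simp
    then have "form (T e) (y (x' e)) = 0" using form_cj[of "T e" "y (x' e)"] by simp
    then have "form (y (T e)) (x' e) = 0" using G.L_D(2)[OF yG, of "T e" "x' e"] by simp
    then show "b x' y = 0"
      using pairing_double_bracket[OF LT_L(1)[OF x'(1)] LT_L(2)[OF y]] by simp
  qed
  have "adj \<sigma> v = 0" for v
  proof -
    \<comment> \<open>Central elements commute with \<open>rk e v\<close>, which sends e to <e, e> v
      up to a multiple of e. As \<open>adj \<sigma>\<close> kills e, it kills v as well.\<close>
    have "rk e v \<in> G.L" by (rule G.rk_in_L) simp_all
    then have "x1 (rk e v e) = rk e v (x1 e)" "x2 (rk e v e) = rk e v (x2 e)"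
      using cen[OF x(1) x1N] cen[OF x(2) x2N] by (auto simp: lie_center_def lie_bracket_def fun_eq_iff)
    then have "adj \<sigma> (rk e v e) = rk e v (adj \<sigma> e)"
      using x(4) by (simp add: hom_add[OF hom_rk] hom_diff[OF hom_rk] hom_minus[OF hom_rk] hom_scale[OF hom_rk])
    then have "adj \<sigma> (rk e v e) = 0" by (simp add: ae hom_0[OF hom_rk])
    then have "scl (form e e) (adj \<sigma> v) = 0"
      by (simp add: rk_def hom_diff[OF hom_adj[OF h\<sigma>]] hom_scale[OF hom_adj[OF h\<sigma>]] ae)
    then have "scl (form e e * qi) (adj \<sigma> v) = 0"
      by (metis mult.commute scale_scale scale_zero_right)
    then show ?thesis by (simp add: form_e_qi)
  qed
  then have "form (\<sigma> v) w = 0" for v w by (simp add: form_adj[OF h\<sigma>])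
  then have "\<sigma> = 0" using form_nondegenerate by (intro ext) (auto simp: zero_fun_def)
  then show False using \<sigma>(2) by blast
qed

end

theorem stable_iff:
  assumes \<tau>: "\<tau> \<in> dualG" and z: "z \<in> lie_center HL.L" "z \<noteq> 0"
  shows "lie_stable G.L HU \<tau> \<longleftrightarrow>
    lie_regular emb scl G.L \<tau> \<and> lie_regular emb scl HL.L (dual_restrict HL.L \<tau>) \<and>
    nondegenerate_mod (lie_centralizer G.L \<tau>) (lie_center G.L)
      (lie_centralizer HL.L (dual_restrict HL.L \<tau>))
      (\<lambda>x y. pairing emb scl (lie_bracket z (lie_bracket x y)) \<tau>)"
proof -
  let ?T = "G.rep \<tau>" and ?\<tau>H = "dual_restrict HL.L \<tau>"
  note TL = G.rep_in_L[OF \<tau>] and \<tau>H = restrict_in_dual[OF \<tau>]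
  obtain s where s: "s \<noteq> 0" "\<And>v. z v = scl (emb s * \<delta>) (PH v)"
    using lie_center_scalar[OF z] by metis
  have st: "lie_stable G.L HU \<tau> \<longleftrightarrow> cyclic ?T e UNIV"
    using cyclic_imp_stable[OF \<tau>] stable_imp_cyclic[OF \<tau>] by blast
  have cent: "lie_centralizer G.L \<tau> = G.LT ?T" "lie_centralizer HL.L ?\<tau>H = HL.LT (TH ?T)"
    using G.lie_centralizer_eq[OF \<tau>] HL.lie_centralizer_eq[OF \<tau>H] rep_restrict[OF \<tau>] by auto
  have reg: "lie_regular emb scl G.L \<tau> \<longleftrightarrow> (\<forall>\<eta>\<in>G.L. EF.dim (G.LT ?T) \<le> EF.dim (G.LT \<eta>))"
    "lie_regular emb scl HL.L ?\<tau>H \<longleftrightarrow> (\<forall>\<eta>\<in>HL.L. EF.dim (HL.LT (TH ?T)) \<le> EF.dim (HL.LT \<eta>))"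
    using G.lie_regular_iff[OF \<tau>] HL.lie_regular_iff[OF \<tau>H] rep_restrict[OF \<tau>] by auto
  show ?thesis
    unfolding st cent reg
  proof (intro iffI conjI ballI)
    assume cyc: "cyclic ?T e UNIV"
    show "EF.dim (G.LT ?T) \<le> EF.dim (G.LT \<eta>)" if "\<eta> \<in> G.L" for \<eta>
      using G.cyclic_dim_minimal[OF _ TL refl that] cyc by simp
    show "EF.dim (HL.LT (TH ?T)) \<le> EF.dim (HL.LT \<eta>)" if "\<eta> \<in> HL.L" for \<eta>
      by (rule HL.cyclic_dim_minimal[OF cyclic_TH[OF TL cyc] TH_in_L[OF TL] _ that]) simp
    show "nondegenerate_mod (G.LT ?T) (lie_center G.L) (HL.LT (TH ?T))
        (\<lambda>x y. pairing emb scl (lie_bracket z (lie_bracket x y)) \<tau>)"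
      by (rule cyclic_nondegenerate[OF \<tau> refl s cyc])
  next
    assume *: "(\<forall>\<eta>\<in>G.L. EF.dim (G.LT ?T) \<le> EF.dim (G.LT \<eta>)) \<and>
      (\<forall>\<eta>\<in>HL.L. EF.dim (HL.LT (TH ?T)) \<le> EF.dim (HL.LT \<eta>)) \<and>
      nondegenerate_mod (G.LT ?T) (lie_center G.L) (HL.LT (TH ?T))
        (\<lambda>x y. pairing emb scl (lie_bracket z (lie_bracket x y)) \<tau>)"
    show "cyclic ?T e UNIV"
    proof (rule nondegenerate_imp_cyclic[OF \<tau> refl s])
      show "EF.dim (HL.LT (TH ?T)) \<le> EF.dim (HL.LT \<eta>)" if "\<eta> \<in> HL.L" for \<eta>
        using * that by blast
      show "x \<in> lie_center G.L" if "x \<in> G.LT ?T"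
        "\<And>y. y \<in> HL.LT (TH ?T) \<Longrightarrow> pairing emb scl (lie_bracket z (lie_bracket x y)) \<tau> = 0" for x
        using * that unfolding nondegenerate_mod_def by blast
    qed
  qed
qed

end

text \<open>The dual basis consists of preimages of the basis vectors under v -> sum of <v, b> b, a
  map injective by nondegeneracy and hence surjective by counting over F.\<close>

lemma (in unitary_ggp) ex_ggp_frame: "\<exists>\<delta> D B d qi. ggp_frame emb cj scl form \<delta> D B d e qi"
proof -
  obtain \<delta> D where \<delta>: "cj \<delta> = - \<delta>" "\<delta> * \<delta> = emb D" "D \<noteq> 0" "\<And>x. \<exists>p q. x = emb p + emb q * \<delta>"
    using ex_skew_generator by blast
  obtain B where B: "finite B" "independent B" "span B = UNIV" using rank by blast
  obtain qi where qi: "form e e * qi = 1" using form_e_unit by (metis dvdE)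
  \<comment> \<open>The F-structure is set up by hand: \<open>hermitian_frame\<close>, which
    provides it, presupposes the dual basis under construction.\<close>
  define sc where "sc c v = scl (emb c) v" for c v
  interpret S: vector_space sc
    by unfold_locales (auto simp: sc_def emb_add emb_mult emb_one algebra_simps)
  have coord: "\<exists>r. v = (\<Sum>b\<in>B. scl (r b) b)" for v
    using span_finite[OF B(1)] B(3) by (metis (no_types, lifting) UNIV_I imageE)
  let ?D = "B \<union> scl \<delta> ` B"
  have gen: "v \<in> S.span ?D" for v
  proof -
    obtain r where r: "v = (\<Sum>b\<in>B. scl (r b) b)" using coord by blast
    have "scl (r b) b \<in> S.span ?D" if "b \<in> B" for b
    proof -
      obtain p q where "r b = emb p + emb q * \<delta>" using \<delta>(4) by blast
      then have "scl (r b) b = sc p b + sc q (scl \<delta> b)" by (simp add: sc_def algebra_simps)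
      also have "\<dots> \<in> S.span ?D"
        using that by (intro S.span_add S.span_scale S.span_base) auto
      finally show ?thesis .
    qed
    then show ?thesis unfolding r by (intro S.span_sum)
  qed
  define \<Psi> where "\<Psi> v = (\<Sum>b\<in>B. scl (form v b) b)" for v
  have lin: "Vector_Spaces.linear sc sc \<Psi>"
    unfolding Vector_Spaces.linear_iff using S.vector_space_axioms
    by (auto simp: \<Psi>_def sc_def form_add form_scale scale_left_distrib sum.distrib scale_sum_right)
  have indep: "r b = 0" if "(\<Sum>b\<in>B. scl (r b) b) = 0" "b \<in> B" for r b
    using independentD[OF B(2,1) order_refl that] .
  have "\<Psi> ` UNIV = UNIV"
  proof (rule S.injective_endo_surj_on[OF _ _ S.subspace_UNIV lin])
    show "finite ?D" using B(1) by simp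
    show "UNIV \<subseteq> S.span ?D" using gen by blast
    fix v assume "\<Psi> v = 0"
    then have 0: "form v b = 0" if "b \<in> B" for b
      using indep[of "form v"] that by (simp add: \<Psi>_def)
    show "v = 0"
    proof (rule form_nondegenerate)
      fix w
      obtain r where "w = (\<Sum>b\<in>B. scl (r b) b)" using coord by blast
      then show "form v w = 0" using 0 by (simp add: form_sum form_scale_right)
    qed
  qed simp
  then have "\<forall>b. \<exists>w. \<Psi> w = b" by (metis surjD)
  then obtain d where d: "\<And>b. \<Psi> (d b) = b" by metis
  have fd: "form (d b) c = (if c = b then 1 else 0)" if b: "b \<in> B" and c: "c \<in> B" for b c
  proof -
    have "(\<Sum>c\<in>B. scl (form (d b) c - (if c = b then 1 else 0)) c) = \<Psi> (d b) - (\<Sum>c\<in>B. scl (if c = b then 1 else 0) c)"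
      by (simp add: \<Psi>_def scale_left_diff_distrib sum_subtractf)
    also have "(\<Sum>c\<in>B. scl (if c = b then 1 else 0) c) = (\<Sum>c\<in>B. if c = b then c else 0)"
      by (rule sum.cong) auto
    also have "\<dots> = b" using b B(1) by simp
    finally have "(\<Sum>c\<in>B. scl (form (d b) c - (if c = b then 1 else 0)) c) = 0" by (simp add: d)
    from indep[OF this c] show ?thesis by simp
  qed
  have fd': "form c (d b) = (if c = b then 1 else 0)" if "b \<in> B" "c \<in> B" for b c
    using form_cj[of c "d b"] fd[OF that] by simp
  have "(\<Sum>b\<in>B. scl (form v (d b)) b) = v" for v
  proof -
    obtain r where r: "v = (\<Sum>b\<in>B. scl (r b) b)" using coord by blast
    have "form v (d b) = r b" if b: "b \<in> B" for b
    proof -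
      have "form v (d b) = (\<Sum>c\<in>B. r c * form c (d b))" by (simp add: r form_sum form_scale)
      also have "\<dots> = (\<Sum>c\<in>B. if c = b then r c else 0)"
        by (rule sum.cong) (auto simp: fd'[OF b])
      also have "\<dots> = r b" using b B(1) by simp
      finally show ?thesis .
    qed
    then show ?thesis by (simp add: r)
  qed
  then have "ggp_frame emb cj scl form \<delta> D B d e qi"
    using \<delta> B(1) fd' qi by unfold_locales auto
  then show ?thesis by blast
qed

theorem theorem18:
  fixes emb :: "'f::real_or_complex \<Rightarrow> 'e::comm_ring_1"
    and cj :: "'e \<Rightarrow> 'e"
    and scl :: "'e \<Rightarrow> 'v::ab_group_add \<Rightarrow> 'v"
    and form :: "'v \<Rightarrow> 'v \<Rightarrow> 'e"
    and n :: nat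
    and e :: 'v
    and \<tau> :: "('v \<Rightarrow> 'v) \<Rightarrow> complex"
    and z :: "'v \<Rightarrow> 'v"
    and \<gg> \<hh> H :: "('v \<Rightarrow> 'v) set"
    and \<tau>\<^sub>H :: "('v \<Rightarrow> 'v) \<Rightarrow> complex"
  defines "\<gg> \<equiv> unitary_lie scl form UNIV"
    and "\<hh> \<equiv> unitary_lie scl form (ggp_VH scl form e)"
    and "H \<equiv> unitary_group scl form (ggp_VH scl form e)"
    and "\<tau>\<^sub>H \<equiv> dual_restrict \<hh> \<tau>"
  assumes "unitary_ggp emb cj scl form n e"
    and "\<tau> \<in> lie_dual emb scl \<gg>"
    and "z \<in> lie_center \<hh>"
    and "z \<noteq> 0"
  shows "lie_stable \<gg> H \<tau> \<longleftrightarrow>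
    lie_regular emb scl \<gg> \<tau> \<and> lie_regular emb scl \<hh> \<tau>\<^sub>H \<and>
    nondegenerate_mod (lie_centralizer \<gg> \<tau>) (lie_center \<gg>) (lie_centralizer \<hh> \<tau>\<^sub>H)
      (\<lambda>x y. pairing emb scl (lie_bracket z (lie_bracket x y)) \<tau>)"
proof -
  obtain \<delta> D B d qi where "ggp_frame emb cj scl form \<delta> D B d e qi"
    using unitary_ggp.ex_ggp_frame[OF assms(5)] by blast
  then interpret ggp_frame emb cj scl form \<delta> D B d e qi .
  show ?thesis
    unfolding \<gg>_def \<hh>_def H_def \<tau>\<^sub>H_def unitary_lie_UNIV unitary_lie_VH unitary_group_VH
    by (rule stable_iff)
       (use assms(6-8) in \<open>simp_all add: \<gg>_def \<hh>_def unitary_lie_UNIV unitary_lie_VH\<close>)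
qed

end
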